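(* Let $(\xi,\eta;\lambda,\nu)\in(\mathbb Z/2\mathbb Z)^5\times\mathbb C^5$, where $\xi\in(\mathbb Z/2\mathbb Z)^3$, $\eta\in(\mathbb Z/2\mathbb Z)^2$, $\lambda\in\mathbb C^3$, $\nu\in\mathbb C^2$. The following conditions are equivalent: (i) $\mathrm{Diff}_{G_3'}(I(\xi,\lambda),J(\eta,\nu))\neq\{0\}$; (ii) $\dim_{\mathbb C}\mathrm{Diff}_{G_3'}(I(\xi,\lambda),J(\eta,\nu))\in\{1,2\}$; (iii) $(\xi,\eta;\lambda,\nu)\in\mathrm{Supp}_3(\mathbb D)$. Moreover, the dimension of this space is two if and only if $(\xi,\eta;\lambda,\nu)\in\mathrm{Supp}_{3,c}(\mathbb D)$.
   Context: $\mathbb N=\{0,1,2,\dots\}$; $[a,b]=\emptyset$ if $b<a$. $G=GL(3,\mathbb R)$, $G'=GL(2,\mathbb R)$; $P=MAN_+\subset G$ is the group of invertible upper triangular matrices, $M=\{\mathrm{diag}(\pm1,\pm1,\pm1)\}$, $A$ = positive diagonal matrices, $N_+$ = upper unipotent. For $\xi\in(\mathbb Z/2\mathbb Z)^3,\lambda\in\mathbb C^3$, $I(\xi,\lambda)=\mathrm{Ind}_P^G(\mathbb C_\xi\boxtimes\mathbb C_\lambda)$ is the unnormalized principal series: smooth $f$ on $G$ with $f(gman)=\prod_j m_j^{-\xi_j}\prod_j a_j^{-\lambda_j}f(g)$ for $m=\mathrm{diag}(m_j)\in M$, $a=\mathrm{diag}(a_j)\in A$, $n\in N_+$, with left translation.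 $J(\eta,\nu)$ ($\eta\in(\mathbb Z/2\mathbb Z)^2,\nu\in\mathbb C^2$) is the analogous principal series of $G'$ induced from its upper triangular subgroup $P'$. Let $\iota_3\begin{pmatrix}a&b\\c&d\end{pmatrix}=\begin{pmatrix}a&0&b\\0&1&0\\c&0&d\end{pmatrix}$, $G_3'=\iota_3(G')$, and regard $J(\eta,\nu)$ as a representation of $G_3'$. $\mathrm{Diff}_{G_3'}(I(\xi,\lambda),J(\eta,\nu))$ is the space of $G_3'$-intertwining differential operators $I(\xi,\lambda)\to J(\eta,\nu)$ (differential symmetry breaking operators), with respect to the natural map $G_3'/\iota_3(P')\to G/P$. $\Phi_3=\{(\lambda,\nu)\in\mathbb C^5:\nu_1-\lambda_1,\ \lambda_3-\nu_2\in\mathbb N\}$. Subsets: $\Phi_{3,a}$: those in $\Phi_3$ with $\nu_1-\nu_2-1\notin[1,\min(\nu_1-\lambda_1,\lambda_3-\nu_2)]\cap\mathbb Z$; $\Phi_{3,b}$: those with $\nu_1-\nu_2-1\in[1,\min(\nu_1-\lambda_1,\lambda_3-\nu_2)]\cap\mathbb Z$ and $\lambda_2-\nu_2\notin[1,\nu_1-\nu_2-1]\cap\mathbb Z$; $\Phi_{3,c}$: those with $\nu_1-\nu_2-1\in[1,\min(\nu_1-\lambda_1,\lambda_3-\nu_2)]\cap\mathbb Z$ and $\lambda_2-\nu_2\in[1,\nu_1-\nu_2-1]\cap\mathbb Z$. For $\omega\in\{a,b,c\}$, $\mathrm{Supp}_{3,\omega}(\mathbb D)=\{(\xi,\eta;\lambda,\nu)\in(\mathbb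 Z/2\mathbb Z)^5\times\Phi_{3,\omega}:\ \xi_1+\eta_1\equiv\nu_1-\lambda_1,\ \xi_3+\eta_2\equiv\lambda_3-\nu_2\bmod 2\}$, and $\mathrm{Supp}_3(\mathbb D)$ is the union of these three sets. *)

theory Defs
  imports "HOL-Analysis.Analysis" "HOL-Library.Z2" "HOL-Library.Function_Algebras"
begin

type_synonym mat3 = "real^3^3"
type_synonym mat2 = "real^2^2"

text \<open>
  Indices of \<^typ>\<open>3\<close> and \<^typ>\<open>2\<close> are addressed as \<open>1, 2, 3\<close> and \<open>1, 2\<close>. Since \<open>3 = 0\<close> in
  \<^typ>\<open>3\<close> (and \<open>2 = 0\<close> in \<^typ>\<open>2\<close>), the order of these types is never used: triangular matrices
  are written out entrywise.
\<close>

definition GL :: "(real^'n^'n) set"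
  where "GL = {g. invertible g}"

definition diag_mat :: "real^'n \<Rightarrow> real^'n^'n"
  where "diag_mat v = (\<chi> i j. if i = j then v $ i else 0)"

definition upper_unipotent3 :: "mat3 set"
  where "upper_unipotent3 =
    {vector [vector [1, x, y], vector [0, 1, z], vector [0, 0, 1]] | x y z. True}"

definition upper_unipotent2 :: "mat2 set"
  where "upper_unipotent2 = {vector [vector [1, x], vector [0, 1]] | x. True}"

definition iota3 :: "mat2 \<Rightarrow> mat3"
  where "iota3 h = vector
    [vector [h $ 1 $ 1, 0, h $ 1 $ 2],
     vector [0,         1, 0],
     vector [h $ 2 $ 1, 0, h $ 2 $ 2]]"


text \<open>Iterated directional derivatives, the last direction of the list being applied first.\<close>

fun dir_derivs :: "'a::real_normed_vector list \<Rightarrow> ('a \<Rightarrow> complex) \<Rightarrow> 'a \<Rightarrow> complex"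
  where
    "dir_derivs [] f = f"
  | "dir_derivs (v # vs) f = (\<lambda>x. frechet_derivative (dir_derivs vs f) (at x) v)"

text \<open>Smoothness, to be used on open sets \<open>S\<close> only: \<open>f\<close> may be arbitrary outside \<open>S\<close>.\<close>

definition smooth_on :: "'a::real_normed_vector set \<Rightarrow> ('a \<Rightarrow> complex) \<Rightarrow> bool"
  where "smooth_on S f \<longleftrightarrow> (\<forall>vs. \<forall>x\<in>S. dir_derivs vs f differentiable (at x))"


text \<open>\<open>sign_pow m e\<close> is \<open>m ^ e\<close> for \<open>m = \<plusminus>1\<close> and an exponent \<open>e\<close> modulo 2.\<close>

definition sign_pow :: "real \<Rightarrow> bit \<Rightarrow> complex"
  where "sign_pow m e = (if e = 1 then of_real m else 1)"

text \<open>
  The unnormalized principal series of \<open>GL\<close> induced from \<open>M A U\<close>, for a unipotent group \<open>U\<close>.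
  Its elements are functions on \<open>GL\<close>; they are extended by \<open>0\<close> to all matrices, so that
  equality of elements is equality of functions.
\<close>

definition principal_series ::
    "(real^'n^'n) set \<Rightarrow> bit^'n \<Rightarrow> complex^'n \<Rightarrow> (real^'n^'n \<Rightarrow> complex) set"
  where "principal_series U \<xi> l = {f.
    smooth_on GL f \<and>
    (\<forall>g. g \<notin> GL \<longrightarrow> f g = 0) \<and>
    (\<forall>g m a n. g \<in> GL \<and> (\<forall>j. m $ j \<in> {1, -1}) \<and> (\<forall>j. a $ j > 0) \<and> n \<in> U \<longrightarrow>
       f (g ** diag_mat m ** diag_mat a ** n) =
         (\<Prod>j\<in>UNIV. inverse (sign_pow (m $ j) (\<xi> $ j))) *
         (\<Prod>j\<in>UNIV. of_real (a $ j) powr (- (l $ j))) * f g)}"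

definition I_rep :: "bit^3 \<Rightarrow> complex^3 \<Rightarrow> (mat3 \<Rightarrow> complex) set"
  where "I_rep = principal_series upper_unipotent3"

definition J_rep :: "bit^2 \<Rightarrow> complex^2 \<Rightarrow> (mat2 \<Rightarrow> complex) set"
  where "J_rep = principal_series upper_unipotent2"

definition left_transl :: "real^'n^'n \<Rightarrow> (real^'n^'n \<Rightarrow> complex) \<Rightarrow> (real^'n^'n \<Rightarrow> complex)"
  where "left_transl g f = (\<lambda>x. f (matrix_inv g ** x))"


text \<open>
  An operator \<open>D\<close> defined on a space \<open>V\<close> of functions on \<open>GL(3,\<real>)\<close>, with values in functions on
  \<open>GL(2,\<real>)\<close>, is a differential operator along \<open>iota3\<close> if locally on \<open>GL(2,\<real>)\<close> the value of \<open>D f\<close>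
  at \<open>h\<close> is a combination, with smooth coefficients, of partial derivatives of \<open>f\<close> of bounded
  order at \<open>iota3 h\<close>. The matrix entries serve as coordinates on \<open>GL(3,\<real>)\<close>, so \<open>Basis\<close> is the set
  of elementary matrices. Sections of the bundles over the flag manifolds \<open>G/P\<close> and \<open>G'/P'\<close> being
  equivariant functions on the groups, for operators from \<open>I_rep\<close> to \<open>J_rep\<close> this is the notion of
  a differential operator with respect to the map \<open>G'/P' \<rightarrow> G/P\<close> induced by \<open>iota3\<close>.
\<close>

definition differential_op ::
    "(mat3 \<Rightarrow> complex) set \<Rightarrow> ((mat3 \<Rightarrow> complex) \<Rightarrow> (mat2 \<Rightarrow> complex)) \<Rightarrow> bool"
  where "differential_op V D \<longleftrightarrow>
    (\<forall>h0\<in>GL. \<exists>W N (c :: mat3 list \<Rightarrow> mat2 \<Rightarrow> complex).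
       open W \<and> h0 \<in> W \<and> W \<subseteq> GL \<and> (\<forall>vs. smooth_on W (c vs)) \<and>
       (\<forall>f\<in>V. \<forall>h\<in>W. D f h =
          (\<Sum>vs | set vs \<subseteq> Basis \<and> length vs \<le> N. c vs h * dir_derivs vs f (iota3 h))))"

text \<open>
  The space of differential symmetry breaking operators. An operator is extended by \<open>0\<close> to
  functions outside \<open>I_rep \<xi> l\<close>, so that it is determined by its restriction to \<open>I_rep \<xi> l\<close>.
\<close>

definition Diff_SBO ::
    "bit^3 \<Rightarrow> complex^3 \<Rightarrow> bit^2 \<Rightarrow> complex^2 \<Rightarrow> ((mat3 \<Rightarrow> complex) \<Rightarrow> (mat2 \<Rightarrow> complex)) set"
  where "Diff_SBO \<xi> l \<eta> \<nu> = {D.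
    (\<forall>f\<in>I_rep \<xi> l. D f \<in> J_rep \<eta> \<nu>) \<and>
    (\<forall>f. f \<notin> I_rep \<xi> l \<longrightarrow> D f = 0) \<and>
    (\<forall>f1\<in>I_rep \<xi> l. \<forall>f2\<in>I_rep \<xi> l. D (f1 + f2) = D f1 + D f2) \<and>
    (\<forall>z. \<forall>f\<in>I_rep \<xi> l. D (\<lambda>g. z * f g) = (\<lambda>h. z * D f h)) \<and>
    differential_op (I_rep \<xi> l) D \<and>
    (\<forall>h\<in>GL. \<forall>f\<in>I_rep \<xi> l. D (left_transl (iota3 h) f) = left_transl h (D f))}"

definition op_scale :: "complex \<Rightarrow> ('a \<Rightarrow> 'b \<Rightarrow> complex) \<Rightarrow> ('a \<Rightarrow> 'b \<Rightarrow> complex)"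
  where "op_scale z D = (\<lambda>f h. z * D f h)"

text \<open>
  \<open>op_space.dim\<close> is the complex dimension. It is \<open>0\<close> for infinite-dimensional spaces, so a
  positive value means finite dimension.
\<close>

global_interpretation op_space: vector_space "op_scale :: complex \<Rightarrow> ('a \<Rightarrow> 'b \<Rightarrow> complex) \<Rightarrow> _"
  by standard (auto simp: op_scale_def fun_eq_iff algebra_simps)


text \<open>The integers in the interval \<open>[a, b]\<close>, as complex numbers.\<close>

definition int_interval :: "real \<Rightarrow> real \<Rightarrow> complex set"
  where "int_interval a b = {z. z \<in> \<int> \<and> a \<le> Re z \<and> Re z \<le> b}"

definition Phi3 :: "((complex^3) \<times> (complex^2)) set"
  where "Phi3 = {(l, \<nu>). \<nu> $ 1 - l $ 1 \<in> \<nat> \<and> l $ 3 - \<nu> $ 2 \<in> \<nat>}"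

text \<open>The real parts below are those of integers whenever \<open>(l, \<nu>) \<in> Phi3\<close>
  (and, in \<open>Phi3b\<close> and \<open>Phi3c\<close>, whenever the first interval condition holds).\<close>

definition Phi3a :: "((complex^3) \<times> (complex^2)) set"
  where "Phi3a = {(l, \<nu>) \<in> Phi3.
    \<nu> $ 1 - \<nu> $ 2 - 1 \<notin> int_interval 1 (min (Re (\<nu> $ 1 - l $ 1)) (Re (l $ 3 - \<nu> $ 2)))}"

definition Phi3b :: "((complex^3) \<times> (complex^2)) set"
  where "Phi3b = {(l, \<nu>) \<in> Phi3.
    \<nu> $ 1 - \<nu> $ 2 - 1 \<in> int_interval 1 (min (Re (\<nu> $ 1 - l $ 1)) (Re (l $ 3 - \<nu> $ 2))) \<and>
    l $ 2 - \<nu> $ 2 \<notin> int_interval 1 (Re (\<nu> $ 1 - \<nu> $ 2 - 1))}"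

definition Phi3c :: "((complex^3) \<times> (complex^2)) set"
  where "Phi3c = {(l, \<nu>) \<in> Phi3.
    \<nu> $ 1 - \<nu> $ 2 - 1 \<in> int_interval 1 (min (Re (\<nu> $ 1 - l $ 1)) (Re (l $ 3 - \<nu> $ 2))) \<and>
    l $ 2 - \<nu> $ 2 \<in> int_interval 1 (Re (\<nu> $ 1 - \<nu> $ 2 - 1))}"

text \<open>\<open>cong2 e z\<close>: the complex number \<open>z\<close> is an integer whose class modulo 2 is \<open>e\<close>.\<close>

definition cong2 :: "bit \<Rightarrow> complex \<Rightarrow> bool"
  where "cong2 e z \<longleftrightarrow> (\<exists>k::int. z = of_int k \<and> e = of_int k)"

definition Supp_over ::
    "((complex^3) \<times> (complex^2)) set \<Rightarrow> ((bit^3) \<times> (bit^2) \<times> (complex^3) \<times> (complex^2)) set"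
  where "Supp_over \<Phi> = {(\<xi>, \<eta>, l, \<nu>). (l, \<nu>) \<in> \<Phi> \<and>
    cong2 (\<xi> $ 1 + \<eta> $ 1) (\<nu> $ 1 - l $ 1) \<and> cong2 (\<xi> $ 3 + \<eta> $ 2) (l $ 3 - \<nu> $ 2)}"

definition Supp3a :: "((bit^3) \<times> (bit^2) \<times> (complex^3) \<times> (complex^2)) set"
  where "Supp3a = Supp_over Phi3a"

definition Supp3b :: "((bit^3) \<times> (bit^2) \<times> (complex^3) \<times> (complex^2)) set"
  where "Supp3b = Supp_over Phi3b"

definition Supp3c :: "((bit^3) \<times> (bit^2) \<times> (complex^3) \<times> (complex^2)) set"
  where "Supp3c = Supp_over Phi3c"

definition Supp3 :: "((bit^3) \<times> (bit^2) \<times> (complex^3) \<times> (complex^2)) set"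
  where "Supp3 = Supp3a \<union> Supp3b \<union> Supp3c"

end

theory Submission
  imports Defs
begin

text \<open>
  An intertwining differential operator \<open>D\<close> is determined by the functional \<open>T f = D f 1\<close>, since
  \<open>D f h = T (f \<circ> iota3 h)\<close>. As \<open>f\<close> is right equivariant under the upper triangular group, \<open>T\<close> is a
  combination of the derivatives \<open>jet i j k\<close> of \<open>f\<close> at \<open>1\<close> along \<open>E\<^sub>2\<^sub>1\<^sup>i E\<^sub>3\<^sub>1\<^sup>j E\<^sub>3\<^sub>2\<^sup>k\<close>, and these are linearly
  independent because there are elements of the principal series supported in the big cell with
  prescribed jets. Equivariance of \<open>T\<close> under the diagonal matrices forces \<open>i + j = \<nu>\<^sub>1 - l\<^sub>1 = p\<close> and
  \<open>j + k = l\<^sub>3 - \<nu>\<^sub>2 = q\<close>, together with the parity conditions, so that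
  \<open>T = (\<Sum>j\<le>min p q. t\<^sub>j jet (p - j) j (q - j))\<close>. Invariance under \<open>1 + c E\<^sub>1\<^sub>3\<close> is
  infinitesimal and amounts to the two-term recurrence
  \<open>(j + 1) (j + 1 - n) t\<^sub>j\<^sub>+\<^sub>1 + (p - j) (q - j) (l\<^sub>2 - \<nu>\<^sub>2 - j - 1) t\<^sub>j = 0\<close> for \<open>j < min p q\<close>, where
  \<open>n = \<nu>\<^sub>1 - \<nu>\<^sub>2 - 1\<close>. Its solution space is a line, except when the leading coefficient and, at an
  index not larger, the other coefficient vanish; then it is a plane.
\<close>

section \<open>Smoothness and iterated directional derivatives\<close>

text \<open>The jets are iterated derivatives in constant directions of the matrix space, not along
  left-invariant vector fields. Such derivatives commute, and translations are linear maps of that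
  space, so equivariance can be differentiated along 1 + c X without exponentials and without
  ordering corrections. The price is that the symmetry of second derivatives must first be derived
  from a notion of smoothness that asks only for differentiability at every order.

  To first order in c, translation by 1 + c E_13 sends the jet of index j to jets of indices j - 1
  and j with p and q lowered by one, hence only two unknowns meet in each equation. Below min p q
  the leading coefficient vanishes at most at j = n - 1, and the other one at most at j = l2 -
  \<nu>2 - 1. A zero of the leading coefficient cuts the unknowns into two blocks: the upper block
  always carries one solution, and the lower block carries another one exactly when the other
  coefficient stops the propagation no later than the cut. This is the origin of the cases a, b and
  c.\<close>

lemma second_difference_mean_value:
  fixes g :: "'a::real_normed_vector \<Rightarrow> real"
  assumes h: "h > 0"
    and sub: "\<And>s t. 0 \<le> s \<Longrightarrow> s \<le> h \<Longrightarrow> 0 \<le> t \<Longrightarrow> t \<le> h \<Longrightarrow> x + s *\<^sub>R u + t *\<^sub>R v \<in> S"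
    and g: "\<And>y. y \<in> S \<Longrightarrow> (g has_derivative G y) (at y)"
    and gu: "\<And>y. y \<in> S \<Longrightarrow> ((\<lambda>y. G y u) has_derivative Gu y) (at y)"
  shows "\<exists>s t. 0 < s \<and> s < h \<and> 0 < t \<and> t < h \<and>
    g (x + h *\<^sub>R u + h *\<^sub>R v) - g (x + h *\<^sub>R u) - g (x + h *\<^sub>R v) + g x
      = h * h * Gu (x + s *\<^sub>R u + t *\<^sub>R v) v"
proof -
  have *: "((\<lambda>s. g (x + s *\<^sub>R u + t *\<^sub>R v)) has_real_derivative G (x + s *\<^sub>R u + t *\<^sub>R v) u) (at s)"
    if "0 \<le> s" "s \<le> h" "0 \<le> t" "t \<le> h" for s t
  proof -
    have "((\<lambda>s. g (x + s *\<^sub>R u + t *\<^sub>R v)) has_derivative (\<lambda>r. G (x + s *\<^sub>R u + t *\<^sub>R v) (r *\<^sub>R u))) (at s)"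
      by (rule has_derivative_compose[where g = g and f = "\<lambda>s. x + s *\<^sub>R u + t *\<^sub>R v", OF _ g[OF sub[OF that]]])
        (auto intro!: derivative_eq_intros)
    moreover have "linear (G (x + s *\<^sub>R u + t *\<^sub>R v))"
      using g[OF sub[OF that]] by (rule has_derivative_linear)
    ultimately show ?thesis
      by (simp add: has_field_derivative_def linear_cmul mult_commute_abs)
  qed
  \<comment> \<open>The second difference is the increment along \<open>u\<close> of an increment
    along \<open>v\<close>. A mean value step in \<open>s\<close> gives a difference of first
    derivatives, and another one in \<open>t\<close> turns it into \<open>Gu\<close>.\<close>
  let ?\<psi> = "\<lambda>s. g (x + s *\<^sub>R u + h *\<^sub>R v) - g (x + s *\<^sub>R u + 0 *\<^sub>R v)"
  have "\<exists>s. s > 0 \<and> s < h \<and> ?\<psi> h - ?\<psi> 0 = (h - 0) * (G (x + s *\<^sub>R u + h *\<^sub>R v) u - G (x + s *\<^sub>R u + 0 *\<^sub>R v) u)"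
    by (rule MVT2[OF h]) (use h *[of _ h] *[of _ 0] in \<open>auto intro!: DERIV_diff\<close>)
  then obtain s where s: "0 < s" "s < h"
    and eq1: "?\<psi> h - ?\<psi> 0 = h * (G (x + s *\<^sub>R u + h *\<^sub>R v) u - G (x + s *\<^sub>R u + 0 *\<^sub>R v) u)" by auto
  have **: "((\<lambda>t. G (x + s *\<^sub>R u + t *\<^sub>R v) u) has_real_derivative Gu (x + s *\<^sub>R u + t *\<^sub>R v) v) (at t)"
    if t: "0 \<le> t" "t \<le> h" for t
  proof -
    have S: "x + s *\<^sub>R u + t *\<^sub>R v \<in> S" using s t by (intro sub) auto
    have "((\<lambda>t. G (x + s *\<^sub>R u + t *\<^sub>R v) u) has_derivative (\<lambda>r. Gu (x + s *\<^sub>R u + t *\<^sub>R v) (r *\<^sub>R v))) (at t)"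
      by (rule has_derivative_compose[where g = "\<lambda>y. G y u" and f = "\<lambda>t. x + s *\<^sub>R u + t *\<^sub>R v", OF _ gu[OF S]])
        (auto intro!: derivative_eq_intros)
    moreover have "linear (Gu (x + s *\<^sub>R u + t *\<^sub>R v))"
      using gu[OF S] by (rule has_derivative_linear)
    ultimately show ?thesis
      by (simp add: has_field_derivative_def linear_cmul mult_commute_abs)
  qed
  have "\<exists>t. t > 0 \<and> t < h \<and> G (x + s *\<^sub>R u + h *\<^sub>R v) u - G (x + s *\<^sub>R u + 0 *\<^sub>R v) u
      = (h - 0) * Gu (x + s *\<^sub>R u + t *\<^sub>R v) v"
    by (rule MVT2[OF h]) (use ** in auto)
  then obtain t where "0 < t" "t < h" "G (x + s *\<^sub>R u + h *\<^sub>R v) u - G (x + s *\<^sub>R u + 0 *\<^sub>R v) u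
      = h * Gu (x + s *\<^sub>R u + t *\<^sub>R v) v" by auto
  with eq1 s show ?thesis
    by (intro exI[of _ s] exI[of _ t]) (simp add: algebra_simps)
qed

text \<open>The second difference over a small parallelogram is symmetric in \<open>u\<close> and
  \<open>v\<close>, and each mixed derivative takes that value divided by \<open>h * h\<close> at
  some nearby point. Continuity at \<open>x\<close> then excludes a gap between the two.\<close>

lemma symmetric_second_derivative_real:
  fixes g :: "'a::real_normed_vector \<Rightarrow> real"
  assumes S: "open S" "x \<in> S"
    and g: "\<And>y. y \<in> S \<Longrightarrow> (g has_derivative G y) (at y)"
    and gu: "\<And>y. y \<in> S \<Longrightarrow> ((\<lambda>y. G y u) has_derivative Gu y) (at y)"
    and gv: "\<And>y. y \<in> S \<Longrightarrow> ((\<lambda>y. G y v) has_derivative Gv y) (at y)"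
    and cu: "isCont (\<lambda>y. Gu y v) x" and cv: "isCont (\<lambda>y. Gv y u) x"
  shows "Gu x v = Gv x u"
proof (rule ccontr)
  assume ne: "Gu x v \<noteq> Gv x u"
  define e where "e = \<bar>Gu x v - Gv x u\<bar> / 2"
  have e: "e > 0" using ne by (simp add: e_def)
  obtain r where r: "r > 0" "ball x r \<subseteq> S" using S open_contains_ball by blast
  obtain d1 where d1: "d1 > 0" "\<And>y. dist y x < d1 \<Longrightarrow> \<bar>Gu y v - Gu x v\<bar> < e"
    using cu e unfolding continuous_at_eps_delta dist_real_def by blast
  obtain d2 where d2: "d2 > 0" "\<And>y. dist y x < d2 \<Longrightarrow> \<bar>Gv y u - Gv x u\<bar> < e"
    using cv e unfolding continuous_at_eps_delta dist_real_def by blast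
  define d where "d = min r (min d1 d2)"
  \<comment> \<open>This size keeps the whole parallelogram within \<open>d / 2\<close> of
    \<open>x\<close>; the summand 1 covers \<open>u = v = 0\<close>.\<close>
  define h where "h = d / (2 * (norm u + norm v + 1))"
  have d: "d > 0" using r d1 d2 by (simp add: d_def)
  have n: "norm u + norm v + 1 > 0" using norm_ge_zero[of u] norm_ge_zero[of v] by linarith
  have h: "h > 0" unfolding h_def using d n by (intro divide_pos_pos) auto
  have near: "dist (x + s *\<^sub>R u + t *\<^sub>R v) x < d" if "0 \<le> s" "s \<le> h" "0 \<le> t" "t \<le> h" for s t
  proof -
    have "dist (x + s *\<^sub>R u + t *\<^sub>R v) x = norm (s *\<^sub>R u + t *\<^sub>R v)"
      by (simp add: dist_norm)
    also have "\<dots> \<le> s * norm u + t * norm v"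
      using norm_triangle_ineq[of "s *\<^sub>R u" "t *\<^sub>R v"] that by simp
    also have "\<dots> \<le> h * norm u + h * norm v"
      using that by (intro add_mono mult_right_mono) auto
    also have "\<dots> \<le> h * (norm u + norm v + 1)" using h by (simp add: algebra_simps)
    also have "\<dots> = d / 2" using n unfolding h_def by (simp add: divide_simps)
    also have "\<dots> < d" using d by simp
    finally show ?thesis .
  qed
  have sub: "x + s *\<^sub>R u + t *\<^sub>R v \<in> S" if "0 \<le> s" "s \<le> h" "0 \<le> t" "t \<le> h" for s t
    using near[OF that] r by (auto simp: d_def dist_commute)
  have sub': "x + s *\<^sub>R v + t *\<^sub>R u \<in> S" if "0 \<le> s" "s \<le> h" "0 \<le> t" "t \<le> h" for s t
    using sub[of t s] that by (simp add: algebra_simps)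
  obtain s t where st: "0 < s" "s < h" "0 < t" "t < h"
    and A: "g (x + h *\<^sub>R u + h *\<^sub>R v) - g (x + h *\<^sub>R u) - g (x + h *\<^sub>R v) + g x
      = h * h * Gu (x + s *\<^sub>R u + t *\<^sub>R v) v"
    using second_difference_mean_value[of h x u v S g G Gu, OF h sub g gu] by blast
  obtain s' t' where st': "0 < s'" "s' < h" "0 < t'" "t' < h"
    and B: "g (x + h *\<^sub>R v + h *\<^sub>R u) - g (x + h *\<^sub>R v) - g (x + h *\<^sub>R u) + g x
      = h * h * Gv (x + s' *\<^sub>R v + t' *\<^sub>R u) u"
    using second_difference_mean_value[of h x v u S g G Gv, OF h sub' g gv] by blast
  have "h * h * Gu (x + s *\<^sub>R u + t *\<^sub>R v) v = h * h * Gv (x + s' *\<^sub>R v + t' *\<^sub>R u) u"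
    using A B by (simp add: algebra_simps)
  then have eq: "Gu (x + s *\<^sub>R u + t *\<^sub>R v) v = Gv (x + t' *\<^sub>R u + s' *\<^sub>R v) u"
    using h by (simp add: algebra_simps)
  have "\<bar>Gu (x + s *\<^sub>R u + t *\<^sub>R v) v - Gu x v\<bar> < e"
    using near[of s t] st by (intro d1) (auto simp: d_def)
  moreover have "\<bar>Gv (x + t' *\<^sub>R u + s' *\<^sub>R v) u - Gv x u\<bar> < e"
    using near[of t' s'] st' by (intro d2) (auto simp: d_def)
  ultimately show False using eq unfolding e_def by (simp add: abs_if split: if_splits)
qed

section \<open>Locality, symmetry and linearity of iterated derivatives\<close>

lemma frechet_derivative_cong_open:
  assumes "open S" "x \<in> S" "\<And>y. y \<in> S \<Longrightarrow> f y = g y"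
  shows "frechet_derivative f (at x) = frechet_derivative g (at x)"
proof -
  have "(f has_derivative F) (at x) \<longleftrightarrow> (g has_derivative F) (at x)" for F
    using assms by (metis has_derivative_transform_within_open)
  then show ?thesis by (simp add: frechet_derivative_def)
qed

lemma differentiable_cong_open:
  assumes "open S" "x \<in> S" "\<And>y. y \<in> S \<Longrightarrow> f y = g y"
  shows "f differentiable (at x) \<longleftrightarrow> g differentiable (at x)"
  unfolding differentiable_def using assms by (metis has_derivative_transform_within_open)

lemma dir_derivs_cong_open:
  assumes "open S" "\<And>y. y \<in> S \<Longrightarrow> f y = g y" "x \<in> S"
  shows "dir_derivs vs f x = dir_derivs vs g x"
  using assms(3)
proof (induction vs arbitrary: x)
  case (Cons v vs)
  then show ?case using frechet_derivative_cong_open[OF assms(1) Cons.prems, of "dir_derivs vs f" "dir_derivs vs g"]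
    by simp
qed (use assms in simp)

lemma smooth_on_cong_open:
  assumes "open S" "\<And>y. y \<in> S \<Longrightarrow> f y = g y"
  shows "smooth_on S f \<longleftrightarrow> smooth_on S g"
proof -
  have "dir_derivs vs f differentiable (at x) \<longleftrightarrow> dir_derivs vs g differentiable (at x)" if "x \<in> S" for vs x
    by (rule differentiable_cong_open[OF assms(1) that]) (rule dir_derivs_cong_open[OF assms])
  then show ?thesis by (simp add: smooth_on_def)
qed

lemma dir_derivs_append: "dir_derivs (us @ vs) f = dir_derivs us (dir_derivs vs f)"
  by (induction us) auto

lemma smooth_on_dir_derivs: "smooth_on S f \<Longrightarrow> smooth_on S (dir_derivs vs f)"
  unfolding smooth_on_def dir_derivs_append[symmetric] by blast

lemma smooth_on_differentiable: "smooth_on S f \<Longrightarrow> x \<in> S \<Longrightarrow> f differentiable (at x)"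
  unfolding smooth_on_def by (metis dir_derivs.simps(1))

lemma smooth_on_has_derivative:
  "smooth_on S f \<Longrightarrow> x \<in> S \<Longrightarrow> (f has_derivative (\<lambda>v. dir_derivs [v] f x)) (at x)"
  using smooth_on_differentiable frechet_derivative_works by fastforce

lemma smooth_on_Un: "smooth_on S f \<Longrightarrow> smooth_on T f \<Longrightarrow> smooth_on (S \<union> T) f"
  unfolding smooth_on_def by blast

lemma smooth_on_subset: "smooth_on S f \<Longrightarrow> T \<subseteq> S \<Longrightarrow> smooth_on T f"
  unfolding smooth_on_def by blast

lemma dir_derivs_linear:
  assumes "smooth_on S f" "x \<in> S"
  shows "linear (\<lambda>v. dir_derivs (v # vs) f x)"
  using assms linear_frechet_derivative unfolding smooth_on_def by fastforce

text \<open>The mean value theorem needs real values, so real and imaginary parts are treated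
  separately. Second derivatives are continuous because \<open>smooth_on\<close> makes them
  differentiable.\<close>

lemma dir_derivs_swap:
  assumes S: "open S" "x \<in> S" and f: "smooth_on S f"
  shows "dir_derivs (u # v # vs) f x = dir_derivs (v # u # vs) f x"
proof -
  define g where "g = dir_derivs vs f"
  have g: "smooth_on S g" unfolding g_def by (rule smooth_on_dir_derivs[OF f])
  have sym: "\<phi> (dir_derivs [u, v] g x) = \<phi> (dir_derivs [v, u] g x)" if "bounded_linear \<phi>" for \<phi> :: "complex \<Rightarrow> real"
  proof (rule symmetric_second_derivative_real[where g = "\<lambda>y. \<phi> (g y)" and G = "\<lambda>y w. \<phi> (dir_derivs [w] g y)"
      and Gu = "\<lambda>y w. \<phi> (dir_derivs [w, v] g y)" and Gv = "\<lambda>y w. \<phi> (dir_derivs [w, u] g y)" and u = v and v = u, OF S])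
    show "((\<lambda>y. \<phi> (g y)) has_derivative (\<lambda>w. \<phi> (dir_derivs [w] g y))) (at y)" if "y \<in> S" for y
      using smooth_on_has_derivative[OF g that] by (rule bounded_linear.has_derivative[OF \<open>bounded_linear \<phi>\<close>])
    have *: "((\<lambda>y. \<phi> (dir_derivs [z] g y)) has_derivative (\<lambda>w. \<phi> (dir_derivs [w, z] g y))) (at y)" if "y \<in> S" for y z
      using bounded_linear.has_derivative[OF \<open>bounded_linear \<phi>\<close>
          smooth_on_has_derivative[OF smooth_on_dir_derivs[OF g, of "[z]"] that]]
      by simp
    show "((\<lambda>y. \<phi> (dir_derivs [v] g y)) has_derivative (\<lambda>w. \<phi> (dir_derivs [w, v] g y))) (at y)"
      "((\<lambda>y. \<phi> (dir_derivs [u] g y)) has_derivative (\<lambda>w. \<phi> (dir_derivs [w, u] g y))) (at y)" if "y \<in> S" for y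
      using *[OF that] by auto
    have c: "isCont (\<lambda>y. \<phi> (dir_derivs ws g y)) x" for ws
      using smooth_on_differentiable[OF smooth_on_dir_derivs[OF g] S(2), of ws]
      by (intro bounded_linear.isCont[OF \<open>bounded_linear \<phi>\<close>]) (rule differentiable_imp_continuous_within)
    show "isCont (\<lambda>y. \<phi> (dir_derivs [u, v] g y)) x" "isCont (\<lambda>y. \<phi> (dir_derivs [v, u] g y)) x"
      by (rule c)+
  qed
  have "dir_derivs [u, v] g x = dir_derivs [v, u] g x"
    using sym[OF bounded_linear_Re] sym[OF bounded_linear_Im] by (rule complex_eqI)
  then show ?thesis by (simp add: g_def)
qed

text \<open>Only the multiset of directions counts. This allows an unwanted direction to be moved to
  the head, where it can be eliminated, and lists of lower directions to be sorted into
  \<open>mlist\<close>.\<close>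

lemma dir_derivs_perm:
  assumes S: "open S" and f: "smooth_on S f" and "mset us = mset vs" "x \<in> S"
  shows "dir_derivs us f x = dir_derivs vs f x"
  using assms(3,4)
proof (induction us arbitrary: vs x)
  case (Cons u us)
  have front: "dir_derivs (as @ u # bs) f x = dir_derivs (u # as @ bs) f x" if "x \<in> S" for as bs x
    using that
  proof (induction as arbitrary: x)
    case (Cons a as)
    have "dir_derivs (a # as @ u # bs) f x = dir_derivs (a # u # as @ bs) f x"
      using frechet_derivative_cong_open[OF S Cons.prems, of "dir_derivs (as @ u # bs) f" "dir_derivs (u # as @ bs) f"] Cons.IH
      by simp
    also have "\<dots> = dir_derivs (u # a # as @ bs) f x"
      by (rule dir_derivs_swap[OF S Cons.prems f])
    finally show ?case by simp
  qed simp
  have "u \<in> set vs" using Cons.prems(1) by (metis list.set_intros(1) mset_eq_setD)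
  then obtain as bs where vs: "vs = as @ u # bs" by (meson split_list)
  have m: "mset us = mset (as @ bs)" using Cons.prems(1) vs by simp
  have "dir_derivs (u # us) f x = dir_derivs (u # as @ bs) f x"
    using frechet_derivative_cong_open[OF S Cons.prems(2), of "dir_derivs us f" "dir_derivs (as @ bs) f"]
      Cons.IH[OF m] by simp
  then show ?case using front[OF Cons.prems(2)] vs by simp
qed simp

lemma dir_derivs_linear_nth:
  assumes S: "open S" and f: "smooth_on S f" and x: "x \<in> S"
  shows "linear (\<lambda>v. dir_derivs (us @ v # vs) f x)"
proof -
  have "dir_derivs (us @ v # vs) f x = dir_derivs (v # us @ vs) f x" for v
    by (rule dir_derivs_perm[OF S f _ x]) simp
  then show ?thesis using dir_derivs_linear[OF f x] by simp
qed

text \<open>A derivative \<open>L\<close> that is the same at all points makes \<open>A\<close>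
  affine, so the chain rule has no higher order terms.\<close>

lemma dir_derivs_affine:
  assumes S: "open S" and f: "smooth_on S f"
    and A: "\<And>x. (A has_derivative L) (at x)" and x: "A x \<in> S"
  shows "dir_derivs vs (\<lambda>x. f (A x)) x = dir_derivs (map L vs) f (A x)"
proof -
  have cont: "continuous_on UNIV A"
    using A by (meson continuous_at_imp_continuous_on has_derivative_continuous)
  have op: "open (A -` S)" by (rule open_vimage[OF S cont])
  show ?thesis using x
  proof (induction vs arbitrary: x)
    case (Cons v vs)
    have "frechet_derivative (dir_derivs vs (\<lambda>x. f (A x))) (at x)
      = frechet_derivative (\<lambda>x. dir_derivs (map L vs) f (A x)) (at x)"
      by (rule frechet_derivative_cong_open[OF op]) (use Cons in auto)
    also have "\<dots> = (\<lambda>v. dir_derivs [L v] (dir_derivs (map L vs) f) (A x))"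
      by (rule frechet_derivative_at[symmetric],
          rule has_derivative_compose[OF A smooth_on_has_derivative[OF smooth_on_dir_derivs[OF f] Cons.prems]])
    finally show ?case by simp
  qed simp
qed

lemma smooth_on_affine:
  assumes S: "open S" and f: "smooth_on S f"
    and A: "\<And>x. (A has_derivative L) (at x)" and T: "\<And>x. x \<in> T \<Longrightarrow> A x \<in> S"
  shows "smooth_on T (\<lambda>x. f (A x))"
proof -
  have cont: "continuous_on UNIV A"
    using A by (meson continuous_at_imp_continuous_on has_derivative_continuous)
  have op: "open (A -` S)" by (rule open_vimage[OF S cont])
  show ?thesis unfolding smooth_on_def
  proof (intro allI ballI)
    fix vs x assume x: "x \<in> T"
    have "(\<lambda>x. dir_derivs (map L vs) f (A x)) differentiable (at x)"
      using has_derivative_compose[OF A smooth_on_has_derivative[OF smooth_on_dir_derivs[OF f] T[OF x]]]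
      unfolding differentiable_def by blast
    then show "dir_derivs vs (\<lambda>x. f (A x)) differentiable (at x)"
      using differentiable_cong_open[OF op, of x "dir_derivs vs (\<lambda>x. f (A x))"] T[OF x]
        dir_derivs_affine[OF S f A] by auto
  qed
qed

section \<open>Closure properties of smooth functions\<close>

lemma smooth_on_coinduct:
  assumes S: "open S" and f: "f \<in> F"
    and diff: "\<And>f x. f \<in> F \<Longrightarrow> x \<in> S \<Longrightarrow> f differentiable (at x)"
    and closed: "\<And>f v. f \<in> F \<Longrightarrow> \<exists>g\<in>F. \<forall>x\<in>S. frechet_derivative f (at x) v = g x"
  shows "smooth_on S f"
proof -
  \<comment> \<open>Each iterated derivative agrees on \<open>S\<close> with a member of
    \<open>F\<close>; agreement on an open set is enough to differentiate once more.\<close>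
  have *: "\<exists>g\<in>F. \<forall>x\<in>S. dir_derivs vs f x = g x" for vs
  proof (induction vs)
    case (Cons v vs)
    then obtain g where g: "g \<in> F" "\<forall>x\<in>S. dir_derivs vs f x = g x" by blast
    have "dir_derivs (v # vs) f x = frechet_derivative g (at x) v" if "x \<in> S" for x
      using frechet_derivative_cong_open[OF S that, of "dir_derivs vs f" g] g by simp
    then show ?case using closed[OF g(1), of v] by simp
  qed (use f in auto)
  show ?thesis unfolding smooth_on_def
    using * diff differentiable_cong_open[OF S] by metis
qed

text \<open>The derivative of a product is a sum of products, so the natural classes are closed
  under differentiation only up to finite sums. Closing them additively spares an iterated Leibniz
  formula.\<close>

inductive_set sums_of :: "('a \<Rightarrow> complex) set \<Rightarrow> ('a \<Rightarrow> complex) set" for B where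
  base: "f \<in> B \<Longrightarrow> f \<in> sums_of B"
| add: "f \<in> sums_of B \<Longrightarrow> g \<in> sums_of B \<Longrightarrow> (\<lambda>x. f x + g x) \<in> sums_of B"

lemma smooth_on_coinduct_sums:
  assumes S: "open S" and f: "f \<in> sums_of B"
    and diff: "\<And>f. f \<in> B \<Longrightarrow> \<exists>F. \<forall>x\<in>S. (f has_derivative F x) (at x) \<and> (\<forall>v. (\<lambda>x. F x v) \<in> sums_of B)"
  shows "smooth_on S f"
proof (rule smooth_on_coinduct[OF S f])
  have *: "\<exists>F. (\<forall>x\<in>S. (f has_derivative F x) (at x)) \<and> (\<forall>v. (\<lambda>x. F x v) \<in> sums_of B)"
    if "f \<in> sums_of B" "S \<noteq> {}" for f
    using that(1)
  proof induction
    case (base f)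
    then show ?case using diff[OF base] that(2) by blast
  next
    case (add f g)
    then obtain F G where "\<forall>x\<in>S. (f has_derivative F x) (at x)" "\<forall>v. (\<lambda>x. F x v) \<in> sums_of B"
      "\<forall>x\<in>S. (g has_derivative G x) (at x)" "\<forall>v. (\<lambda>x. G x v) \<in> sums_of B" by blast
    then show ?case
      by (intro exI[of _ "\<lambda>x v. F x v + G x v"]) (auto intro!: has_derivative_add sums_of.add)
  qed
  show "f differentiable (at x)" if "f \<in> sums_of B" "x \<in> S" for f x
    using * that unfolding differentiable_def by blast
  show "\<exists>g\<in>sums_of B. \<forall>x\<in>S. frechet_derivative f (at x) v = g x" if f: "f \<in> sums_of B" for f v
  \<comment> \<open>In the premise the closure condition stands under the quantifier over
    \<open>S\<close>, so for empty \<open>S\<close> it is void and a separate witness is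
    needed.\<close>
  proof (cases "S = {}")
    case True then show ?thesis using that by auto
  next
    case False
    then obtain F where F: "\<forall>x\<in>S. (f has_derivative F x) (at x)" "\<forall>v. (\<lambda>x. F x v) \<in> sums_of B"
      using *[OF f] by blast
    show ?thesis using F by (intro bexI[of _ "\<lambda>x. F x v"]) (auto simp: frechet_derivative_at[symmetric])
  qed
qed

lemma smooth_on_const: "smooth_on S (\<lambda>x. c)"
proof -
  have "\<exists>d. dir_derivs vs (\<lambda>x::'a. c) = (\<lambda>x. d)" for vs
    by (induction vs) auto
  then show ?thesis unfolding smooth_on_def by (metis differentiable_const)
qed

lemma smooth_on_add:
  assumes S: "open S" and "smooth_on S f" "smooth_on S g"
  shows "smooth_on S (\<lambda>x. f x + g x)"
proof (rule smooth_on_coinduct_sums[OF S, where B = "{f. smooth_on S f}"])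
  show "(\<lambda>x. f x + g x) \<in> sums_of {f. smooth_on S f}"
    using assms by (intro sums_of.add sums_of.base) auto
  show "\<exists>F. \<forall>x\<in>S. (f has_derivative F x) (at x) \<and> (\<forall>v. (\<lambda>x. F x v) \<in> sums_of {f. smooth_on S f})"
    if "f \<in> {f. smooth_on S f}" for f
    using that smooth_on_has_derivative[of S f] smooth_on_dir_derivs[of S f "[_]"]
    by (intro exI[of _ "\<lambda>x v. dir_derivs [v] f x"]) (auto simp del: dir_derivs.simps intro!: sums_of.base)
qed

lemma smooth_on_mult:
  assumes S: "open S" and "smooth_on S f" "smooth_on S g"
  shows "smooth_on S (\<lambda>x. f x * g x)"
proof (rule smooth_on_coinduct_sums[OF S, where B = "{\<lambda>x. f x * g x | f g. smooth_on S f \<and> smooth_on S g}"], goal_cases)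
  case 1
  show ?case using assms by (intro sums_of.base) auto
next
  case (2 p)
  then obtain f g where p: "p = (\<lambda>x. f x * g x)" and f: "smooth_on S f" and g: "smooth_on S g" by auto
  have "(\<lambda>x. f x * dir_derivs [v] g x + dir_derivs [v] f x * g x)
    \<in> sums_of {\<lambda>x. f x * g x | f g. smooth_on S f \<and> smooth_on S g}" for v
    using f g smooth_on_dir_derivs[of S _ "[v]"]
    by (intro sums_of.add sums_of.base) blast+
  then show ?case
    by (intro exI[of _ "\<lambda>x v. f x * dir_derivs [v] g x + dir_derivs [v] f x * g x"])
      (auto simp: p simp del: dir_derivs.simps
        intro!: has_derivative_mult smooth_on_has_derivative[OF f] smooth_on_has_derivative[OF g])
qed

lemma smooth_on_bounded_linear:
  assumes S: "open S" and f: "smooth_on S f" and \<phi>: "bounded_linear \<phi>"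
  shows "smooth_on S (\<lambda>x. \<phi> (f x))"
proof (rule smooth_on_coinduct_sums[OF S, where B = "{\<lambda>x. \<phi> (f x) | f. smooth_on S f}"], goal_cases)
  case 1
  show ?case using f by (intro sums_of.base) auto
next
  case (2 p)
  then obtain f where p: "p = (\<lambda>x. \<phi> (f x))" and f: "smooth_on S f" by auto
  have "(\<lambda>x. \<phi> (dir_derivs [v] f x)) \<in> sums_of {\<lambda>x. \<phi> (f x) | f. smooth_on S f}" for v
    using f smooth_on_dir_derivs[of S _ "[v]"] by (intro sums_of.base) blast
  then show ?case
    by (intro exI[of _ "\<lambda>x v. \<phi> (dir_derivs [v] f x)"])
      (auto simp: p simp del: dir_derivs.simps
        intro!: bounded_linear.has_derivative[OF \<phi>] smooth_on_has_derivative[OF f])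
qed

text \<open>\<open>W\<close> is a class of one-variable functions stable under differentiation on
  \<open>T\<close>. The factor \<open>g\<close> in the class of products collects the inner
  derivatives; \<open>Re (d x)\<close> appears because \<open>smooth_on\<close> speaks of
  complex-valued functions only.\<close>

lemma smooth_on_comp_real:
  fixes w :: "real \<Rightarrow> complex"
  assumes S: "open S" and d: "smooth_on S d" and dT: "\<And>x. x \<in> S \<Longrightarrow> Re (d x) \<in> T"
    and w: "w \<in> W" and W: "\<And>w. w \<in> W \<Longrightarrow> \<exists>w'\<in>W. \<forall>t\<in>T. (w has_vector_derivative w' t) (at t)"
  shows "smooth_on S (\<lambda>x. w (Re (d x)))"
proof (rule smooth_on_coinduct_sums[OF S, where B = "{\<lambda>x. w (Re (d x)) * g x | w g. w \<in> W \<and> smooth_on S g}"], goal_cases)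
  case 1
  have "(\<lambda>x. w (Re (d x)) * 1) \<in> {\<lambda>x. w (Re (d x)) * g x | w g. w \<in> W \<and> smooth_on S g}"
    using w smooth_on_const[of S 1] by fast
  from sums_of.base[OF this] show ?case by simp
next
  case (2 p)
  then obtain w g where p: "p = (\<lambda>x. w (Re (d x)) * g x)" and w: "w \<in> W" and g: "smooth_on S g" by auto
  obtain w' where w': "w' \<in> W" "\<forall>t\<in>T. (w has_vector_derivative w' t) (at t)" using W[OF w] by blast
  define Rd where "Rd v = (\<lambda>x. complex_of_real (Re (dir_derivs [v] d x)))" for v
  have Rd: "smooth_on S (Rd v)" for v
    unfolding Rd_def
    by (intro smooth_on_bounded_linear[OF S smooth_on_dir_derivs[OF d], where \<phi> = "\<lambda>z. complex_of_real (Re z)"]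
        bounded_linear_intros bounded_linear_compose[OF bounded_linear_of_real bounded_linear_Re])
  let ?F = "\<lambda>x v. w (Re (d x)) * dir_derivs [v] g x + w' (Re (d x)) * (Rd v x * g x)"
  have "(\<lambda>x. ?F x v) \<in> sums_of {\<lambda>x. w (Re (d x)) * g x | w g. w \<in> W \<and> smooth_on S g}" for v
  proof (intro sums_of.add sums_of.base)
    show "(\<lambda>x. w (Re (d x)) * dir_derivs [v] g x) \<in> {\<lambda>x. w (Re (d x)) * g x | w g. w \<in> W \<and> smooth_on S g}"
      using w smooth_on_dir_derivs[OF g, of "[v]"] by blast
    show "(\<lambda>x. w' (Re (d x)) * (Rd v x * g x)) \<in> {\<lambda>x. w (Re (d x)) * g x | w g. w \<in> W \<and> smooth_on S g}"
      using w'(1) smooth_on_mult[OF S Rd g, of v] by (auto intro!: exI[of _ w'] exI[of _ "\<lambda>x. Rd v x * g x"])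
  qed
  moreover have "(p has_derivative ?F x) (at x)" if x: "x \<in> S" for x
  proof -
    have 1: "(w has_derivative (\<lambda>r. r *\<^sub>R w' (Re (d x)))) (at (Re (d x)))"
      using w' dT[OF x] by (simp add: has_vector_derivative_def)
    have 2: "((\<lambda>x. Re (d x)) has_derivative (\<lambda>v. Re (dir_derivs [v] d x))) (at x)"
      by (intro has_derivative_Re smooth_on_has_derivative[OF d x])
    have "((\<lambda>x. w (Re (d x))) has_derivative (\<lambda>v. Re (dir_derivs [v] d x) *\<^sub>R w' (Re (d x)))) (at x)"
      using has_derivative_compose[OF 2 1] .
    from has_derivative_mult[OF this smooth_on_has_derivative[OF g x]] show ?thesis
      by (simp add: p Rd_def scaleR_conv_of_real algebra_simps)
  qed
  ultimately show ?case by (intro exI[of _ ?F]) blast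
qed


lemma smooth_on_sum:
  assumes "open S" "\<And>i. i \<in> I \<Longrightarrow> smooth_on S (f i)"
  shows "smooth_on S (\<lambda>x. \<Sum>i\<in>I. f i x)"
  using assms(2) by (induction I rule: infinite_finite_induct) (auto intro: smooth_on_const smooth_on_add[OF assms(1)])

lemma smooth_on_power:
  assumes "open S" "smooth_on S f"
  shows "smooth_on S (\<lambda>x. f x ^ n)"
  by (induction n) (auto intro: smooth_on_const smooth_on_mult assms)

lemma smooth_on_diff:
  assumes "open S" "smooth_on S f" "smooth_on S g"
  shows "smooth_on S (\<lambda>x. f x - g x)"
  using smooth_on_add[OF assms(1,2) smooth_on_mult[OF assms(1) smooth_on_const[of S "-1"] assms(3)]] by simp

lemma smooth_on_linear:
  assumes S: "open S" and L: "bounded_linear L"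
  shows "smooth_on S (\<lambda>x. complex_of_real (L x))"
proof (rule smooth_on_coinduct_sums[OF S, where B = "insert (\<lambda>x. complex_of_real (L x)) (range (\<lambda>c x. c))"], goal_cases)
  case 1
  show ?case by (intro sums_of.base) auto
next
  case (2 p)
  then consider "p = (\<lambda>x. complex_of_real (L x))" | c where "p = (\<lambda>x. c)" by auto
  then show ?case
  proof cases
    case 1
    then show ?thesis
      by (intro exI[of _ "\<lambda>x v. complex_of_real (L v)"])
        (auto intro!: sums_of.base bounded_linear_imp_has_derivative
          bounded_linear_compose[OF bounded_linear_of_real L])
  next
    case 2
    then show ?thesis
      by (intro exI[of _ "\<lambda>x v. 0"]) (auto intro!: sums_of.base)
  qed
qed

text \<open>Meant for translation by 1 + c X: with base point 1 and \<open>y = X\<close>, the point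
  moves and so does every direction, with \<open>\<phi> v\<close> equal to v X or X v. At
  \<open>c = 0\<close> the moving point adds the direction \<open>y\<close>, and each moving
  direction contributes one term.\<close>

lemma dir_derivs_curve:
  assumes S: "open S" and f: "smooth_on S f" and x: "x \<in> S"
  shows "((\<lambda>c. dir_derivs (us @ map (\<lambda>v. v + c *\<^sub>R \<phi> v) vs) f (x + c *\<^sub>R y)) has_vector_derivative
    dir_derivs (y # us @ vs) f x + (\<Sum>i<length vs. dir_derivs (us @ vs[i := \<phi> (vs ! i)]) f x)) (at 0)"
proof (induction vs arbitrary: us)
  case Nil
  have "((\<lambda>c. dir_derivs us f (x + c *\<^sub>R y)) has_derivative (\<lambda>c. dir_derivs [c *\<^sub>R y] (dir_derivs us f) (x + 0 *\<^sub>R y))) (at 0)"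
    by (rule has_derivative_compose[where g = "dir_derivs us f" and f = "\<lambda>c. x + c *\<^sub>R y"])
      (use x in \<open>auto simp del: dir_derivs.simps intro!: derivative_eq_intros smooth_on_has_derivative[of S] smooth_on_dir_derivs f\<close>)
  then show ?case
    using linear_cmul[OF dir_derivs_linear[OF f x, of us]]
    by (simp add: has_vector_derivative_def)
next
  case (Cons v vs)
  let ?m = "\<lambda>c. map (\<lambda>v. v + c *\<^sub>R \<phi> v) vs"
  let ?F = "\<lambda>w c. dir_derivs ((us @ [w]) @ ?m c) f (x + c *\<^sub>R y)"
  \<comment> \<open>The head slot is linear, so it splits into \<open>v\<close> and \<open>c\<close>
    times \<open>\<phi> v\<close>; at \<open>c = 0\<close> the second part contributes only its
    value there.\<close>
  have "((\<lambda>c. ?F v c + c *\<^sub>R ?F (\<phi> v) c) has_vector_derivative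
      (dir_derivs (y # (us @ [v]) @ vs) f x + (\<Sum>i<length vs. dir_derivs ((us @ [v]) @ vs[i := \<phi> (vs ! i)]) f x))
      + (0 *\<^sub>R (dir_derivs (y # (us @ [\<phi> v]) @ vs) f x + (\<Sum>i<length vs. dir_derivs ((us @ [\<phi> v]) @ vs[i := \<phi> (vs ! i)]) f x))
        + 1 *\<^sub>R ?F (\<phi> v) 0)) (at 0)"
    by (intro has_vector_derivative_add has_vector_derivative_scaleR Cons.IH DERIV_ident)
  also have "(dir_derivs (y # (us @ [v]) @ vs) f x + (\<Sum>i<length vs. dir_derivs ((us @ [v]) @ vs[i := \<phi> (vs ! i)]) f x))
      + (0 *\<^sub>R (dir_derivs (y # (us @ [\<phi> v]) @ vs) f x + (\<Sum>i<length vs. dir_derivs ((us @ [\<phi> v]) @ vs[i := \<phi> (vs ! i)]) f x))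
        + 1 *\<^sub>R ?F (\<phi> v) 0)
     = dir_derivs (y # us @ v # vs) f x + (\<Sum>i<length (v # vs). dir_derivs (us @ (v # vs)[i := \<phi> ((v # vs) ! i)]) f x)"
    by (simp add: sum.lessThan_Suc_shift del: sum.lessThan_Suc)
  finally show ?case
  proof (rule has_vector_derivative_transform_within_open)
    show "open ((\<lambda>c. x + c *\<^sub>R y) -` S)"
      by (intro open_vimage S continuous_intros)
    show "0 \<in> (\<lambda>c. x + c *\<^sub>R y) -` S" using x by simp
    show "?F v c + c *\<^sub>R ?F (\<phi> v) c = dir_derivs (us @ map (\<lambda>v. v + c *\<^sub>R \<phi> v) (v # vs)) f (x + c *\<^sub>R y)"
      if "c \<in> (\<lambda>c. x + c *\<^sub>R y) -` S" for c
    proof -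
      have "linear (\<lambda>w. dir_derivs (us @ w # ?m c) f (x + c *\<^sub>R y))"
        using that by (intro dir_derivs_linear_nth[OF S f]) auto
      from linear_add[OF this, of v "c *\<^sub>R \<phi> v"] linear_cmul[OF this, of c "\<phi> v"]
      show ?thesis by simp
    qed
  qed
qed

text \<open>\<open>differential_op\<close> admits directions from \<open>Basis\<close> only, so
  translated directions have to be expanded in coordinates, one slot at a time.\<close>

lemma dir_derivs_expand:
  fixes f :: "'a::euclidean_space \<Rightarrow> complex"
  assumes S: "open S" and f: "smooth_on S f" and x: "x \<in> S"
  shows "dir_derivs (us @ vs) f x = (\<Sum>ws | set ws \<subseteq> Basis \<and> length ws = length vs.
    complex_of_real (\<Prod>(v, w)\<leftarrow>zip vs ws. v \<bullet> w) * dir_derivs (us @ ws) f x)"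
proof (induction vs arbitrary: us)
  case Nil
  have "{ws::'a list. set ws \<subseteq> Basis \<and> length ws = length []} = {[]}" by auto
  then show ?case by simp
next
  case (Cons v vs)
  let ?L = "{ws::'a list. set ws \<subseteq> Basis \<and> length ws = length vs}"
  have lin: "linear (\<lambda>w. dir_derivs (us @ w # vs) f x)"
    by (rule dir_derivs_linear_nth[OF S f x])
  have "dir_derivs (us @ v # vs) f x = dir_derivs (us @ (\<Sum>b\<in>Basis. (v \<bullet> b) *\<^sub>R b) # vs) f x"
    by (simp add: euclidean_representation)
  also have "\<dots> = (\<Sum>b\<in>Basis. complex_of_real (v \<bullet> b) * dir_derivs ((us @ [b]) @ vs) f x)"
    by (simp add: linear_sum[OF lin] linear_cmul[OF lin] scaleR_conv_of_real)
  also have "\<dots> = (\<Sum>b\<in>Basis. \<Sum>ws\<in>?L. complex_of_real (v \<bullet> b) *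
      (complex_of_real (\<Prod>(v, w)\<leftarrow>zip vs ws. v \<bullet> w) * dir_derivs ((us @ [b]) @ ws) f x))"
    unfolding Cons.IH[of "us @ [_]"] by (simp add: sum_distrib_left)
  also have "\<dots> = (\<Sum>(ws, b)\<in>?L \<times> Basis. complex_of_real (v \<bullet> b) *
      (complex_of_real (\<Prod>(v, w)\<leftarrow>zip vs ws. v \<bullet> w) * dir_derivs ((us @ [b]) @ ws) f x))"
    by (subst sum.swap) (rule sum.cartesian_product)
  also have "\<dots> = (\<Sum>ws | set ws \<subseteq> Basis \<and> length ws = length (v # vs).
      complex_of_real (\<Prod>(v, w)\<leftarrow>zip (v # vs) ws. v \<bullet> w) * dir_derivs (us @ ws) f x)"
    unfolding list.size(4) One_nat_def add_Suc_right add_0_right lists_length_Suc_eq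
    by (subst sum.reindex) (auto simp: inj_on_def intro!: sum.cong)
  finally show ?case .
qed

lemma dir_derivs_scale:
  assumes S: "open S" and f: "smooth_on S f" and x: "x \<in> S"
  shows "dir_derivs (us @ map (\<lambda>v. c v *\<^sub>R v) vs) f x = complex_of_real (\<Prod>v\<leftarrow>vs. c v) * dir_derivs (us @ vs) f x"
proof (induction vs arbitrary: us)
  case (Cons v vs)
  have "linear (\<lambda>w. dir_derivs (us @ w # map (\<lambda>v. c v *\<^sub>R v) vs) f x)"
    by (rule dir_derivs_linear_nth[OF S f x])
  from linear_cmul[OF this, of "c v" v]
  have "dir_derivs (us @ map (\<lambda>v. c v *\<^sub>R v) (v # vs)) f x
      = complex_of_real (c v) * dir_derivs ((us @ [v]) @ map (\<lambda>v. c v *\<^sub>R v) vs) f x"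
    by (simp add: scaleR_conv_of_real)
  then show ?case unfolding Cons.IH by simp
qed simp

lemma dir_derivs_add:
  assumes S: "open S" and f: "smooth_on S f" and g: "smooth_on S g" and x: "x \<in> S"
  shows "dir_derivs vs (\<lambda>x. f x + g x) x = dir_derivs vs f x + dir_derivs vs g x"
  using x
proof (induction vs arbitrary: x)
  case (Cons v vs)
  have "frechet_derivative (dir_derivs vs (\<lambda>x. f x + g x)) (at x) = frechet_derivative (\<lambda>x. dir_derivs vs f x + dir_derivs vs g x) (at x)"
    using Cons by (intro frechet_derivative_cong_open[OF S]) auto
  also have "\<dots> = (\<lambda>v. dir_derivs [v] (dir_derivs vs f) x + dir_derivs [v] (dir_derivs vs g) x)"
    by (intro frechet_derivative_at[symmetric] has_derivative_add smooth_on_has_derivative[OF smooth_on_dir_derivs[OF f]] smooth_on_has_derivative[OF smooth_on_dir_derivs[OF g]] Cons.prems)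
  finally show ?case by simp
qed simp

lemma dir_derivs_cmult:
  assumes S: "open S" and f: "smooth_on S f" and x: "x \<in> S"
  shows "dir_derivs vs (\<lambda>x. z * f x) x = z * dir_derivs vs f x"
  using x
proof (induction vs arbitrary: x)
  case (Cons v vs)
  have "frechet_derivative (dir_derivs vs (\<lambda>x. z * f x)) (at x) = frechet_derivative (\<lambda>x. z * dir_derivs vs f x) (at x)"
    using Cons by (intro frechet_derivative_cong_open[OF S]) auto
  also have "\<dots> = (\<lambda>v. z * dir_derivs [v] (dir_derivs vs f) x)"
    by (intro frechet_derivative_at[symmetric] has_derivative_mult_right smooth_on_has_derivative[OF smooth_on_dir_derivs[OF f]] Cons.prems)
  finally show ?case by simp
qed simp

section \<open>Characters of the multiplicative group of the reals\<close>

lemma sign_pow_mult: "sign_pow (a * b) e = sign_pow a e * sign_pow b e"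
  by (simp add: sign_pow_def)

text \<open>The character of parity \<open>e\<close> and exponent \<open>\<mu>\<close>. It merges
  the sign factor from M and the positive power from A into one factor per diagonal entry.\<close>

definition sign_powr :: "bit \<Rightarrow> complex \<Rightarrow> real \<Rightarrow> complex"
  where "sign_powr e \<mu> t = sign_pow (sgn t) e * complex_of_real \<bar>t\<bar> powr \<mu>"

lemma sign_powr_mult: "sign_powr e \<mu> (s * t) = sign_powr e \<mu> s * sign_powr e \<mu> t"
  by (simp add: sign_powr_def sgn_mult sign_pow_mult abs_mult powr_times_real)

lemma sign_powr_1 [simp]: "sign_powr e \<mu> 1 = 1"
  by (simp add: sign_powr_def sign_pow_def)

lemma sign_powr_inverse: "t \<noteq> 0 \<Longrightarrow> sign_powr 1 (-1) t = complex_of_real (inverse t)"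
  by (simp add: sign_powr_def sign_pow_def powr_minus_divide sgn_if abs_if field_simps)

text \<open>Differentiation lowers the exponent by one and flips the parity: for negative
  \<open>t\<close> the chain rule through \<open>- t\<close> gives the extra sign. Multiples of
  these characters are thus stable under differentiation.\<close>

lemma sign_powr_has_vector_derivative:
  assumes "t \<noteq> 0"
  shows "(sign_powr e \<mu> has_vector_derivative \<mu> * sign_powr (e + 1) (\<mu> - 1) t) (at t)"
proof (cases "t > 0")
  case True
  have "((\<lambda>s. complex_of_real s powr \<mu>) has_vector_derivative \<mu> * complex_of_real t powr (\<mu> - 1)) (at t)"
    using True by (intro has_vector_derivative_real_field has_field_derivative_powr) (auto simp: complex_nonpos_Reals_iff)
  then show ?thesis
    by (rule has_vector_derivative_transform_within_open[where S = "{0<..}", THEN has_vector_derivative_eq_rhs])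
      (use True in \<open>auto simp: sign_powr_def sign_pow_def\<close>)
next
  case False
  then have t: "t < 0" using assms by simp
  have *: "((\<lambda>z. sign_pow (-1) e * (- z) powr \<mu>) has_field_derivative sign_pow (-1) e * (\<mu> * (- complex_of_real t) powr (\<mu> - 1) * (-1))) (at (complex_of_real t))"
    using t by (auto intro!: derivative_eq_intros simp: complex_nonpos_Reals_iff)
  have flip: "sign_pow (-1) (e + 1) = - sign_pow (-1) e"
    by (cases "e = 0") (auto simp: sign_pow_def)
  from has_vector_derivative_real_field[OF *]
  have "((\<lambda>s. sign_pow (-1) e * (- complex_of_real s) powr \<mu>) has_vector_derivative
     sign_pow (-1) e * (\<mu> * (- complex_of_real t) powr (\<mu> - 1) * (-1))) (at t)" .
  then show ?thesis
    by (rule has_vector_derivative_transform_within_open[where S = "{..<0}", THEN has_vector_derivative_eq_rhs])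
      (use t flip in \<open>auto simp: sign_powr_def\<close>)
qed

lemma smooth_on_sign_powr:
  assumes S: "open S" and d: "smooth_on S d" and "\<And>x. x \<in> S \<Longrightarrow> Re (d x) \<noteq> 0"
  shows "smooth_on S (\<lambda>x. sign_powr e \<mu> (Re (d x)))"
proof (rule smooth_on_comp_real[OF S d, where T = "- {0}" and W = "{\<lambda>t. c * sign_powr e \<mu> t | c e \<mu>. True}"], goal_cases)
  case 2
  show ?case by (intro CollectI exI[of _ 1] exI[of _ e] exI[of _ \<mu>]) auto
next
  case (3 w)
  then obtain c e \<mu> where w: "w = (\<lambda>t. c * sign_powr e \<mu> t)" by auto
  have "(w has_vector_derivative (c * \<mu>) * sign_powr (e + 1) (\<mu> - 1) t) (at t)" if "t \<in> - {0}" for t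
    using has_vector_derivative_mult_right[OF sign_powr_has_vector_derivative, of t c e \<mu>] that
    unfolding w by (simp only: mult.assoc) simp
  then show ?case
    by (intro bexI[of _ "\<lambda>t. (c * \<mu>) * sign_powr (e + 1) (\<mu> - 1) t"]) blast+
qed (use assms in auto)

text \<open>The reciprocal is the character of odd parity and exponent -1.\<close>

lemma smooth_on_inverse:
  assumes S: "open S" and d: "smooth_on S (\<lambda>x. complex_of_real (d x))" and n: "\<And>x. x \<in> S \<Longrightarrow> d x \<noteq> 0"
  shows "smooth_on S (\<lambda>x. complex_of_real (inverse (d x)))"
  using smooth_on_sign_powr[OF S d, of 1 "-1"] n
  by (subst smooth_on_cong_open[OF S, of _ "\<lambda>x. sign_powr 1 (-1) (d x)"]) (auto simp: sign_powr_inverse)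

text \<open>The polynomial parameter makes the family stable under differentiation;
  \<open>p = 1\<close> is the standard smooth function that is flat at 0, and it serves as a
  cutoff.\<close>

definition flat_exp :: "real poly \<Rightarrow> real \<Rightarrow> real"
  where "flat_exp p t = (if t > 0 then poly p (1 / t) * exp (- (1 / t)) else 0)"

lemma poly_exp_tendsto_0: "((\<lambda>s. poly p s * exp (- s)) \<longlongrightarrow> (0::real)) at_top"
proof -
  have "((\<lambda>s. \<Sum>i\<le>degree p. coeff p i * (s ^ i / exp s)) \<longlongrightarrow> (\<Sum>i\<le>degree p. coeff p i * 0)) at_top"
    by (intro tendsto_sum tendsto_mult tendsto_const tendsto_power_div_exp_0)
  then show ?thesis
    by (simp add: poly_altdef sum_distrib_right exp_minus divide_inverse mult.assoc)
qed

text \<open>With s = 1/t one has ds/dt = - s^2, so p(s) exp(-s) differentiates to s^2 (p - p')(s)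
  exp(-s). At 0 the difference quotient from the right is s p(s) exp(-s), which tends to 0.\<close>

lemma flat_exp_has_derivative:
  "(flat_exp p has_real_derivative flat_exp ([:0, 0, 1:] * (p - pderiv p)) t) (at t)"
proof -
  consider "t > 0" | "t < 0" | "t = 0" by linarith
  then show ?thesis
  proof cases
    case 1
    have "((\<lambda>t. poly p (1 / t) * exp (- (1 / t))) has_real_derivative
        poly ([:0, 0, 1:] * (p - pderiv p)) (1 / t) * exp (- (1 / t))) (at t)"
      using 1 by (auto intro!: derivative_eq_intros simp: field_simps power2_eq_square)
    then have "(flat_exp p has_real_derivative
        poly ([:0, 0, 1:] * (p - pderiv p)) (1 / t) * exp (- (1 / t))) (at t)"
      by (rule has_field_derivative_transform_within_open[where S = "{0<..}"])
        (use 1 in \<open>auto simp: flat_exp_def\<close>)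
    then show ?thesis using 1 by (simp add: flat_exp_def)
  next
    case 2
    have "((\<lambda>t. 0) has_real_derivative 0) (at t)" by simp
    then have "(flat_exp p has_real_derivative 0) (at t)"
      by (rule has_field_derivative_transform_within_open[where S = "{..<0}"])
        (use 2 in \<open>auto simp: flat_exp_def\<close>)
    then show ?thesis using 2 by (simp add: flat_exp_def)
  next
    case 3
    have r: "((\<lambda>y. flat_exp p y / y) \<longlongrightarrow> 0) (at_right 0)"
    proof -
      have "((\<lambda>y. poly (pCons 0 p) (inverse y) * exp (- inverse y)) \<longlongrightarrow> 0) (at_right (0::real))"
        by (rule filterlim_compose[OF poly_exp_tendsto_0 filterlim_inverse_at_top_right])
      then show ?thesis
        by (rule Lim_transform_eventually)
          (auto simp: flat_exp_def eventually_at_right_less inverse_eq_divide field_simps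
             intro!: eventually_mono[OF eventually_at_right_less[of 0]])
    qed
    have "((\<lambda>y. flat_exp p y / y) \<longlongrightarrow> 0) (at_left 0)"
      by (rule Lim_transform_eventually[OF tendsto_const])
        (auto simp: flat_exp_def eventually_at intro!: exI[of _ 1])
    with r have "((\<lambda>y. flat_exp p y / y) \<longlongrightarrow> 0) (at 0)"
      by (simp add: filterlim_split_at)
    then show ?thesis using 3 by (simp add: has_field_derivative_iff flat_exp_def)
  qed
qed

lemma smooth_on_flat_exp:
  assumes S: "open S" and d: "smooth_on S (\<lambda>x. complex_of_real (d x))"
  shows "smooth_on S (\<lambda>x. complex_of_real (flat_exp 1 (d x)))"
proof -
  have "smooth_on S (\<lambda>x. (\<lambda>t. complex_of_real (flat_exp 1 t)) (Re (complex_of_real (d x))))"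
  proof (rule smooth_on_comp_real[OF S d, where T = UNIV and W = "range (\<lambda>p t. complex_of_real (flat_exp p t))"], goal_cases)
    case (3 w)
    then obtain p where "w = (\<lambda>t. complex_of_real (flat_exp p t))" by auto
    then show ?case
      by (intro bexI[of _ "\<lambda>t. complex_of_real (flat_exp ([:0, 0, 1:] * (p - pderiv p)) t)"])
        (auto simp del: mult_pCons_left intro!: has_vector_derivative_of_real flat_exp_has_derivative)
  qed auto
  then show ?thesis by simp
qed

section \<open>Principal series and derivatives at the identity\<close>

lemma open_GL: "open (GL :: (real^'n^'n) set)"
proof -
  have "continuous_on UNIV (det :: real^'n^'n \<Rightarrow> real)"
    unfolding det_def by (intro continuous_intros)
  moreover have "(GL :: (real^'n^'n) set) = det -` (- {0})"
    by (auto simp: GL_def invertible_det_nz)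
  ultimately show ?thesis using open_vimage[of "- {0::real}" "det :: real^'n^'n \<Rightarrow> real"] by (simp add: open_Compl)
qed

lemma GL_mult: "g \<in> GL \<Longrightarrow> h \<in> GL \<Longrightarrow> g ** h \<in> GL"
  by (simp add: GL_def invertible_mult)

lemma GL_mult_iff_left: "g \<in> GL \<Longrightarrow> g ** h \<in> GL \<longleftrightarrow> h \<in> GL"
  by (simp add: GL_def invertible_det_nz det_mul)

lemma mat_1_GL: "mat 1 \<in> GL"
  by (simp add: GL_def invertible_det_nz)

lemma matrix_inv_mult:
  assumes "g \<in> GL"
  shows "g ** matrix_inv g = mat 1" "matrix_inv g ** g = mat 1"
proof -
  have "g ** matrix_inv g = mat 1 \<and> matrix_inv g ** g = mat 1"
    using assms unfolding GL_def matrix_inv_def mem_Collect_eq invertible_def by (rule someI_ex)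
  then show "g ** matrix_inv g = mat 1" "matrix_inv g ** g = mat 1" by auto
qed

lemma matrix_inv_GL: "g \<in> GL \<Longrightarrow> matrix_inv g \<in> GL"
  using matrix_inv_mult[of g] unfolding GL_def mem_Collect_eq invertible_def[of "matrix_inv g"] by auto

lemma matrix_add_rdistrib: "(B + C) ** A = B ** A + C ** (A :: real^'n^'n)"
  by (simp add: vec_eq_iff matrix_matrix_mult_def sum.distrib algebra_simps)

lemma matrix_mult_bounded_linear:
  "bounded_linear (\<lambda>x::real^'n^'n. g ** x)" "bounded_linear (\<lambda>x::real^'n^'n. x ** g)"
  unfolding linear_conv_bounded_linear[symmetric] linear_iff
  by (simp_all add: matrix_add_ldistrib matrix_add_rdistrib scalar_matrix_assoc matrix_scalar_ac)

lemma has_derivative_matrix_mult: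
  "((\<lambda>x::real^'n^'n. g ** x) has_derivative (\<lambda>x. g ** x)) (at x)"
  "((\<lambda>x::real^'n^'n. x ** g) has_derivative (\<lambda>x. x ** g)) (at x)"
  by (intro bounded_linear_imp_has_derivative matrix_mult_bounded_linear)+

lemma diag_mat_mult: "diag_mat a ** diag_mat b = diag_mat (\<chi> j. a $ j * b $ j)"
proof -
  have "(\<Sum>k\<in>UNIV. (if i = k then a $ i else 0) * (if k = j then b $ k else 0))
      = (\<Sum>k\<in>UNIV. if k = i then (if i = j then a $ i * b $ i else 0) else 0)" for i j
    by (rule sum.cong) auto
  then show ?thesis by (simp add: diag_mat_def matrix_matrix_mult_def vec_eq_iff)
qed

lemma diag_mat_1: "diag_mat (\<chi> j. 1) = mat 1"
  by (simp add: diag_mat_def mat_def vec_eq_iff)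

lemma det_diag_mat: "det (diag_mat d) = (\<Prod>j\<in>UNIV. d $ j)"
  by (subst det_diagonal) (auto simp: diag_mat_def)

lemma diag_mat_GL: "(\<And>j. d $ j \<noteq> 0) \<Longrightarrow> diag_mat d \<in> GL"
  by (simp add: GL_def invertible_det_nz det_diag_mat)

text \<open>A diagonal matrix with nonzero entries splits into signs and absolute values, so M and A
  act through one character per entry; \<open>mat 1 \<in> U\<close> separates this action from that
  of \<open>U\<close>. Signs are their own inverses, so the inverse disappears.\<close>

lemma principal_series_iff:
  fixes U :: "(real^'n^'n) set"
  assumes U: "mat 1 \<in> U"
  shows "f \<in> principal_series U \<xi> l \<longleftrightarrow> smooth_on GL f \<and> (\<forall>g. g \<notin> GL \<longrightarrow> f g = 0) \<and>
    (\<forall>g\<in>GL. \<forall>d. (\<forall>j. d $ j \<noteq> 0) \<longrightarrow>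
      f (g ** diag_mat d) = (\<Prod>j\<in>UNIV. sign_powr (\<xi> $ j) (- (l $ j)) (d $ j)) * f g) \<and>
    (\<forall>g\<in>GL. \<forall>n\<in>U. f (g ** n) = f g)" (is "?A \<longleftrightarrow> ?B")
proof
  have eq: "(\<Prod>j\<in>UNIV. inverse (sign_pow (m $ j) (\<xi> $ j))) * (\<Prod>j\<in>UNIV. of_real (a $ j) powr (- (l $ j)))
     = (\<Prod>j\<in>UNIV. sign_powr (\<xi> $ j) (- (l $ j)) (m $ j * a $ j))"
    if m: "\<forall>j. m $ j \<in> {1, -1}" and a: "\<forall>j. a $ j > 0" for m a :: "real^'n"
  proof -
    have "inverse (sign_pow (m $ j) (\<xi> $ j)) * of_real (a $ j) powr (- (l $ j)) = sign_powr (\<xi> $ j) (- (l $ j)) (m $ j * a $ j)" for j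
      using m[rule_format, of j] a[rule_format, of j]
      by (auto simp: sign_powr_def sign_pow_def abs_mult sgn_mult)
    then show ?thesis by (simp add: prod.distrib[symmetric])
  qed
  show ?B if A: ?A
  proof (intro conjI ballI allI impI)
    have H: "f (g ** diag_mat m ** diag_mat a ** n) = (\<Prod>j\<in>UNIV. sign_powr (\<xi> $ j) (- (l $ j)) (m $ j * a $ j)) * f g"
      if "g \<in> GL" "\<forall>j. m $ j \<in> {1, -1}" "\<forall>j. a $ j > 0" "n \<in> U" for g n :: "real^'n^'n" and m a :: "real^'n"
      using A that eq[of m a] unfolding principal_series_def by auto
    show "f (g ** n) = f g" if "g \<in> GL" "n \<in> U" for g n
      using H[OF that(1) _ _ that(2), of "\<chi> j. 1" "\<chi> j. 1"] by (simp add: diag_mat_1)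
    show "f (g ** diag_mat d) = (\<Prod>j\<in>UNIV. sign_powr (\<xi> $ j) (- (l $ j)) (d $ j)) * f g"
      if "g \<in> GL" "\<forall>j. d $ j \<noteq> 0" for g d
      using H[OF that(1) _ _ U, of "\<chi> j. sgn (d $ j)" "\<chi> j. \<bar>d $ j\<bar>"] that(2)
      by (simp add: matrix_mul_assoc[symmetric] diag_mat_mult diag_mat_1 sgn_mult_abs) (simp add: sgn_if)
  qed (use A in \<open>auto simp: principal_series_def\<close>)
  show ?A if B: ?B
    unfolding principal_series_def mem_Collect_eq
  proof (intro conjI allI impI)
    fix g n :: "real^'n^'n" and m a :: "real^'n"
    assume "g \<in> GL \<and> (\<forall>j. m $ j \<in> {1, -1}) \<and> (\<forall>j. a $ j > 0) \<and> n \<in> U"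
    then have g: "g \<in> GL" and m: "\<forall>j. m $ j \<in> {1, -1}" and a: "\<forall>j. a $ j > 0" and n: "n \<in> U" by auto
    have ma: "\<forall>j. m $ j * a $ j \<noteq> 0" 
    proof
      fix j
      have "m $ j = 1 \<or> m $ j = -1" "a $ j > 0" using m a by auto
      then show "m $ j * a $ j \<noteq> 0" by auto
    qed
    have "f (g ** diag_mat m ** diag_mat a ** n) = f ((g ** diag_mat (\<chi> j. m $ j * a $ j)) ** n)"
      by (simp add: matrix_mul_assoc[symmetric] diag_mat_mult)
    also have "\<dots> = f (g ** diag_mat (\<chi> j. m $ j * a $ j))"
      using B g n ma by (auto simp: GL_mult diag_mat_GL)
    also have "\<dots> = (\<Prod>j\<in>UNIV. sign_powr (\<xi> $ j) (- (l $ j)) (m $ j * a $ j)) * f g"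
      using B g ma by simp
    finally show "f (g ** diag_mat m ** diag_mat a ** n) =
         (\<Prod>j\<in>UNIV. inverse (sign_pow (m $ j) (\<xi> $ j))) * (\<Prod>j\<in>UNIV. of_real (a $ j) powr (- (l $ j))) * f g"
      using eq[OF m a] by simp
  qed (use B in auto)
qed

lemma principal_series_smooth: "f \<in> principal_series U \<xi> l \<Longrightarrow> smooth_on GL f"
  by (simp add: principal_series_def)

lemma principal_series_add:
  "f \<in> principal_series U \<xi> l \<Longrightarrow> g \<in> principal_series U \<xi> l \<Longrightarrow> (\<lambda>x. f x + g x) \<in> principal_series U \<xi> l"
  by (auto simp: principal_series_def smooth_on_add[OF open_GL] distrib_left)

lemma principal_series_cmult:
  "f \<in> principal_series U \<xi> l \<Longrightarrow> (\<lambda>x. z * f x) \<in> principal_series U \<xi> l"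
  by (auto simp: principal_series_def smooth_on_mult[OF open_GL] smooth_on_const)

lemma principal_series_left:
  assumes f: "f \<in> principal_series U \<xi> l" and h: "h \<in> GL"
  shows "(\<lambda>x. f (h ** x)) \<in> principal_series U \<xi> l"
proof -
  have "smooth_on GL (\<lambda>x. f (h ** x))"
    using GL_mult[OF h] by (rule smooth_on_affine[OF open_GL principal_series_smooth[OF f] has_derivative_matrix_mult(1)])
  then show ?thesis
    using f h by (simp add: principal_series_def GL_mult_iff_left matrix_mul_assoc GL_mult)
qed

section \<open>Elementary matrices and upper triangular directions\<close>

definition elem :: "3 \<Rightarrow> 3 \<Rightarrow> mat3"
  where "elem a b = axis a (axis b 1)"

lemma elem_nth: "elem a b $ i $ j = (if i = a \<and> j = b then 1 else 0)"
  by (simp add: elem_def axis_def)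

lemma elem_mult: "elem a b ** elem c d = (if b = c then elem a d else 0)"
proof -
  have "(\<Sum>k\<in>UNIV. (if i = a \<and> k = b then 1 else 0) * (if k = c \<and> j = d then 1 else (0::real)))
      = (\<Sum>k\<in>UNIV. if k = b then (if i = a \<and> b = c \<and> j = d then 1 else 0) else 0)" for i j
    by (rule sum.cong) auto
  then show ?thesis by (simp add: matrix_matrix_mult_def vec_eq_iff elem_nth)
qed

lemma Basis_mat3: "(Basis :: mat3 set) = {elem a b | a b. True}"
  by (auto simp: Basis_vec_def elem_def)

text \<open>The directions in the Lie algebra of P, along which right equivariance prescribes the
  derivative.\<close>

definition upper :: "3 \<Rightarrow> 3 \<Rightarrow> bool"
  where "upper a b \<longleftrightarrow> a = b \<or> (a, b) \<in> {(1, 2), (1, 3), (2, 3)}"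

lemma mat_1_upper_unipotent3: "mat 1 \<in> upper_unipotent3"
  unfolding upper_unipotent3_def
  by (rule CollectI, rule exI[of _ 0], rule exI[of _ 0], rule exI[of _ 0]) (simp add: vec_eq_iff forall_3 mat_def)

lemma mat_1_upper_unipotent2: "mat 1 \<in> upper_unipotent2"
  unfolding upper_unipotent2_def
  by (rule CollectI, rule exI[of _ 0]) (simp add: vec_eq_iff forall_2 mat_def)

lemma elem_upper_unipotent3:
  assumes "upper a b" "a \<noteq> b"
  shows "mat 1 + c *\<^sub>R elem a b \<in> upper_unipotent3"
  unfolding upper_unipotent3_def
  by (rule CollectI, rule exI[of _ "if (a, b) = (1, 2) then c else 0"], rule exI[of _ "if (a, b) = (1, 3) then c else 0"],
      rule exI[of _ "if (a, b) = (2, 3) then c else 0"])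
    (use assms in \<open>auto simp: upper_def vec_eq_iff forall_3 mat_def elem_nth\<close>)

lemmas I_rep_iff = principal_series_iff[OF mat_1_upper_unipotent3, folded I_rep_def]
lemmas J_rep_iff = principal_series_iff[OF mat_1_upper_unipotent2, folded J_rep_def]
lemmas I_rep_smooth = principal_series_smooth[of _ upper_unipotent3, folded I_rep_def]
lemmas I_rep_left = principal_series_left[of _ upper_unipotent3, folded I_rep_def]

text \<open>Differentiate the equivariance of \<open>f\<close> under right multiplication by \<open>1 + c E\<^sub>a\<^sub>b\<close> at \<open>c = 0\<close>.\<close>

lemma I_rep_upper_deriv:
  assumes f: "f \<in> I_rep \<xi> l" and ab: "upper a b"
  shows "dir_derivs (elem a b # vs) f (mat 1) + (\<Sum>i<length vs. dir_derivs (vs[i := vs ! i ** elem a b]) f (mat 1))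
    = (if a = b then - (l $ a) else 0) * dir_derivs vs f (mat 1)"
proof -
  let ?X = "elem a b"
  \<comment> \<open>The factor by which right multiplication by 1 + c E_ab acts: for
    \<open>a \<noteq> b\<close> the matrix is unipotent, and for \<open>a = b\<close> it is
    diagonal, invertible as long as \<open>-1 < c\<close>.\<close>
  let ?k = "\<lambda>c. if a = b then sign_powr (\<xi> $ a) (- (l $ a)) (1 + c) else 1"
  let ?F = "\<lambda>c. dir_derivs ([] @ map (\<lambda>v. v + c *\<^sub>R (v ** ?X)) vs) f (mat 1 + c *\<^sub>R ?X)"
  have sm: "smooth_on GL f" using f by (rule I_rep_smooth)
  have k: "f (x ** (mat 1 + c *\<^sub>R ?X)) = ?k c * f x" if c: "c \<in> {-1<..<1}" and x: "x \<in> GL" for c x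
  proof (cases "a = b")
    case True
    let ?d = "\<chi> j. if j = a then 1 + c else 1"
    have "mat 1 + c *\<^sub>R ?X = diag_mat ?d"
      by (auto simp: vec_eq_iff diag_mat_def mat_def elem_nth True)
    moreover have "f (x ** diag_mat ?d) = (\<Prod>j\<in>UNIV. sign_powr (\<xi> $ j) (- (l $ j)) (?d $ j)) * f x"
    proof -
      have "\<forall>j. ?d $ j \<noteq> 0" using c by auto
      then show ?thesis using f x unfolding I_rep_iff by blast
    qed
    moreover have "(\<Prod>j\<in>UNIV. sign_powr (\<xi> $ j) (- (l $ j)) (?d $ j)) = sign_powr (\<xi> $ a) (- (l $ a)) (1 + c)"
      by (subst prod.remove[of _ a]) auto
    ultimately show ?thesis using True by simp
  next
    case False
    then show ?thesis using f x elem_upper_unipotent3[OF ab False] unfolding I_rep_iff by simp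
  qed
  have GL: "mat 1 + c *\<^sub>R ?X \<in> GL" if c: "c \<in> {-1<..<1}" for c
    using c ab unfolding GL_def mem_Collect_eq invertible_det_nz upper_def
    by (auto simp: det_3 mat_def elem_nth)
  have F: "?F c = ?k c * dir_derivs vs f (mat 1)" if c: "c \<in> {-1<..<1}" for c
  proof -
    let ?B = "mat 1 + c *\<^sub>R ?X"
    \<comment> \<open>Right multiplication is linear, so it moves directions in the same way as
      points.\<close>
    have m: "(\<lambda>v. v + c *\<^sub>R (v ** ?X)) = (\<lambda>v. v ** ?B)"
      by (simp add: matrix_add_ldistrib matrix_scalar_ac scalar_matrix_assoc fun_eq_iff)
    have "?F c = dir_derivs (map (\<lambda>v. v ** ?B) vs) f (mat 1 ** ?B)" unfolding m by simp
    also have "\<dots> = dir_derivs vs (\<lambda>x. f (x ** ?B)) (mat 1)"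
      by (rule dir_derivs_affine[OF open_GL sm has_derivative_matrix_mult(2), symmetric]) (simp add: GL[OF c])
    also have "\<dots> = dir_derivs vs (\<lambda>x. ?k c * f x) (mat 1)"
      by (rule dir_derivs_cong_open[OF open_GL k[OF c] mat_1_GL])
    also have "\<dots> = ?k c * dir_derivs vs f (mat 1)"
      by (rule dir_derivs_cmult[OF open_GL sm mat_1_GL])
    finally show ?thesis .
  qed
  have "((\<lambda>c. sign_powr (\<xi> $ a) (- (l $ a)) (1 + c)) has_vector_derivative 1 *\<^sub>R (- (l $ a) * sign_powr (\<xi> $ a + 1) (- (l $ a) - 1) (1 + 0))) (at 0)"
  proof (rule vector_diff_chain_at[unfolded o_def, where f = "\<lambda>c. 1 + c"])
    show "((\<lambda>c. 1 + c) has_vector_derivative 1) (at (0::real))"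
      by (auto intro!: derivative_eq_intros simp: has_vector_derivative_def)
    show "(sign_powr (\<xi> $ a) (- (l $ a)) has_vector_derivative - (l $ a) * sign_powr (\<xi> $ a + 1) (- (l $ a) - 1) (1 + 0)) (at (1 + 0))"
      by (rule sign_powr_has_vector_derivative) simp
  qed
  then have "(?k has_vector_derivative (if a = b then - (l $ a) else 0)) (at 0)" by (cases "a = b") simp_all
  then have "((\<lambda>c. ?k c * dir_derivs vs f (mat 1)) has_vector_derivative
      (if a = b then - (l $ a) else 0) * dir_derivs vs f (mat 1)) (at 0)"
    by (rule has_vector_derivative_mult_left)
  then have "(?F has_vector_derivative (if a = b then - (l $ a) else 0) * dir_derivs vs f (mat 1)) (at 0)"
    by (rule has_vector_derivative_transform_within_open[where S = "{-1<..<1}"]) (use F in auto)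
  from vector_derivative_unique_at[OF dir_derivs_curve[OF open_GL sm mat_1_GL, of "[]" "\<lambda>v. v ** ?X" vs ?X] this]
  show ?thesis by simp
qed

section \<open>Jets along the opposite unipotent group\<close>

definition mlist :: "nat \<Rightarrow> nat \<Rightarrow> nat \<Rightarrow> mat3 list"
  where "mlist i j k = replicate i (elem 2 1) @ replicate j (elem 3 1) @ replicate k (elem 3 2)"

text \<open>The directions are fixed matrices, so these derivatives do not depend on the order
  inside \<open>mlist\<close>.\<close>

definition jet :: "nat \<Rightarrow> nat \<Rightarrow> nat \<Rightarrow> (mat3 \<Rightarrow> complex) \<Rightarrow> complex"
  where "jet i j k f = dir_derivs (mlist i j k) f (mat 1)"

lemma dir_derivs_zero:
  assumes S: "open S" and f: "smooth_on S f" and x: "x \<in> S" and "0 \<in> set vs"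
  shows "dir_derivs vs f x = 0"
  using assms(4) dir_derivs_linear_nth[OF S f x] linear_0 by (metis split_list)

text \<open>Order is irrelevant, so the replaced entry can be brought to the head; the term then
  depends on the value of the entry and not on its position.\<close>

lemma dir_derivs_update_sum:
  assumes S: "open S" and f: "smooth_on S f" and x: "x \<in> S"
  shows "(\<Sum>i<length vs. dir_derivs (vs[i := \<phi> (vs ! i)]) f x) = (\<Sum>v\<leftarrow>vs. dir_derivs (\<phi> v # remove1 v vs) f x)"
proof -
  have "dir_derivs (vs[i := \<phi> (vs ! i)]) f x = dir_derivs (\<phi> (vs ! i) # remove1 (vs ! i) vs) f x" if "i < length vs" for i
    by (rule dir_derivs_perm[OF S f _ x]) (use that in \<open>simp add: mset_update\<close>)
  then show ?thesis
    by (simp add: sum_list_sum_nth atLeast0LessThan)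
qed

lemma elem_eq_iff: "elem a b = elem c d \<longleftrightarrow> a = c \<and> b = d"
proof
  assume "elem a b = elem c d"
  then have "elem a b $ a $ b = elem c d $ a $ b" by simp
  then show "a = c \<and> b = d" by (simp add: elem_nth split: if_splits)
qed simp

text \<open>Equal entries give equal terms, whence the multiplicities. When a multiplicity is 0,
  this factor absorbs the truncated subtraction.\<close>

lemma mlist_update_sum:
  assumes S: "open S" and f: "smooth_on S f" and x: "x \<in> S"
  shows "(\<Sum>m<length (mlist i j k). dir_derivs ((mlist i j k)[m := \<phi> (mlist i j k ! m)]) f x) =
    of_nat i * dir_derivs (\<phi> (elem 2 1) # mlist (i - 1) j k) f x +
    of_nat j * dir_derivs (\<phi> (elem 3 1) # mlist i (j - 1) k) f x +
    of_nat k * dir_derivs (\<phi> (elem 3 2) # mlist i j (k - 1)) f x"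
proof -
  let ?H = "\<lambda>v. dir_derivs (\<phi> v # remove1 v (mlist i j k)) f x"
  have "?H (elem 2 1) = dir_derivs (\<phi> (elem 2 1) # mlist (i - 1) j k) f x" if "i > 0"
    using that by (intro dir_derivs_perm[OF S f _ x]) (cases i, auto simp: mlist_def)
  moreover have "?H (elem 3 1) = dir_derivs (\<phi> (elem 3 1) # mlist i (j - 1) k) f x" if "j > 0"
    using that by (intro dir_derivs_perm[OF S f _ x]) (cases j, auto simp: mlist_def)
  moreover have "?H (elem 3 2) = dir_derivs (\<phi> (elem 3 2) # mlist i j (k - 1)) f x" if "k > 0"
    using that by (intro dir_derivs_perm[OF S f _ x]) (cases k, auto simp: mlist_def)
  moreover have "(\<Sum>v\<leftarrow>mlist i j k. ?H v) = of_nat i * ?H (elem 2 1) + of_nat j * ?H (elem 3 1) + of_nat k * ?H (elem 3 2)"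
    unfolding mlist_def[of i j k] map_append sum_list_append map_replicate sum_list_replicate
    unfolding mlist_def[of i j k, symmetric] by simp
  ultimately show ?thesis unfolding dir_derivs_update_sum[OF assms]
    by (cases "i = 0"; cases "j = 0"; cases "k = 0") simp_all
qed

context
  fixes f \<xi> l
  assumes f: "f \<in> I_rep \<xi> l"
begin

private abbreviation D where "D a b i j k \<equiv> dir_derivs (elem a b # mlist i j k) f (mat 1)"

private lemma D_lower:
  "D 2 1 i j k = jet (Suc i) j k f" "D 3 1 i j k = jet i (Suc j) k f" "D 3 2 i j k = jet i j (Suc k) f"
  unfolding jet_def by (rule dir_derivs_perm[OF open_GL I_rep_smooth[OF f] _ mat_1_GL]; simp add: mlist_def)+

private lemma D_zero: "dir_derivs (0 # vs) f (mat 1) = 0"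
  by (rule dir_derivs_zero[OF open_GL I_rep_smooth[OF f] mat_1_GL]) simp

text \<open>Right equivariance, solved for the derivative with an upper direction at the head. The
  products on the right are elementary or 0, so everything reduces to jets; below,
  \<open>D23\<close> rests on \<open>D33\<close> and \<open>D12\<close> on
  \<open>D22\<close>.\<close>

private lemma D_upper:
  assumes "upper a b"
  shows "D a b i j k = (if a = b then - (l $ a) else 0) * jet i j k f -
    (of_nat i * dir_derivs (elem 2 1 ** elem a b # mlist (i - 1) j k) f (mat 1) +
     of_nat j * dir_derivs (elem 3 1 ** elem a b # mlist i (j - 1) k) f (mat 1) +
     of_nat k * dir_derivs (elem 3 2 ** elem a b # mlist i j (k - 1)) f (mat 1))"
  using I_rep_upper_deriv[OF f assms, of "mlist i j k"]
    mlist_update_sum[OF open_GL I_rep_smooth[OF f] mat_1_GL, of i j k "\<lambda>v. v ** elem a b"]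
  by (simp add: jet_def algebra_simps del: dir_derivs.simps)

private lemmas D_simps = elem_mult D_lower D_zero upper_def

lemma D33: "D 3 3 i j k = - (l $ 3) * jet i j k f"
  by (subst D_upper) (simp_all add: D_simps del: dir_derivs.simps)

lemma D22: "D 2 2 i j k = - (l $ 2 + of_nat k) * jet i j k f"
  by (subst D_upper; cases k) (simp_all add: D_simps algebra_simps del: dir_derivs.simps)

lemma D11: "D 1 1 i j k = - (l $ 1 + of_nat i + of_nat j) * jet i j k f"
  by (subst D_upper; cases i; cases j) (simp_all add: D_simps algebra_simps del: dir_derivs.simps)

lemma D23: "D 2 3 i j k = of_nat k * l $ 3 * jet i j (k - 1) f"
  by (subst D_upper) (simp_all add: D_simps D33 algebra_simps del: dir_derivs.simps)

lemma D12: "D 1 2 i j k = of_nat i * (l $ 2 + of_nat k) * jet (i - 1) j k f - of_nat j * jet i (j - 1) (Suc k) f"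
  by (subst D_upper) (simp_all add: D_simps D22 algebra_simps del: dir_derivs.simps)

text \<open>First order effect of left translation by 1 + c E_13. On directions, E_13 E_31 = E_11,
  E_13 E_32 = E_12 and E_13 E_21 = 0, and the moving base point adds the direction E_13. All these
  directions are upper, and eliminating them leaves jets of lower order.\<close>

lemma jet_raising_deriv:
  "D 1 3 i j k + (\<Sum>m<length (mlist i j k). dir_derivs ((mlist i j k)[m := elem 1 3 ** (mlist i j k ! m)]) f (mat 1))
    = of_nat j * (l $ 3 - l $ 1 - of_nat (i + j + k) + 1) * jet i (j - 1) k f +
      of_nat i * of_nat k * (l $ 2 - l $ 3 + of_nat k - 1) * jet (i - 1) j (k - 1) f"
proof -
  have 1: "D 1 3 i j k = - (of_nat i * D 2 3 (i - 1) j k + of_nat j * D 3 3 i (j - 1) k)"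
    by (subst D_upper) (simp_all add: D_simps del: dir_derivs.simps)
  have 2: "(\<Sum>m<length (mlist i j k). dir_derivs ((mlist i j k)[m := elem 1 3 ** (mlist i j k ! m)]) f (mat 1))
    = of_nat j * D 1 1 i (j - 1) k + of_nat k * D 1 2 i j (k - 1)"
    unfolding mlist_update_sum[OF open_GL I_rep_smooth[OF f] mat_1_GL, of i j k "\<lambda>v. elem 1 3 ** v"]
    by (simp add: D_simps del: dir_derivs.simps)
  show ?thesis
    unfolding 1 2 D23 D33 D11 D12
    by (cases j; cases k) (simp_all add: algebra_simps)
qed

end

lemma jet_raising_has_derivative:
  assumes f: "f \<in> I_rep \<xi> l"
  shows "((\<lambda>c. jet i j k (\<lambda>x. f ((mat 1 + c *\<^sub>R elem 1 3) ** x))) has_vector_derivative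
     of_nat j * (l $ 3 - l $ 1 - of_nat (i + j + k) + 1) * jet i (j - 1) k f +
      of_nat i * of_nat k * (l $ 2 - l $ 3 + of_nat k - 1) * jet (i - 1) j (k - 1) f) (at 0)"
proof -
  have GL: "mat 1 + c *\<^sub>R elem 1 3 \<in> GL" for c
    by (simp add: GL_def invertible_det_nz det_3 mat_def elem_nth)
  have "jet i j k (\<lambda>x. f ((mat 1 + c *\<^sub>R elem 1 3) ** x)) =
    dir_derivs ([] @ map (\<lambda>v. v + c *\<^sub>R (elem 1 3 ** v)) (mlist i j k)) f (mat 1 + c *\<^sub>R elem 1 3)" for c
  proof -
    have "(\<lambda>v :: mat3. v + c *\<^sub>R (elem 1 3 ** v)) = (\<lambda>v. (mat 1 + c *\<^sub>R elem 1 3) ** v)"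
      by (simp add: matrix_add_rdistrib scalar_matrix_assoc fun_eq_iff)
    moreover have "jet i j k (\<lambda>x. f ((mat 1 + c *\<^sub>R elem 1 3) ** x)) =
      dir_derivs (map (\<lambda>v. (mat 1 + c *\<^sub>R elem 1 3) ** v) (mlist i j k)) f ((mat 1 + c *\<^sub>R elem 1 3) ** mat 1)"
      unfolding jet_def
      by (rule dir_derivs_affine[OF open_GL I_rep_smooth[OF f] has_derivative_matrix_mult(1)]) (simp add: GL)
    ultimately show ?thesis by simp
  qed
  with dir_derivs_curve[OF open_GL I_rep_smooth[OF f] mat_1_GL, of "[]" "\<lambda>v. elem 1 3 ** v" "mlist i j k" "elem 1 3"]
    jet_raising_deriv[OF f, of i j k]
  show ?thesis by simp
qed

text \<open>Agreement is required on \<open>I_rep\<close> only, where right equivariance relates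
  derivatives in different directions.\<close>

definition jet_span :: "bit^3 \<Rightarrow> complex^3 \<Rightarrow> ((mat3 \<Rightarrow> complex) \<Rightarrow> complex) set"
  where "jet_span \<xi> l = {T. \<exists>S t. finite S \<and> (\<forall>f\<in>I_rep \<xi> l. T f = (\<Sum>(i, j, k)\<in>S. t (i, j, k) * jet i j k f))}"

lemma jet_span_cong: "(\<And>f. f \<in> I_rep \<xi> l \<Longrightarrow> T f = T' f) \<Longrightarrow> T \<in> jet_span \<xi> l \<longleftrightarrow> T' \<in> jet_span \<xi> l"
  by (simp add: jet_span_def)

lemma jet_span_jet: "jet i j k \<in> jet_span \<xi> l"
  unfolding jet_span_def by (intro CollectI exI[of _ "{(i, j, k)}"] exI[of _ "\<lambda>_. 1"]) simp

lemma jet_span_0: "(\<lambda>f. 0) \<in> jet_span \<xi> l"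
  unfolding jet_span_def by (intro CollectI exI[of _ "{}"]) simp

lemma jet_span_add:
  assumes "T \<in> jet_span \<xi> l" "T' \<in> jet_span \<xi> l"
  shows "(\<lambda>f. T f + T' f) \<in> jet_span \<xi> l"
proof -
  obtain S t S' t' where S: "finite S" "\<forall>f\<in>I_rep \<xi> l. T f = (\<Sum>(i, j, k)\<in>S. t (i, j, k) * jet i j k f)"
    and S': "finite S'" "\<forall>f\<in>I_rep \<xi> l. T' f = (\<Sum>(i, j, k)\<in>S'. t' (i, j, k) * jet i j k f)"
    using assms unfolding jet_span_def by blast
  have "(\<Sum>(i, j, k)\<in>S. t (i, j, k) * jet i j k f) = (\<Sum>(i, j, k)\<in>S \<union> S'. (if (i, j, k) \<in> S then t (i, j, k) else 0) * jet i j k f)" for f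
    by (rule sum.mono_neutral_cong_left) (use S S' in auto)
  moreover have "(\<Sum>(i, j, k)\<in>S'. t' (i, j, k) * jet i j k f) = (\<Sum>(i, j, k)\<in>S \<union> S'. (if (i, j, k) \<in> S' then t' (i, j, k) else 0) * jet i j k f)" for f
    by (rule sum.mono_neutral_cong_left) (use S S' in auto)
  ultimately show ?thesis using S S' unfolding jet_span_def
    by (intro CollectI exI[of _ "S \<union> S'"] exI[of _ "\<lambda>p. (if p \<in> S then t p else 0) + (if p \<in> S' then t' p else 0)"])
      (simp add: distrib_right sum.distrib case_prod_unfold)
qed

lemma jet_span_cmult:
  assumes "T \<in> jet_span \<xi> l"
  shows "(\<lambda>f. z * T f) \<in> jet_span \<xi> l"
proof -
  obtain S t where "finite S" "\<forall>f\<in>I_rep \<xi> l. T f = (\<Sum>(i, j, k)\<in>S. t (i, j, k) * jet i j k f)"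
    using assms unfolding jet_span_def by blast
  then show ?thesis unfolding jet_span_def
    by (intro CollectI exI[of _ S] exI[of _ "\<lambda>p. z * t p"]) (simp add: sum_distrib_left case_prod_unfold mult.assoc)
qed

lemma jet_span_sum:
  assumes "\<And>a. a \<in> A \<Longrightarrow> T a \<in> jet_span \<xi> l"
  shows "(\<lambda>f. \<Sum>a\<in>A. T a f) \<in> jet_span \<xi> l"
  using assms by (induction A rule: infinite_finite_induct) (auto intro: jet_span_0 jet_span_add)

lemma dir_derivs_jet_span:
  assumes "set vs \<subseteq> insert 0 Basis"
  shows "(\<lambda>f. dir_derivs vs f (mat 1)) \<in> jet_span \<xi> l"
  using assms
proof (induction vs rule: length_induct)
  case (1 vs)
  consider "0 \<in> set vs" | "set vs \<subseteq> {elem 2 1, elem 3 1, elem 3 2}" | a b where "upper a b" "elem a b \<in> set vs"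
  proof -
    have "elem a b \<in> {elem 2 1, elem 3 1, elem 3 2} \<or> upper a b" for a b
      by (cases rule: exhaust_3[of a, THEN disjE]; cases rule: exhaust_3[of b, THEN disjE]) (auto simp: upper_def elem_eq_iff)
    then show thesis using that 1(2) unfolding Basis_mat3 by blast
  qed
  then show ?case
  proof cases
    case 1
    then show ?thesis
      using dir_derivs_zero[OF open_GL I_rep_smooth mat_1_GL 1] jet_span_0 by (subst jet_span_cong) auto
  next
    case 2
    then have "mset vs = mset (mlist (count (mset vs) (elem 2 1)) (count (mset vs) (elem 3 1)) (count (mset vs) (elem 3 2)))"
      by (intro multiset_eqI) (auto simp: mlist_def count_eq_zero_iff elem_eq_iff)
    from dir_derivs_perm[OF open_GL I_rep_smooth this mat_1_GL]
    show ?thesis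
      unfolding jet_def[symmetric] by (subst jet_span_cong) (auto intro: jet_span_jet)
  next
    case (3 a b)
    then obtain us ws where vs: "vs = us @ elem a b # ws" by (meson split_list)
    let ?rs = "us @ ws"
    have len: "length ?rs < length vs" by (simp add: vs)
    have "?rs ! i \<in> insert 0 Basis" if "i < length ?rs" for i
      using that 1(2) nth_mem[OF that] unfolding vs by auto
    then have "?rs ! i ** elem a b \<in> insert 0 Basis" if "i < length ?rs" for i
      using that unfolding Basis_mat3 by (force simp: elem_mult)
    then have "set (?rs[i := ?rs ! i ** elem a b]) \<subseteq> insert 0 Basis" if "i < length ?rs" for i
      using that 1(2) set_update_subset_insert[of ?rs i "?rs ! i ** elem a b"] unfolding vs by fastforce
    then have *: "(\<lambda>f. dir_derivs (?rs[i := ?rs ! i ** elem a b]) f (mat 1)) \<in> jet_span \<xi> l" if "i < length ?rs" for i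
      using 1(1) len that by simp
    have "set ?rs \<subseteq> insert 0 Basis" using 1(2) by (auto simp: vs)
    then have **: "(\<lambda>f. dir_derivs ?rs f (mat 1)) \<in> jet_span \<xi> l" using 1(1) len by blast
    have "dir_derivs vs f (mat 1) = (if a = b then - (l $ a) else 0) * dir_derivs ?rs f (mat 1) +
        (-1) * (\<Sum>i<length ?rs. dir_derivs (?rs[i := ?rs ! i ** elem a b]) f (mat 1))" if f: "f \<in> I_rep \<xi> l" for f
    proof -
      have "dir_derivs vs f (mat 1) = dir_derivs (elem a b # ?rs) f (mat 1)"
        by (rule dir_derivs_perm[OF open_GL I_rep_smooth[OF f] _ mat_1_GL]) (simp add: vs)
      then show ?thesis using I_rep_upper_deriv[OF f 3(1), of ?rs] by (simp del: dir_derivs.simps add: algebra_simps)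
    qed
    moreover have "(\<lambda>f. (if a = b then - (l $ a) else 0) * dir_derivs ?rs f (mat 1) +
        (-1) * (\<Sum>i<length ?rs. dir_derivs (?rs[i := ?rs ! i ** elem a b]) f (mat 1))) \<in> jet_span \<xi> l"
      by (intro jet_span_add jet_span_cmult jet_span_sum * **) auto
    ultimately show ?thesis using jet_span_cong[of \<xi> l "\<lambda>f. dir_derivs vs f (mat 1)"] by simp
  qed
qed

section \<open>Test functions on the big cell\<close>

lemma prod_UNIV_3: "(\<Prod>j\<in>(UNIV :: 3 set). F j) = F 1 * F 2 * F 3"
  unfolding UNIV_3 by (simp add: ac_simps)

lemma smooth_on_real_intros:
  assumes S: "open S"
    and d: "smooth_on S (\<lambda>x. complex_of_real (d x))" and e: "smooth_on S (\<lambda>x. complex_of_real (e x))"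
  shows "smooth_on S (\<lambda>x. complex_of_real (d x + e x))"
    and "smooth_on S (\<lambda>x. complex_of_real (d x - e x))"
    and "smooth_on S (\<lambda>x. complex_of_real (d x * e x))"
  using smooth_on_add[OF S d e] smooth_on_diff[OF S d e] smooth_on_mult[OF S d e] by simp_all

lemma smooth_on_real_power:
  assumes S: "open S" and d: "smooth_on S (\<lambda>x. complex_of_real (d x))"
  shows "smooth_on S (\<lambda>x. complex_of_real (d x ^ n))"
  using smooth_on_power[OF S d] by simp

lemma smooth_on_real_divide:
  assumes S: "open S"
    and d: "smooth_on S (\<lambda>x. complex_of_real (d x))" and e: "smooth_on S (\<lambda>x. complex_of_real (e x))"
    and ne: "\<And>x. x \<in> S \<Longrightarrow> e x \<noteq> 0"
  shows "smooth_on S (\<lambda>x. complex_of_real (d x / e x))"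
  using smooth_on_mult[OF S d smooth_on_inverse[OF S e ne]] by (simp add: divide_inverse)

lemma smooth_on_entry:
  assumes "open S"
  shows "smooth_on S (\<lambda>g :: real^'n^'m. complex_of_real (g $ i $ j))"
  by (rule smooth_on_linear[OF assms])
    (rule bounded_linear_compose[OF bounded_linear_vec_nth bounded_linear_vec_nth])

lemma smooth_on_coord:
  assumes "open S"
  shows "smooth_on S (\<lambda>p :: real^'n. complex_of_real (p $ i))"
  by (rule smooth_on_linear[OF assms]) (rule bounded_linear_vec_nth)

text \<open>Like the first column, the minors of the first two columns are invariant under right
  unipotent multiplication and scaled by right diagonal multiplication. Quotients of two of them are
  therefore functions on a part of G/P.\<close>

definition minor :: "3 \<Rightarrow> 3 \<Rightarrow> mat3 \<Rightarrow> real"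
  where "minor a b g = g $ a $ 1 * g $ b $ 2 - g $ a $ 2 * g $ b $ 1"

text \<open>Relative to the squared leading entry, this norm is at least 1, as is
  \<open>minor_sq\<close> relative to the squared leading minor. Requiring both ratios to stay below
  2 keeps the support away from the zeros of the denominators.\<close>

definition col_sq :: "mat3 \<Rightarrow> real"
  where "col_sq g = (g $ 1 $ 1)\<^sup>2 + (g $ 2 $ 1)\<^sup>2 + (g $ 3 $ 1)\<^sup>2"

definition minor_sq :: "mat3 \<Rightarrow> real"
  where "minor_sq g = (minor 1 2 g)\<^sup>2 + (minor 1 3 g)\<^sup>2 + (minor 2 3 g)\<^sup>2"

definition big_cell :: "mat3 set"
  where "big_cell = {g \<in> GL. g $ 1 $ 1 \<noteq> 0 \<and> minor 1 2 g \<noteq> 0}"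

text \<open>
  On the big cell write \<open>g = n d u\<close> with \<open>n\<close> lower unipotent, \<open>d\<close> diagonal and \<open>u\<close> upper unipotent. The
  quotients in the \<^const>\<open>sign_powr\<close> factors are the entries of \<open>d\<close>, and the three bases of the powers
  are the entries \<open>(2,1)\<close>, \<open>(3,1)\<close>, \<open>(3,2)\<close> of \<open>n\<close>.
\<close>

definition test_fun :: "bit^3 \<Rightarrow> complex^3 \<Rightarrow> nat \<Rightarrow> nat \<Rightarrow> nat \<Rightarrow> mat3 \<Rightarrow> complex"
  where "test_fun \<xi> l i j k g = (if g \<in> big_cell then
    sign_powr (\<xi> $ 1) (- (l $ 1)) (g $ 1 $ 1) *
    sign_powr (\<xi> $ 2) (- (l $ 2)) (minor 1 2 g / g $ 1 $ 1) *
    sign_powr (\<xi> $ 3) (- (l $ 3)) (det g / minor 1 2 g) *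
    complex_of_real ((g $ 2 $ 1 / g $ 1 $ 1) ^ i * (g $ 3 $ 1 / g $ 1 $ 1) ^ j * (minor 1 3 g / minor 1 2 g) ^ k *
      flat_exp 1 (2 - col_sq g / (g $ 1 $ 1)\<^sup>2) * flat_exp 1 (2 - minor_sq g / (minor 1 2 g)\<^sup>2))
    else 0)"

text \<open>Right multiplication by \<open>diag_mat d\<close> scales the first column by d1, the
  minors by d1 d2 and the determinant by d1 d2 d3. The quotients in the three characters thus scale
  by d1, d2 and d3, and all other quotients are unchanged.\<close>

lemma test_fun_diag:
  assumes g: "g \<in> GL" and d: "\<forall>j. d $ j \<noteq> 0"
  shows "test_fun \<xi> l i j k (g ** diag_mat d) = (\<Prod>j\<in>UNIV. sign_powr (\<xi> $ j) (- (l $ j)) (d $ j)) * test_fun \<xi> l i j k g"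
proof -
  let ?h = "g ** diag_mat d"
  have e: "?h $ i $ j = g $ i $ j * d $ j" for i j
    by (simp add: matrix_matrix_mult_def diag_mat_def if_distrib[of "\<lambda>x. _ * x"] cong: if_cong)
  have d': "d $ 1 \<noteq> 0" "d $ 2 \<noteq> 0" "d $ 3 \<noteq> 0" using d by auto
  have m: "minor a b ?h = d $ 1 * d $ 2 * minor a b g" for a b
    by (simp add: minor_def e algebra_simps)
  have q: "col_sq ?h = (d $ 1)\<^sup>2 * col_sq g" "minor_sq ?h = (d $ 1 * d $ 2)\<^sup>2 * minor_sq g"
    by (simp_all add: col_sq_def minor_sq_def m e power_mult_distrib algebra_simps)
  have dt: "det ?h = d $ 1 * d $ 2 * d $ 3 * det g"
    by (simp add: det_mul det_diag_mat prod_UNIV_3[of "($) d"] mult_ac)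
  have cell: "?h \<in> big_cell \<longleftrightarrow> g \<in> big_cell"
    using g d d' by (auto simp: big_cell_def GL_mult diag_mat_GL m e)
  have p: "(\<Prod>j\<in>UNIV. sign_powr (\<xi> $ j) (- (l $ j)) (d $ j)) =
      sign_powr (\<xi> $ 1) (- (l $ 1)) (d $ 1) * sign_powr (\<xi> $ 2) (- (l $ 2)) (d $ 2) * sign_powr (\<xi> $ 3) (- (l $ 3)) (d $ 3)"
    by (simp add: prod_UNIV_3)
  show ?thesis
  proof (cases "g \<in> big_cell")
    case True
    then have ne: "g $ 1 $ 1 \<noteq> 0" "minor 1 2 g \<noteq> 0" by (auto simp: big_cell_def)
    have r: "minor 1 2 ?h / ?h $ 1 $ 1 = d $ 2 * (minor 1 2 g / g $ 1 $ 1)"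
      "det ?h / minor 1 2 ?h = d $ 3 * (det g / minor 1 2 g)"
      "?h $ 2 $ 1 / ?h $ 1 $ 1 = g $ 2 $ 1 / g $ 1 $ 1" "?h $ 3 $ 1 / ?h $ 1 $ 1 = g $ 3 $ 1 / g $ 1 $ 1"
      "minor 1 3 ?h / minor 1 2 ?h = minor 1 3 g / minor 1 2 g"
      "col_sq ?h / (?h $ 1 $ 1)\<^sup>2 = col_sq g / (g $ 1 $ 1)\<^sup>2"
      "minor_sq ?h / (minor 1 2 ?h)\<^sup>2 = minor_sq g / (minor 1 2 g)\<^sup>2"
      using ne d' by (simp_all add: m e q dt power_mult_distrib)
    have e11: "?h $ 1 $ 1 = d $ 1 * g $ 1 $ 1" by (simp add: e)
    show ?thesis unfolding test_fun_def p r if_P[OF True] if_P[OF True[folded cell]]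
      unfolding e11
      by (simp only: sign_powr_mult mult_ac)
  qed (simp add: test_fun_def cell)
qed

lemma test_fun_unipotent:
  assumes g: "g \<in> GL" and n: "n \<in> upper_unipotent3"
  shows "test_fun \<xi> l i j k (g ** n) = test_fun \<xi> l i j k g"
proof -
  let ?h = "g ** n"
  obtain x y z where nn: "n = vector [vector [1, x, y], vector [0, 1, z], vector [0, 0, 1]]"
    using n unfolding upper_unipotent3_def by blast
  have e: "?h $ i $ 1 = g $ i $ 1" "?h $ i $ 2 = g $ i $ 1 * x + g $ i $ 2" for i
    by (simp_all add: matrix_matrix_mult_def sum_3 nn)
  have m: "minor a b ?h = minor a b g" for a b
    by (simp add: minor_def e algebra_simps)
  have q: "col_sq ?h = col_sq g" "minor_sq ?h = minor_sq g"
    by (simp_all add: col_sq_def minor_sq_def m e)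
  have "det n = 1" by (simp add: nn det_3)
  then have dt: "det ?h = det g" by (simp add: det_mul)
  have cell: "?h \<in> big_cell \<longleftrightarrow> g \<in> big_cell"
    using dt by (auto simp: big_cell_def m e GL_def invertible_det_nz)
  show ?thesis unfolding test_fun_def by (simp add: m q dt cell e)
qed

text \<open>Expansion of the determinant along the third column.\<close>

lemma minor_sq_pos:
  assumes "g \<in> GL"
  shows "minor_sq g > 0"
proof (rule ccontr)
  assume "\<not> minor_sq g > 0"
  moreover have "(minor 1 2 g)\<^sup>2 \<ge> 0" "(minor 1 3 g)\<^sup>2 \<ge> 0" "(minor 2 3 g)\<^sup>2 \<ge> 0" by simp_all
  ultimately have "(minor 1 2 g)\<^sup>2 = 0" "(minor 1 3 g)\<^sup>2 = 0" "(minor 2 3 g)\<^sup>2 = 0"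
    unfolding minor_sq_def by linarith+
  then have z: "minor 1 2 g = 0" "minor 1 3 g = 0" "minor 2 3 g = 0" by simp_all
  have "det g = g $ 3 $ 3 * minor 1 2 g - g $ 2 $ 3 * minor 1 3 g + g $ 1 $ 3 * minor 2 3 g"
    by (simp add: det_3 minor_def algebra_simps)
  then show False using assms z by (simp add: GL_def invertible_det_nz)
qed

lemma col_sq_pos:
  assumes "g \<in> GL"
  shows "col_sq g > 0"
proof (rule ccontr)
  assume "\<not> col_sq g > 0"
  moreover have "(g $ 1 $ 1)\<^sup>2 \<ge> 0" "(g $ 2 $ 1)\<^sup>2 \<ge> 0" "(g $ 3 $ 1)\<^sup>2 \<ge> 0" by simp_all
  ultimately have "(g $ 1 $ 1)\<^sup>2 = 0" "(g $ 2 $ 1)\<^sup>2 = 0" "(g $ 3 $ 1)\<^sup>2 = 0"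
    unfolding col_sq_def by linarith+
  then have "minor_sq g = 0" by (simp add: minor_sq_def minor_def)
  then show False using minor_sq_pos[OF assms] by simp
qed

lemma continuous_on_minors:
  "continuous_on A (minor a b)" "continuous_on A col_sq" "continuous_on A minor_sq"
  unfolding minor_def col_sq_def minor_sq_def by (intro continuous_intros)+

text \<open>Near every point outside the big cell one of the arguments of \<^const>\<open>flat_exp\<close> is negative, so the
  function vanishes there.\<close>

lemma test_fun_smooth: "smooth_on GL (test_fun \<xi> l i j k)"
proof -
  \<comment> \<open>Open sets on which the test function vanishes. Outside the big cell one of the
    two denominators is 0 while the norms stay positive, so these sets and the big cell cover
    \<open>GL\<close>.\<close>
  let ?U1 = "{g. 2 * (g $ 1 $ 1)\<^sup>2 < col_sq g} :: mat3 set"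
  let ?U2 = "{g. 2 * (minor 1 2 g)\<^sup>2 < minor_sq g}"
  have "{g. g $ 1 $ 1 \<noteq> 0 \<and> minor 1 2 g \<noteq> 0} = - ({g. g $ 1 $ 1 = 0} \<union> {g. minor 1 2 g = 0})"
    by auto
  moreover have "closed {g :: mat3. g $ 1 $ 1 = 0}" "closed {g. minor 1 2 g = 0}"
    by (intro closed_Collect_eq continuous_intros continuous_on_minors)+
  ultimately have "open {g. g $ 1 $ 1 \<noteq> 0 \<and> minor 1 2 g \<noteq> 0}" by auto
  then have "open (GL \<inter> {g. g $ 1 $ 1 \<noteq> 0 \<and> minor 1 2 g \<noteq> 0})"
    by (intro open_Int open_GL)
  moreover have "GL \<inter> {g. g $ 1 $ 1 \<noteq> 0 \<and> minor 1 2 g \<noteq> 0} = big_cell"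
    by (auto simp: big_cell_def)
  ultimately have oc: "open big_cell" by simp
  have o12: "open ?U1" "open ?U2"
    by (intro open_Collect_less continuous_intros continuous_on_minors)+
  have z: "test_fun \<xi> l i j k g = 0" if "g \<in> ?U1 \<union> ?U2" for g
  proof (cases "g \<in> big_cell")
    case True
    then have "(g $ 1 $ 1)\<^sup>2 > 0" "(minor 1 2 g)\<^sup>2 > 0" by (auto simp: big_cell_def)
    then have "\<not> 2 - col_sq g / (g $ 1 $ 1)\<^sup>2 > 0 \<or> \<not> 2 - minor_sq g / (minor 1 2 g)\<^sup>2 > 0"
      using that by (auto simp: pos_divide_less_eq)
    then show ?thesis by (auto simp: test_fun_def flat_exp_def)
  qed (simp add: test_fun_def)
  have s12: "smooth_on (?U1 \<union> ?U2) (test_fun \<xi> l i j k)"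
    using smooth_on_cong_open[of "?U1 \<union> ?U2" "test_fun \<xi> l i j k" "\<lambda>g. 0"] z o12 smooth_on_const by blast
  have m: "smooth_on big_cell (\<lambda>g. complex_of_real (minor a b g))" for a b
    unfolding minor_def by (intro smooth_on_real_intros smooth_on_entry oc)
  have dt: "smooth_on big_cell (\<lambda>g. complex_of_real (det g))"
    unfolding det_3 by (intro smooth_on_real_intros smooth_on_entry oc)
  have q: "smooth_on big_cell (\<lambda>g. complex_of_real (col_sq g))" "smooth_on big_cell (\<lambda>g. complex_of_real (minor_sq g))"
    unfolding col_sq_def minor_sq_def by (intro smooth_on_real_intros smooth_on_real_power smooth_on_entry oc m)+
  have ne: "g $ 1 $ 1 \<noteq> 0" "minor 1 2 g \<noteq> 0" "det g \<noteq> 0" if "g \<in> big_cell" for g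
    using that by (auto simp: big_cell_def GL_def invertible_det_nz)
  have sp: "smooth_on big_cell (\<lambda>x. sign_powr e \<mu> (d x))"
    if "smooth_on big_cell (\<lambda>x. complex_of_real (d x))" "\<And>x. x \<in> big_cell \<Longrightarrow> d x \<noteq> 0" for d e \<mu>
    using smooth_on_sign_powr[OF oc that(1), of e \<mu>] that(2) by simp
  let ?E = "\<lambda>g. sign_powr (\<xi> $ 1) (- (l $ 1)) (g $ 1 $ 1) *
    sign_powr (\<xi> $ 2) (- (l $ 2)) (minor 1 2 g / g $ 1 $ 1) *
    sign_powr (\<xi> $ 3) (- (l $ 3)) (det g / minor 1 2 g) *
    complex_of_real ((g $ 2 $ 1 / g $ 1 $ 1) ^ i * (g $ 3 $ 1 / g $ 1 $ 1) ^ j * (minor 1 3 g / minor 1 2 g) ^ k *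
      flat_exp 1 (2 - col_sq g / (g $ 1 $ 1)\<^sup>2) * flat_exp 1 (2 - minor_sq g / (minor 1 2 g)\<^sup>2))"
  have "smooth_on big_cell ?E"
    by (intro smooth_on_mult smooth_on_real_intros smooth_on_real_power smooth_on_real_divide smooth_on_flat_exp
        sp m dt q smooth_on_entry oc smooth_on_const) (use ne in auto)
  then have "smooth_on big_cell (test_fun \<xi> l i j k)"
    by (subst smooth_on_cong_open[OF oc, of _ ?E]) (simp_all add: test_fun_def)
  then have "smooth_on (big_cell \<union> (?U1 \<union> ?U2)) (test_fun \<xi> l i j k)"
    using s12 by (rule smooth_on_Un)
  moreover have "GL \<subseteq> big_cell \<union> (?U1 \<union> ?U2)"
    using col_sq_pos minor_sq_pos by (auto simp: big_cell_def)
  ultimately show ?thesis by (rule smooth_on_subset)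
qed

lemma test_fun_I_rep: "test_fun \<xi> l i j k \<in> I_rep \<xi> l"
  unfolding I_rep_iff
proof (intro conjI ballI allI impI)
  show "test_fun \<xi> l i j k g = 0" if "g \<notin> GL" for g
    using that by (simp add: test_fun_def big_cell_def)
qed (simp_all add: test_fun_smooth test_fun_diag test_fun_unipotent)

section \<open>Derivatives of a monomial times a smooth function\<close>

definition mono_at :: "('n::finite \<Rightarrow> nat) \<Rightarrow> real^'n \<Rightarrow> complex"
  where "mono_at m p = (\<Prod>s\<in>UNIV. complex_of_real (p $ s) ^ m s)"

lemma smooth_on_mono_at: "open S \<Longrightarrow> smooth_on S (mono_at m)"
proof -
  assume S: "open S"
  have "smooth_on S (\<lambda>p. \<Prod>s\<in>A. complex_of_real (p $ s) ^ m s)" for A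
  proof (induction A rule: infinite_finite_induct)
    case (insert s A)
    then show ?case
      using smooth_on_mult[OF S smooth_on_power[OF S smooth_on_coord[OF S, of s], of "m s"] insert(3)] by simp
  qed (simp_all add: smooth_on_const)
  then show ?thesis unfolding mono_at_def .
qed

text \<open>A derivative lowers one exponent by one, and at 0 the new smooth cofactor is the old one
  times that exponent. For exponent 0 the truncated subtraction leaves the monomial alone, and
  nothing is claimed about the cofactor at 0.\<close>

lemma mono_at_dir_deriv:
  fixes m :: "'n::finite \<Rightarrow> nat"
  assumes Q: "smooth_on UNIV Q"
  shows "\<exists>Q'. smooth_on UNIV Q' \<and>
    dir_derivs [axis s 1] (\<lambda>p. mono_at m p * Q p) = (\<lambda>p. mono_at (m(s := m s - 1)) p * Q' p) \<and>
    (m s > 0 \<and> Q 0 \<noteq> 0 \<longrightarrow> Q' 0 \<noteq> 0)"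
proof -
  let ?e = "axis s 1 :: real^'n"
  let ?R = "\<lambda>p. \<Prod>t\<in>UNIV - {s}. complex_of_real (p $ t) ^ m t"
  have split: "mono_at (m(s := n)) p = complex_of_real (p $ s) ^ n * ?R p" for n p
    unfolding mono_at_def by (subst prod.remove[of _ s]) (auto intro!: prod.cong)
  have R: "?R (p + c *\<^sub>R ?e) = ?R p" for p c
    by (rule prod.cong) (auto simp: axis_def)
  have F: "smooth_on UNIV (\<lambda>p. mono_at m p * Q p)"
    by (intro smooth_on_mult smooth_on_mono_at Q) auto
  define Q' where "Q' = (\<lambda>p. if m s = 0 then dir_derivs [?e] Q p
      else of_nat (m s) * Q p + complex_of_real (p $ s) * dir_derivs [?e] Q p)"
  have "dir_derivs [?e] (\<lambda>p. mono_at m p * Q p) p = mono_at (m(s := m s - 1)) p * Q' p" for p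
  proof -
    have 1: "((\<lambda>c. mono_at m (p + c *\<^sub>R ?e) * Q (p + c *\<^sub>R ?e)) has_vector_derivative dir_derivs [?e] (\<lambda>p. mono_at m p * Q p) p) (at 0)"
      using dir_derivs_curve[OF open_UNIV F, of p "[]" "\<lambda>v. v" "[]" ?e] by simp
    have 2: "((\<lambda>c. Q (p + c *\<^sub>R ?e)) has_vector_derivative dir_derivs [?e] Q p) (at 0)"
      using dir_derivs_curve[OF open_UNIV Q, of p "[]" "\<lambda>v. v" "[]" ?e] by simp
    have "((\<lambda>z. (complex_of_real (p $ s) + z) ^ m s) has_field_derivative of_nat (m s) * (complex_of_real (p $ s) + of_real 0) ^ (m s - 1)) (at (of_real 0))"
      by (auto intro!: derivative_eq_intros)
    from has_vector_derivative_real_field[OF this]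
    have 3: "((\<lambda>c. (complex_of_real (p $ s) + of_real c) ^ m s) has_vector_derivative of_nat (m s) * complex_of_real (p $ s) ^ (m s - 1)) (at 0)"
      by simp
    have eq: "mono_at m (p + c *\<^sub>R ?e) * Q (p + c *\<^sub>R ?e) = ?R p * ((complex_of_real (p $ s) + of_real c) ^ m s * Q (p + c *\<^sub>R ?e))" for c
      using split[of "m s" "p + c *\<^sub>R ?e"] unfolding R by (simp add: axis_def)
    have "((\<lambda>c. mono_at m (p + c *\<^sub>R ?e) * Q (p + c *\<^sub>R ?e)) has_vector_derivative
      ?R p * (complex_of_real (p $ s) ^ m s * dir_derivs [?e] Q p + of_nat (m s) * complex_of_real (p $ s) ^ (m s - 1) * Q p)) (at 0)"
      unfolding eq using has_vector_derivative_mult_right[OF has_vector_derivative_mult[OF 3 2], of "?R p"] by simp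
    from vector_derivative_unique_at[OF 1 this] show ?thesis
      unfolding split Q'_def by (cases "m s") (simp_all add: algebra_simps)
  qed
  moreover have "smooth_on UNIV Q'"
    unfolding Q'_def
    by (cases "m s = 0") (auto simp del: dir_derivs.simps
      intro!: smooth_on_dir_derivs smooth_on_add smooth_on_mult smooth_on_const smooth_on_coord Q)
  moreover have "m s > 0 \<and> Q 0 \<noteq> 0 \<longrightarrow> Q' 0 \<noteq> 0" by (simp add: Q'_def)
  ultimately show ?thesis by blast
qed

text \<open>At the origin only an exhausted monomial survives: a positive remaining exponent gives
  0, while differentiating exactly \<open>m s\<close> times in each coordinate leaves a nonzero
  cofactor.\<close>

lemma mono_at_dir_derivs:
  fixes m :: "'n::finite \<Rightarrow> nat"
  assumes Q: "smooth_on UNIV Q"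
  shows "\<exists>Q'. smooth_on UNIV Q' \<and>
    dir_derivs (map (\<lambda>s. axis s 1) ss) (\<lambda>p. mono_at m p * Q p) = (\<lambda>p. mono_at (\<lambda>s. m s - count_list ss s) p * Q' p) \<and>
    ((\<forall>s. count_list ss s \<le> m s) \<and> Q 0 \<noteq> 0 \<longrightarrow> Q' 0 \<noteq> 0)"
proof (induction ss)
  case Nil
  then show ?case using Q by (intro exI[of _ Q]) simp
next
  case (Cons s ss)
  then obtain Q' where Q': "smooth_on UNIV Q'"
    and eq: "dir_derivs (map (\<lambda>s. axis s 1) ss) (\<lambda>p. mono_at m p * Q p) = (\<lambda>p. mono_at (\<lambda>s. m s - count_list ss s) p * Q' p)"
    and ne: "(\<forall>s. count_list ss s \<le> m s) \<and> Q 0 \<noteq> 0 \<longrightarrow> Q' 0 \<noteq> 0" by blast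
  let ?m = "\<lambda>s. m s - count_list ss s"
  obtain Q'' where Q'': "smooth_on UNIV Q''"
    and eq': "dir_derivs [axis s 1] (\<lambda>p. mono_at ?m p * Q' p) = (\<lambda>p. mono_at (?m(s := ?m s - 1)) p * Q'' p)"
    and ne': "?m s > 0 \<and> Q' 0 \<noteq> 0 \<longrightarrow> Q'' 0 \<noteq> 0"
    using mono_at_dir_deriv[OF Q', of s ?m] by blast
  have m: "?m(s := ?m s - 1) = (\<lambda>t. m t - count_list (s # ss) t)" by auto
  have "dir_derivs (map (\<lambda>s. axis s 1) (s # ss)) (\<lambda>p. mono_at m p * Q p)
      = (\<lambda>p. mono_at (\<lambda>t. m t - count_list (s # ss) t) p * Q'' p)"
    using eq' unfolding m by (simp add: eq)
  moreover have "Q'' 0 \<noteq> 0" if le: "\<forall>t. count_list (s # ss) t \<le> m t" and "Q 0 \<noteq> 0"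
  proof -
    have "count_list ss t \<le> m t" for t using spec[OF le, of t] by (simp split: if_splits)
    moreover have "?m s > 0" using spec[OF le, of s] by simp
    ultimately show ?thesis using ne ne' that by blast
  qed
  ultimately show ?case using Q'' by blast
qed

lemma count_list_replicate: "count_list (replicate n x) y = (if x = y then n else 0)"
  by (induction n) auto

text \<open>The affine chart \<open>A\<close> of the lower unipotent matrices sends the coordinate
  directions to E_21, E_31, E_32. In this chart the diagonal part is 1, and the test function is the
  monomial times the cutoff \<open>Q\<close>, with \<open>Q 0 \<noteq> 0\<close>.\<close>

lemma jet_test_fun:
  shows "jet i j k (test_fun \<xi> l i j k) \<noteq> 0"
    and "a < i \<or> b < j \<or> c < k \<Longrightarrow> jet a b c (test_fun \<xi> l i j k) = 0"
proof -
  define A :: "real^3 \<Rightarrow> mat3" where "A p = mat 1 + (p $ 1 *\<^sub>R elem 2 1 + p $ 2 *\<^sub>R elem 3 1 + p $ 3 *\<^sub>R elem 3 2)" for p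
  define L :: "real^3 \<Rightarrow> mat3" where "L p = p $ 1 *\<^sub>R elem 2 1 + p $ 2 *\<^sub>R elem 3 1 + p $ 3 *\<^sub>R elem 3 2" for p
  have A: "(A has_derivative L) (at p)" for p
  proof -
    have "bounded_linear L"
      unfolding L_def by (intro bounded_linear_add bounded_linear_scaleR_const bounded_linear_vec_nth)
    from has_derivative_add[OF has_derivative_const[of "mat 1"] bounded_linear_imp_has_derivative[OF this]]
    show ?thesis unfolding A_def L_def by simp
  qed
  have detA: "det (A p) = 1" for p by (simp add: A_def det_3 mat_def elem_nth)
  have GL: "A p \<in> GL" for p by (simp add: GL_def invertible_det_nz detA)
  define Q where "Q p = complex_of_real (flat_exp 1 (2 - (1 + (p $ 1)\<^sup>2 + (p $ 2)\<^sup>2)) *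
      flat_exp 1 (2 - (1 + (p $ 3)\<^sup>2 + (p $ 1 * p $ 3 - p $ 2)\<^sup>2)))"
    for p :: "real^3"
  have Q: "smooth_on UNIV Q"
    unfolding Q_def
    by (intro smooth_on_real_intros smooth_on_real_power smooth_on_flat_exp smooth_on_coord smooth_on_const open_UNIV)
  have Q0: "Q 0 \<noteq> 0" by (simp add: Q_def flat_exp_def)
  define m :: "3 \<Rightarrow> nat" where "m s = (if s = 1 then i else if s = 2 then j else k)" for s
  have m3: "m 1 = i" "m 2 = j" "m 3 = k" by (simp_all add: m_def)
  have F: "test_fun \<xi> l i j k (A p) = mono_at m p * Q p" for p
  proof -
    have e: "A p $ 1 $ 1 = 1" "A p $ 2 $ 1 = p $ 1" "A p $ 3 $ 1 = p $ 2" "minor 1 2 (A p) = 1" "minor 1 3 (A p) = p $ 3"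
      "minor 2 3 (A p) = p $ 1 * p $ 3 - p $ 2"
      by (simp_all add: A_def minor_def mat_def elem_nth)
    have "A p \<in> big_cell" using GL by (simp add: big_cell_def e)
    moreover have "col_sq (A p) = 1 + (p $ 1)\<^sup>2 + (p $ 2)\<^sup>2" "minor_sq (A p) = 1 + (p $ 3)\<^sup>2 + (p $ 1 * p $ 3 - p $ 2)\<^sup>2"
      by (simp_all add: col_sq_def minor_sq_def e)
    ultimately show ?thesis
      by (simp add: test_fun_def e detA mono_at_def prod_UNIV_3[of "\<lambda>s. complex_of_real (p $ s) ^ m s"] m3 Q_def)
  qed
  let ?ss = "\<lambda>a b c. replicate a (1::3) @ replicate b 2 @ replicate c 3"
  have L: "L (axis 1 1) = elem 2 1" "L (axis 2 1) = elem 3 1" "L (axis 3 1) = elem 3 2"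
    by (simp_all add: L_def axis_def)
  have jet: "jet a b c (test_fun \<xi> l i j k) = dir_derivs (map (\<lambda>s. axis s 1) (?ss a b c)) (\<lambda>p. mono_at m p * Q p) 0" for a b c
  proof -
    have "dir_derivs (map (\<lambda>s. axis s 1) (?ss a b c)) (\<lambda>p. test_fun \<xi> l i j k (A p)) 0
        = dir_derivs (map L (map (\<lambda>s. axis s 1) (?ss a b c))) (test_fun \<xi> l i j k) (A 0)"
      by (rule dir_derivs_affine[OF open_GL test_fun_smooth A GL])
    also have "map L (map (\<lambda>s. axis s 1) (?ss a b c)) = mlist a b c"
      by (simp add: mlist_def map_replicate L)
    finally show ?thesis unfolding F by (simp add: jet_def A_def)
  qed
  have cnt: "count_list (?ss a b c) 1 = a" "count_list (?ss a b c) 2 = b" "count_list (?ss a b c) 3 = c" for a b c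
    by (simp_all add: count_list_replicate)
  show "jet i j k (test_fun \<xi> l i j k) \<noteq> 0"
  proof -
    obtain Q' where "dir_derivs (map (\<lambda>s. axis s 1) (?ss i j k)) (\<lambda>p. mono_at m p * Q p) = (\<lambda>p. mono_at (\<lambda>s. m s - count_list (?ss i j k) s) p * Q' p)"
      and "(\<forall>s. count_list (?ss i j k) s \<le> m s) \<and> Q 0 \<noteq> 0 \<longrightarrow> Q' 0 \<noteq> 0"
      using mono_at_dir_derivs[OF Q, of "?ss i j k" m] by blast
    then show ?thesis
      using Q0 by (simp add: jet forall_3 m3 cnt mono_at_def prod_UNIV_3[of "\<lambda>s. 0 ^ (m s - count_list (?ss i j k) s)"] del: count_list_append)
  qed
  show "jet a b c (test_fun \<xi> l i j k) = 0" if "a < i \<or> b < j \<or> c < k"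
  proof -
    obtain Q' where "dir_derivs (map (\<lambda>s. axis s 1) (?ss a b c)) (\<lambda>p. mono_at m p * Q p) = (\<lambda>p. mono_at (\<lambda>s. m s - count_list (?ss a b c) s) p * Q' p)"
      using mono_at_dir_derivs[OF Q, of "?ss a b c" m] by blast
    then show ?thesis
      using that by (auto simp: jet m3 cnt mono_at_def prod_UNIV_3[of "\<lambda>s. 0 ^ (m s - count_list (?ss a b c) s)"] simp del: count_list_append)
  qed
qed

text \<open>Test against the function attached to an exponent of maximal degree with nonzero coefficient.\<close>

lemma jet_independent:
  assumes S: "finite S" and z: "\<And>f. f \<in> I_rep \<xi> l \<Longrightarrow> (\<Sum>(i, j, k)\<in>S. t (i, j, k) * jet i j k f) = 0"
    and p: "p \<in> S"
  shows "t p = 0"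
proof (rule ccontr)
  assume tp: "t p \<noteq> 0"
  let ?d = "\<lambda>(i, j, k). i + j + k :: nat"
  define S' where "S' = {p \<in> S. t p \<noteq> 0}"
  have fin: "finite S'" using S by (simp add: S'_def)
  have "p \<in> S'" using p tp unfolding S'_def by simp
  then have "Max (?d ` S') \<in> ?d ` S'" using fin by (intro Max_in) auto
  then obtain q where "q \<in> S'" "Max (?d ` S') = ?d q" by (rule imageE)
  then have q: "q \<in> S'" "\<forall>r\<in>S'. ?d r \<le> ?d q"
    using Max_ge[of "?d ` S'"] fin by (metis finite_imageI image_eqI)+
  obtain i j k where qe: "q = (i, j, k)" by (cases q)
  let ?f = "test_fun \<xi> l i j k"
  have "(\<Sum>(a, b, c)\<in>S. t (a, b, c) * jet a b c ?f) = (\<Sum>(a, b, c)\<in>{q}. t (a, b, c) * jet a b c ?f)"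
  proof (rule sum.mono_neutral_right[OF S])
    show "\<forall>r\<in>S - {q}. (case r of (a, b, c) \<Rightarrow> t (a, b, c) * jet a b c ?f) = 0"
    proof
      fix r assume r: "r \<in> S - {q}"
      obtain a b c where re: "r = (a, b, c)" by (cases r)
      \<comment> \<open>An exponent of at most the same total degree, other than (i, j, k), is
        smaller in some component, so its jet vanishes on the test function.\<close>
      have "a < i \<or> b < j \<or> c < k" if "t r \<noteq> 0"
      proof -
        have "r \<in> S'" using r that unfolding S'_def by blast
        then have "?d r \<le> ?d q" using q(2) by blast
        then show ?thesis using r by (auto simp: re qe)
      qed
      then show "(case r of (a, b, c) \<Rightarrow> t (a, b, c) * jet a b c ?f) = 0"
        using jet_test_fun(2)[of a i b j c k \<xi> l] by (auto simp: re)
    qed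
  qed (use q in \<open>auto simp: S'_def\<close>)
  then show False using z[OF test_fun_I_rep, of i j k] jet_test_fun(1)[of i j k \<xi> l] q by (simp add: qe S'_def)
qed

section \<open>Operators and equivariant functionals\<close>

lemma iota3_nth:
  "iota3 h $ 1 $ 1 = h $ 1 $ 1" "iota3 h $ 1 $ 2 = 0" "iota3 h $ 1 $ 3 = h $ 1 $ 2"
  "iota3 h $ 2 $ 1 = 0" "iota3 h $ 2 $ 2 = 1" "iota3 h $ 2 $ 3 = 0"
  "iota3 h $ 3 $ 1 = h $ 2 $ 1" "iota3 h $ 3 $ 2 = 0" "iota3 h $ 3 $ 3 = h $ 2 $ 2"
  by (simp_all add: iota3_def)

lemma iota3_mult: "iota3 (g ** h) = iota3 g ** iota3 h"
  by (simp add: vec_eq_iff forall_3 matrix_matrix_mult_def sum_3 sum_2 iota3_nth)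

lemma iota3_1: "iota3 (mat 1) = mat 1"
  by (simp add: vec_eq_iff forall_3 iota3_nth mat_def)

lemma det_iota3: "det (iota3 h) = det h"
  by (simp add: det_3 det_2 iota3_nth)

lemma iota3_GL: "iota3 h \<in> GL \<longleftrightarrow> h \<in> GL"
  by (simp add: GL_def invertible_det_nz det_iota3)

lemma matrix_inv_eqI:
  fixes A B :: "real^'n^'n"
  assumes "A ** B = mat 1" "B ** A = mat 1"
  shows "matrix_inv A = B"
proof -
  have "A \<in> GL" using assms by (auto simp: GL_def invertible_def)
  then have "matrix_inv A = matrix_inv A ** (A ** B)" using assms by simp
  also have "\<dots> = B" using matrix_inv_mult[OF \<open>A \<in> GL\<close>] by (simp add: matrix_mul_assoc)
  finally show ?thesis .
qed

lemma matrix_inv_iota3: "h \<in> GL \<Longrightarrow> matrix_inv (iota3 h) = iota3 (matrix_inv h)"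
  by (rule matrix_inv_eqI) (simp_all add: iota3_mult[symmetric] matrix_inv_mult iota3_1)

text \<open>Because of the middle entry 1, \<open>iota3\<close> is affine but not linear.\<close>

lemma iota3_has_derivative: "(iota3 has_derivative (\<lambda>v. iota3 v - iota3 0)) (at h)"
proof -
  have "linear (\<lambda>v. iota3 v - iota3 0)"
    by (simp add: linear_iff vec_eq_iff forall_3 iota3_nth)
  then have "bounded_linear (\<lambda>v. iota3 v - iota3 0)" by (simp add: linear_conv_bounded_linear)
  from has_derivative_add[OF has_derivative_const[of "iota3 0"] bounded_linear_imp_has_derivative[OF this]]
  show ?thesis by simp
qed

lemma iota3_diag: "iota3 (diag_mat d) = diag_mat (vector [d $ 1, 1, d $ 2])"
  by (simp add: vec_eq_iff forall_3 iota3_nth diag_mat_def)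

lemma iota3_unipotent: "iota3 (vector [vector [1, c], vector [0, 1]]) = mat 1 + c *\<^sub>R elem 1 3"
  by (simp add: vec_eq_iff forall_3 iota3_nth mat_def elem_nth)

lemma prod_UNIV_2: "(\<Prod>j\<in>(UNIV :: 2 set). F j) = F 1 * F 2"
  unfolding UNIV_2 by (simp add: ac_simps)

lemma sign_powr_add:
  assumes "t \<noteq> 0"
  shows "sign_powr e \<mu> t * sign_powr e' \<mu>' t = sign_powr (e + e') (\<mu> + \<mu>') t"
proof -
  have "sign_pow (sgn t) e * sign_pow (sgn t) e' = sign_pow (sgn t) (e + e')"
    using assms by (cases "e = 0"; cases "e' = 0") (auto simp: sign_pow_def sgn_if)
  then show ?thesis
    using assms by (simp add: sign_powr_def powr_add)
qed

lemma sign_powr_of_nat: "t \<noteq> 0 \<Longrightarrow> sign_powr (of_nat n) (of_nat n) t = complex_of_real t ^ n"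
proof (induction n)
  case (Suc n)
  have "sign_powr 1 1 t = complex_of_real t"
    using Suc.prems by (auto simp: sign_powr_def sign_pow_def sgn_if)
  then show ?case
    using Suc sign_powr_add[of t 1 1 "of_nat n" "of_nat n"] by simp
qed (simp add: sign_powr_def sign_pow_def)

lemma sign_powr_minus_of_nat: "t \<noteq> 0 \<Longrightarrow> sign_powr (of_nat n) (- of_nat n) t = inverse (complex_of_real t ^ n)"
proof -
  assume t: "t \<noteq> 0"
  have "sign_powr (of_nat n) (- of_nat n) t * sign_powr (of_nat n) (of_nat n) t = 1"
    unfolding sign_powr_add[OF t] by (simp add: sign_powr_def sign_pow_def t)
  then show ?thesis unfolding sign_powr_of_nat[OF t] using t by (simp add: field_simps)
qed

text \<open>The value at -1 detects the parity, and the derivative at 1 the exponent.\<close>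

lemma sign_powr_inject:
  assumes "\<And>t. t \<noteq> 0 \<Longrightarrow> sign_powr e \<mu> t = sign_powr e' \<mu>' t"
  shows "e = e' \<and> \<mu> = \<mu>'"
proof
  have "sign_powr b z (-1) = (if b = 1 then -1 else 1)" for b z
    by (simp add: sign_powr_def sign_pow_def)
  with assms[of "-1"] have "(if e = 1 then -1 else 1 :: complex) = (if e' = 1 then -1 else 1)" by simp
  moreover have "(-1 :: complex) \<noteq> 1" by simp
  ultimately have "e = 1 \<longleftrightarrow> e' = 1" by metis
  then show "e = e'" by (metis bit_not_one_iff)
  have "(sign_powr e \<mu> has_vector_derivative \<mu>) (at 1)" "(sign_powr e' \<mu>' has_vector_derivative \<mu>') (at 1)"
    using sign_powr_has_vector_derivative[of 1 e \<mu>] sign_powr_has_vector_derivative[of 1 e' \<mu>'] by simp_all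
  moreover have "(sign_powr e' \<mu>' has_vector_derivative \<mu>) (at 1)"
    using calculation(1)
    by (rule has_vector_derivative_transform_within_open[where S = "{0<..}"]) (use assms in auto)
  ultimately show "\<mu> = \<mu>'" by (metis vector_derivative_unique_at)
qed

lemma jet_add: "f \<in> I_rep \<xi> l \<Longrightarrow> g \<in> I_rep \<xi> l \<Longrightarrow> jet i j k (\<lambda>x. f x + g x) = jet i j k f + jet i j k g"
  unfolding jet_def by (intro dir_derivs_add[OF open_GL] I_rep_smooth mat_1_GL)

lemma jet_cmult: "f \<in> I_rep \<xi> l \<Longrightarrow> jet i j k (\<lambda>x. z * f x) = z * jet i j k f"
  unfolding jet_def by (intro dir_derivs_cmult[OF open_GL] I_rep_smooth mat_1_GL)

text \<open>For diagonal \<delta> write \<delta> x = (\<delta> x \<delta>^-1) \<delta>. Right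
  equivariance yields a character, and conjugation fixes 1 and scales E_ab by the quotient of the
  entries a and b of \<delta>. The middle entry is 1, hence only the outer components of
  \<open>\<xi>\<close> and \<open>l\<close> appear.\<close>

lemma jet_diag:
  assumes f: "f \<in> I_rep \<xi> l" and d: "\<forall>j. d $ j \<noteq> 0"
  shows "jet i j k (\<lambda>x. f (iota3 (diag_mat d) ** x)) =
    sign_powr (\<xi> $ 1 + of_nat (i + j)) (- (l $ 1) - of_nat (i + j)) (d $ 1) *
    sign_powr (\<xi> $ 3 + of_nat (j + k)) (- (l $ 3) + of_nat (j + k)) (d $ 2) * jet i j k f"
proof -
  let ?d = "vector [d $ 1, 1, d $ 2] :: real^3"
  let ?e = "vector [inverse (d $ 1), 1, inverse (d $ 2)] :: real^3"
  let ?\<chi> = "sign_powr (\<xi> $ 1) (- (l $ 1)) (d $ 1) * sign_powr (\<xi> $ 3) (- (l $ 3)) (d $ 2)"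
  let ?A = "\<lambda>x. diag_mat ?d ** x ** diag_mat ?e"
  have d': "d $ 1 \<noteq> 0" "d $ 2 \<noteq> 0" using d by auto
  have nz: "\<forall>j. ?d $ j \<noteq> 0" "\<forall>j. ?e $ j \<noteq> 0" using d' by (simp_all add: forall_3)
  have ed: "diag_mat ?e ** diag_mat ?d = mat 1" "diag_mat ?d ** diag_mat ?e = mat 1"
  proof -
    have "(\<chi> j. ?e $ j * ?d $ j) = (\<chi> j. 1)" "(\<chi> j. ?d $ j * ?e $ j) = (\<chi> j. 1)"
      using d' by (simp_all add: vec_eq_iff forall_3)
    then show "diag_mat ?e ** diag_mat ?d = mat 1" "diag_mat ?d ** diag_mat ?e = mat 1"
      by (simp_all only: diag_mat_mult diag_mat_1)
  qed
  have GL: "?A x \<in> GL" if "x \<in> GL" for x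
    using that nz by (intro GL_mult diag_mat_GL) auto
  have eq: "f (iota3 (diag_mat d) ** x) = ?\<chi> * f (?A x)" if "x \<in> GL" for x
  proof -
    have "f (?A x ** diag_mat ?d) = ?\<chi> * f (?A x)"
      using f GL[OF that] nz(1) unfolding I_rep_iff by (simp add: prod_UNIV_3)
    then show ?thesis by (simp add: matrix_mul_assoc[symmetric] ed iota3_diag)
  qed
  have A: "(?A has_derivative ?A) (at x)" for x
    by (rule has_derivative_compose[OF has_derivative_matrix_mult(1) has_derivative_matrix_mult(2)])
  have sm: "smooth_on GL (\<lambda>x. f (?A x))"
    by (rule smooth_on_affine[OF open_GL I_rep_smooth[OF f] A GL])
  define c where "c v = (if v = elem 2 1 then inverse (d $ 1) else if v = elem 3 1 then d $ 2 / d $ 1 else d $ 2)" for v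
  have Ac: "?A (elem 2 1) = c (elem 2 1) *\<^sub>R elem 2 1" "?A (elem 3 1) = c (elem 3 1) *\<^sub>R elem 3 1" "?A (elem 3 2) = c (elem 3 2) *\<^sub>R elem 3 2"
    by (simp_all add: vec_eq_iff forall_3 matrix_matrix_mult_def sum_3 diag_mat_def elem_nth c_def elem_eq_iff divide_inverse)
  have "jet i j k (\<lambda>x. f (iota3 (diag_mat d) ** x)) = dir_derivs (mlist i j k) (\<lambda>x. ?\<chi> * f (?A x)) (mat 1)"
    unfolding jet_def by (rule dir_derivs_cong_open[OF open_GL eq mat_1_GL])
  also have "\<dots> = ?\<chi> * dir_derivs (mlist i j k) (\<lambda>x. f (?A x)) (mat 1)"
    by (rule dir_derivs_cmult[OF open_GL sm mat_1_GL])
  also have "dir_derivs (mlist i j k) (\<lambda>x. f (?A x)) (mat 1) = dir_derivs (map ?A (mlist i j k)) f (?A (mat 1))"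
    by (rule dir_derivs_affine[OF open_GL I_rep_smooth[OF f] A GL[OF mat_1_GL]])
  also have "map ?A (mlist i j k) = [] @ map (\<lambda>v. c v *\<^sub>R v) (mlist i j k)"
    by (simp add: mlist_def map_replicate Ac)
  also have "?A (mat 1) = mat 1" by (simp add: ed)
  also have "dir_derivs ([] @ map (\<lambda>v. c v *\<^sub>R v) (mlist i j k)) f (mat 1) = complex_of_real (\<Prod>v\<leftarrow>mlist i j k. c v) * dir_derivs ([] @ mlist i j k) f (mat 1)"
    by (rule dir_derivs_scale[OF open_GL I_rep_smooth[OF f] mat_1_GL])
  also have "complex_of_real (\<Prod>v\<leftarrow>mlist i j k. c v) =
      sign_powr (of_nat (i + j)) (- of_nat (i + j)) (d $ 1) * sign_powr (of_nat (j + k)) (of_nat (j + k)) (d $ 2)"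
    unfolding sign_powr_of_nat[OF d'(2)] sign_powr_minus_of_nat[OF d'(1)]
    by (simp add: mlist_def prod_list_replicate c_def elem_eq_iff power_add power_inverse power_divide divide_inverse power_mult_distrib)
  finally show ?thesis
    unfolding jet_def diff_conv_add_uminus sign_powr_add[OF d'(1), symmetric] sign_powr_add[OF d'(2), symmetric]
    by (simp only: append_Nil mult_ac)
qed

definition jet_sum :: "(nat \<times> nat \<times> nat) set \<Rightarrow> (nat \<times> nat \<times> nat \<Rightarrow> complex) \<Rightarrow> (mat3 \<Rightarrow> complex) \<Rightarrow> complex"
  where "jet_sum S t f = (\<Sum>(i, j, k)\<in>S. t (i, j, k) * jet i j k f)"

lemma smooth_on_iota3_entry: "open S \<Longrightarrow> smooth_on S (\<lambda>h. complex_of_real (iota3 h $ i $ j))"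
proof -
  assume S: "open S"
  have "\<forall>i j. smooth_on S (\<lambda>h. complex_of_real (iota3 h $ i $ j))"
    unfolding forall_3 iota3_nth by (auto intro: smooth_on_const smooth_on_entry[OF S])
  then show ?thesis by blast
qed

lemma smooth_on_iota3_inner: "open S \<Longrightarrow> smooth_on S (\<lambda>h. complex_of_real ((iota3 h ** v) \<bullet> w))"
  unfolding inner_vec_def matrix_matrix_mult_def
  by (simp, intro smooth_on_sum smooth_on_mult smooth_on_const smooth_on_iota3_entry)

lemma smooth_on_iota3_inners:
  "open S \<Longrightarrow> smooth_on S (\<lambda>h. complex_of_real (\<Prod>(v, w)\<leftarrow>zip (map (\<lambda>v. iota3 h ** v) vs) ws. v \<bullet> w))"
proof (induction vs arbitrary: ws)
  case (Cons v vs)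
  show ?case
  proof (cases ws)
    case (Cons w ws')
    then show ?thesis
      using smooth_on_mult[OF Cons.prems smooth_on_iota3_inner[OF Cons.prems, of v w] Cons.IH[OF Cons.prems, of ws']] by simp
  qed (simp add: smooth_on_const)
qed (simp add: smooth_on_const)

text \<open>The translated directions \<open>iota3 h ** v\<close> have coordinates that are affine
  in \<open>h\<close>, so expanding the jets in the standard basis gives coefficients that are
  smooth on all of \<open>GL\<close>.\<close>

lemma jet_sum_expand:
  assumes S: "finite S"
  shows "\<exists>N c. (\<forall>ws. smooth_on GL (c ws)) \<and>
    (\<forall>f \<xi> l. f \<in> I_rep \<xi> l \<longrightarrow> (\<forall>h\<in>GL. jet_sum S t (\<lambda>x. f (iota3 h ** x)) =
       (\<Sum>ws | set ws \<subseteq> Basis \<and> length ws \<le> N. c ws h * dir_derivs ws f (iota3 h))))"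
proof -
  \<comment> \<open>A crude common bound: the sum of all orders dominates each of them.\<close>
  define N where "N = (\<Sum>(i, j, k)\<in>S. i + j + k)"
  define c :: "mat3 list \<Rightarrow> mat2 \<Rightarrow> complex" where "c ws h = (\<Sum>(i, j, k)\<in>S. if length ws = i + j + k then
    t (i, j, k) * complex_of_real (\<Prod>(v, w)\<leftarrow>zip (map (\<lambda>v. iota3 h ** v) (mlist i j k)) ws. v \<bullet> w) else 0)" for ws h
  have c: "smooth_on GL (c ws)" for ws
  proof -
    have "smooth_on GL (\<lambda>h. case p of (i, j, k) \<Rightarrow> if length ws = i + j + k then
      t (i, j, k) * complex_of_real (\<Prod>(v, w)\<leftarrow>zip (map (\<lambda>v. iota3 h ** v) (mlist i j k)) ws. v \<bullet> w) else 0)" for p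
    proof -
      obtain i j k where p: "p = (i, j, k)" by (cases p)
      show ?thesis
        using smooth_on_mult[OF open_GL smooth_on_const smooth_on_iota3_inners[OF open_GL, of "mlist i j k" ws]]
        by (cases "length ws = i + j + k") (simp_all add: p smooth_on_const)
    qed
    then show ?thesis unfolding c_def by (intro smooth_on_sum open_GL)
  qed
  have fin: "finite {ws :: mat3 list. set ws \<subseteq> Basis \<and> length ws \<le> N}"
    by (rule finite_lists_length_le) simp
  have "jet_sum S t (\<lambda>x. f (iota3 h ** x)) =
       (\<Sum>ws | set ws \<subseteq> Basis \<and> length ws \<le> N. c ws h * dir_derivs ws f (iota3 h))"
    if f: "f \<in> I_rep \<xi> l" and h: "h \<in> GL" for f \<xi> l h
  proof -
    let ?C = "\<lambda>i j k ws. complex_of_real (\<Prod>(v, w)\<leftarrow>zip (map (\<lambda>v. iota3 h ** v) (mlist i j k)) ws. v \<bullet> w)"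
    have len: "length (mlist i j k) = i + j + k" for i j k by (simp add: mlist_def)
    have h3: "iota3 h ** mat 1 \<in> GL" using h by (simp add: iota3_GL)
    have "jet i j k (\<lambda>x. f (iota3 h ** x)) = (\<Sum>ws | set ws \<subseteq> Basis \<and> length ws = i + j + k. ?C i j k ws * dir_derivs ws f (iota3 h))" for i j k
      unfolding jet_def dir_derivs_affine[OF open_GL I_rep_smooth[OF f] has_derivative_matrix_mult(1) h3]
      using dir_derivs_expand[OF open_GL I_rep_smooth[OF f] h3, of "[]" "map (\<lambda>v. iota3 h ** v) (mlist i j k)"]
      by (simp add: len)
    then have "jet_sum S t (\<lambda>x. f (iota3 h ** x)) = (\<Sum>(i, j, k)\<in>S. \<Sum>ws | set ws \<subseteq> Basis \<and> length ws = i + j + k. t (i, j, k) * ?C i j k ws * dir_derivs ws f (iota3 h))"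
      by (simp add: jet_sum_def sum_distrib_left mult.assoc)
    also have "\<dots> = (\<Sum>(i, j, k)\<in>S. \<Sum>ws | set ws \<subseteq> Basis \<and> length ws \<le> N. (if length ws = i + j + k then t (i, j, k) * ?C i j k ws else 0) * dir_derivs ws f (iota3 h))"
    proof (rule sum.cong[OF refl], clarify)
      fix i j k assume p: "(i, j, k) \<in> S"
      have "i + j + k \<le> N"
        unfolding N_def using member_le_sum[OF p _ S, of "\<lambda>(i, j, k). i + j + k"] by simp
      then show "(\<Sum>ws | set ws \<subseteq> Basis \<and> length ws = i + j + k. t (i, j, k) * ?C i j k ws * dir_derivs ws f (iota3 h))
        = (\<Sum>ws | set ws \<subseteq> Basis \<and> length ws \<le> N. (if length ws = i + j + k then t (i, j, k) * ?C i j k ws else 0) * dir_derivs ws f (iota3 h))"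
        by (intro sum.mono_neutral_cong_left fin) auto
    qed
    also have "\<dots> = (\<Sum>ws | set ws \<subseteq> Basis \<and> length ws \<le> N. c ws h * dir_derivs ws f (iota3 h))"
      unfolding case_prod_unfold c_def by (subst sum.swap) (simp add: sum_distrib_right)
    finally show ?thesis .
  qed
  with c show ?thesis by blast
qed

text \<open>The condition on \<open>T\<close> that makes its values on the translates of f by
  \<open>iota3 h\<close>, as a function of h, transform as in \<open>J_rep\<close>. It is stated for
  diagonal and unipotent matrices, which generate P'.\<close>

definition equivariant :: "bit^3 \<Rightarrow> complex^3 \<Rightarrow> bit^2 \<Rightarrow> complex^2 \<Rightarrow> ((mat3 \<Rightarrow> complex) \<Rightarrow> complex) \<Rightarrow> bool"
  where "equivariant \<xi> l \<eta> \<nu> T \<longleftrightarrow>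
    (\<forall>f\<in>I_rep \<xi> l. \<forall>d. (\<forall>j. d $ j \<noteq> 0) \<longrightarrow> T (\<lambda>x. f (iota3 (diag_mat d) ** x)) =
      (\<Prod>j\<in>UNIV. sign_powr (\<eta> $ j) (- (\<nu> $ j)) (d $ j)) * T f) \<and>
    (\<forall>f\<in>I_rep \<xi> l. \<forall>c. T (\<lambda>x. f ((mat 1 + c *\<^sub>R elem 1 3) ** x)) = T f)"

definition op_of :: "bit^3 \<Rightarrow> complex^3 \<Rightarrow> ((mat3 \<Rightarrow> complex) \<Rightarrow> complex) \<Rightarrow> (mat3 \<Rightarrow> complex) \<Rightarrow> mat2 \<Rightarrow> complex"
  where "op_of \<xi> l T f h = (if f \<in> I_rep \<xi> l \<and> h \<in> GL then T (\<lambda>x. f (iota3 h ** x)) else 0)"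

text \<open>The translates of f by \<open>iota3 h\<close> lie again in \<open>I_rep\<close>, so
  equivariance of the functional, applied to them, gives right equivariance of the image at every
  \<open>h\<close>. Compatibility with left translation is built into \<open>op_of\<close>.\<close>

lemma op_of_Diff_SBO:
  assumes S: "finite S" and eq: "equivariant \<xi> l \<eta> \<nu> (jet_sum S t)"
  shows "op_of \<xi> l (jet_sum S t) \<in> Diff_SBO \<xi> l \<eta> \<nu>"
proof -
  let ?T = "jet_sum S t"
  let ?D = "op_of \<xi> l ?T"
  obtain N c where c: "\<And>ws. smooth_on GL (c ws)"
    and exp: "\<And>f h. f \<in> I_rep \<xi> l \<Longrightarrow> h \<in> GL \<Longrightarrow> ?T (\<lambda>x. f (iota3 h ** x)) =
       (\<Sum>ws | set ws \<subseteq> Basis \<and> length ws \<le> N. c ws h * dir_derivs ws f (iota3 h))"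
    using jet_sum_expand[OF S, of t] by blast
  have Iadd: "(\<lambda>x. f x + g x) \<in> I_rep \<xi> l" if "f \<in> I_rep \<xi> l" "g \<in> I_rep \<xi> l" for f g
    using that unfolding I_rep_def by (rule principal_series_add)
  have Icm: "(\<lambda>x. z * f x) \<in> I_rep \<xi> l" if "f \<in> I_rep \<xi> l" for f z
    using that unfolding I_rep_def by (rule principal_series_cmult)
  have L: "(\<lambda>x. f (iota3 h ** x)) \<in> I_rep \<xi> l" if "f \<in> I_rep \<xi> l" "h \<in> GL" for f h
    using that by (simp add: I_rep_left iota3_GL)
  have mult: "?D f (g ** h) = ?T (\<lambda>x. f (iota3 g ** (iota3 h ** x)))" if "f \<in> I_rep \<xi> l" "g \<in> GL" "h \<in> GL" for f g h
    using that by (simp add: op_of_def GL_mult iota3_mult matrix_mul_assoc)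
  have "?D f \<in> J_rep \<eta> \<nu>" if f: "f \<in> I_rep \<xi> l" for f
    unfolding J_rep_iff
  proof (intro conjI ballI allI impI)
    have "smooth_on GL (\<lambda>h. \<Sum>ws | set ws \<subseteq> Basis \<and> length ws \<le> N. c ws h * dir_derivs ws f (iota3 h))"
      by (intro smooth_on_sum smooth_on_mult open_GL c
          smooth_on_affine[OF open_GL smooth_on_dir_derivs[OF I_rep_smooth[OF f]] iota3_has_derivative])
        (simp add: iota3_GL)
    then show "smooth_on GL (?D f)"
      by (subst smooth_on_cong_open[OF open_GL]) (auto simp: op_of_def f exp)
    show "?D f g = 0" if "g \<notin> GL" for g using that by (simp add: op_of_def)
    show "?D f (g ** diag_mat d) = (\<Prod>j\<in>UNIV. sign_powr (\<eta> $ j) (- (\<nu> $ j)) (d $ j)) * ?D f g"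
      if g: "g \<in> GL" and d: "\<forall>j. d $ j \<noteq> 0" for g d
    proof -
      have "diag_mat d \<in> GL" using d by (simp add: diag_mat_GL)
      from mult[OF f g this] show ?thesis
        using eq[unfolded equivariant_def, THEN conjunct1, rule_format, OF L[OF f g], of d] d g f
        by (simp add: op_of_def)
    qed
    show "?D f (g ** n) = ?D f g" if g: "g \<in> GL" and n: "n \<in> upper_unipotent2" for g n
    proof -
      obtain y where y: "n = vector [vector [1, y], vector [0, 1]]"
        using n unfolding upper_unipotent2_def by blast
      have "n \<in> GL" by (simp add: GL_def invertible_det_nz det_2 y)
      from mult[OF f g this] show ?thesis
        using eq[unfolded equivariant_def, THEN conjunct2, rule_format, OF L[OF f g], of y] g f
        by (simp add: op_of_def y iota3_unipotent)
    qed
  qed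
  moreover have "?D f = 0" if "f \<notin> I_rep \<xi> l" for f
    using that by (simp add: op_of_def fun_eq_iff)
  moreover have "?D (f + g) = ?D f + ?D g" if f: "f \<in> I_rep \<xi> l" and g: "g \<in> I_rep \<xi> l" for f g
  proof
    fix h
    show "?D (f + g) h = (?D f + ?D g) h"
      using f g Iadd[OF f g] jet_add[OF L[OF f] L[OF g]]
      by (simp add: op_of_def plus_fun_def jet_sum_def distrib_left sum.distrib case_prod_unfold)
  qed
  moreover have "?D (\<lambda>g. z * f g) = (\<lambda>h. z * ?D f h)" if f: "f \<in> I_rep \<xi> l" for f z
  proof
    fix h
    show "?D (\<lambda>g. z * f g) h = z * ?D f h"
      using f Icm[OF f] jet_cmult[OF L[OF f]]
      by (simp add: op_of_def jet_sum_def sum_distrib_left case_prod_unfold mult_ac)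
  qed
  moreover have "differential_op (I_rep \<xi> l) ?D"
    unfolding differential_op_def
  proof
    fix h0 :: mat2 assume "h0 \<in> GL"
    then show "\<exists>W N c. open W \<and> h0 \<in> W \<and> W \<subseteq> GL \<and> (\<forall>vs. smooth_on W (c vs)) \<and>
       (\<forall>f\<in>I_rep \<xi> l. \<forall>h\<in>W. ?D f h =
          (\<Sum>vs | set vs \<subseteq> Basis \<and> length vs \<le> N. c vs h * dir_derivs vs f (iota3 h)))"
      using exp c open_GL by (intro exI[of _ GL] exI[of _ N] exI[of _ c]) (auto simp: op_of_def)
  qed
  moreover have "?D (left_transl (iota3 h) f) = left_transl h (?D f)" if h: "h \<in> GL" and f: "f \<in> I_rep \<xi> l" for h f
  proof
    fix g
    have i: "matrix_inv h \<in> GL" using h by (rule matrix_inv_GL)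
    have m: "matrix_inv (iota3 h) = iota3 (matrix_inv h)" using h by (rule matrix_inv_iota3)
    have lt: "left_transl (iota3 h) f = (\<lambda>x. f (iota3 (matrix_inv h) ** x))"
      by (simp add: left_transl_def m)
    show "?D (left_transl (iota3 h) f) g = left_transl h (?D f) g"
    proof (cases "g \<in> GL")
      case True
      have "left_transl h (?D f) g = ?T (\<lambda>x. f (iota3 (matrix_inv h) ** (iota3 g ** x)))"
        unfolding left_transl_def by (rule mult[OF f i True])
      then show ?thesis unfolding lt using True L[OF f i] by (simp add: op_of_def)
    next
      case False
      then show ?thesis by (simp add: op_of_def left_transl_def GL_mult_iff_left[OF i])
    qed
  qed
  ultimately show ?thesis unfolding Diff_SBO_def by blast
qed

text \<open>Left equivariance moves every point to 1, so the local formula for a differential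
  operator is needed at the single point 1.\<close>

lemma Diff_SBO_op_of:
  assumes D: "D \<in> Diff_SBO \<xi> l \<eta> \<nu>"
  shows "\<exists>S t. finite S \<and> equivariant \<xi> l \<eta> \<nu> (jet_sum S t) \<and> D = op_of \<xi> l (jet_sum S t)"
proof -
  have J: "D f \<in> J_rep \<eta> \<nu>" if "f \<in> I_rep \<xi> l" for f using D that by (simp add: Diff_SBO_def)
  have L: "(\<lambda>x. f (iota3 h ** x)) \<in> I_rep \<xi> l" if "f \<in> I_rep \<xi> l" "h \<in> GL" for f h
    using that by (simp add: I_rep_left iota3_GL)
  have base: "D f h = D (\<lambda>x. f (iota3 h ** x)) (mat 1)" if f: "f \<in> I_rep \<xi> l" and h: "h \<in> GL" for f h
  proof -
    have i: "matrix_inv h \<in> GL" using h by (rule matrix_inv_GL)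
    \<comment> \<open>\<open>left_transl\<close> translates by the inverse, hence an inverse of an
      inverse.\<close>
    have mm: "matrix_inv (matrix_inv h) = h"
      by (rule matrix_inv_eqI) (simp_all add: matrix_inv_mult h)
    have "left_transl (iota3 (matrix_inv h)) f = (\<lambda>x. f (iota3 h ** x))"
      unfolding left_transl_def matrix_inv_iota3[OF i] mm ..
    moreover have "D (left_transl (iota3 (matrix_inv h)) f) = left_transl (matrix_inv h) (D f)"
      using D f i by (simp add: Diff_SBO_def)
    ultimately show ?thesis by (simp add: left_transl_def mm)
  qed
  obtain W N c where W: "mat 1 \<in> W" "\<forall>f\<in>I_rep \<xi> l. \<forall>h\<in>W. D f h =
          (\<Sum>vs | set vs \<subseteq> Basis \<and> length vs \<le> N. c vs h * dir_derivs vs f (iota3 h))"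
    using D mat_1_GL unfolding Diff_SBO_def differential_op_def by blast
  have "(\<lambda>f. \<Sum>vs | set vs \<subseteq> Basis \<and> length vs \<le> N. c vs (mat 1) * dir_derivs vs f (mat 1)) \<in> jet_span \<xi> l"
    by (intro jet_span_sum jet_span_cmult dir_derivs_jet_span) auto
  then obtain S t where S: "finite S" "\<forall>f\<in>I_rep \<xi> l. (\<Sum>vs | set vs \<subseteq> Basis \<and> length vs \<le> N. c vs (mat 1) * dir_derivs vs f (mat 1))
      = (\<Sum>(i, j, k)\<in>S. t (i, j, k) * jet i j k f)" unfolding jet_span_def by blast
  have T: "D f (mat 1) = jet_sum S t f" if "f \<in> I_rep \<xi> l" for f
    using S(2) W that by (simp add: jet_sum_def iota3_1)
  have "D = op_of \<xi> l (jet_sum S t)"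
  proof (intro ext)
    fix f h
    show "D f h = op_of \<xi> l (jet_sum S t) f h"
    proof (cases "f \<in> I_rep \<xi> l \<and> h \<in> GL")
      case True
      then show ?thesis using base[of f h] T[OF L, of f h] by (simp add: op_of_def)
    next
      case False
      then show ?thesis using J[of f] D by (auto simp: op_of_def J_rep_iff Diff_SBO_def)
    qed
  qed
  moreover have "equivariant \<xi> l \<eta> \<nu> (jet_sum S t)"
    unfolding equivariant_def
  proof (intro conjI ballI allI impI)
    fix f and d :: "real^2" assume f: "f \<in> I_rep \<xi> l" and d: "\<forall>j. d $ j \<noteq> 0"
    have dG: "diag_mat d \<in> GL" using d by (simp add: diag_mat_GL)
    have "D f (mat 1 ** diag_mat d) = (\<Prod>j\<in>UNIV. sign_powr (\<eta> $ j) (- (\<nu> $ j)) (d $ j)) * D f (mat 1)"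
      using J[OF f] d mat_1_GL unfolding J_rep_iff by blast
    then show "jet_sum S t (\<lambda>x. f (iota3 (diag_mat d) ** x)) = (\<Prod>j\<in>UNIV. sign_powr (\<eta> $ j) (- (\<nu> $ j)) (d $ j)) * jet_sum S t f"
      using base[OF f dG] T[OF L[OF f dG]] T[OF f] by simp
  next
    fix f c assume f: "f \<in> I_rep \<xi> l"
    let ?n = "vector [vector [1, c], vector [0, 1]] :: mat2"
    have n: "?n \<in> upper_unipotent2" unfolding upper_unipotent2_def by blast
    have nG: "?n \<in> GL" by (simp add: GL_def invertible_det_nz det_2)
    have "D f (mat 1 ** ?n) = D f (mat 1)"
      using J[OF f] n mat_1_GL unfolding J_rep_iff by blast
    then show "jet_sum S t (\<lambda>x. f ((mat 1 + c *\<^sub>R elem 1 3) ** x)) = jet_sum S t f"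
      using base[OF f nG] T[OF L[OF f nG]] T[OF f] by (simp add: iota3_unipotent)
  qed
  ultimately show ?thesis using S(1) by blast
qed

section \<open>Homogeneous functionals and the recurrence\<close>

text \<open>Entries of \<open>t\<close> beyond \<open>m\<close> are unconstrained, so solutions are
  compared for \<open>j \<le> m\<close> only.\<close>

definition two_term :: "nat \<Rightarrow> (nat \<Rightarrow> complex) \<Rightarrow> (nat \<Rightarrow> complex) \<Rightarrow> (nat \<Rightarrow> complex) set"
  where "two_term m a b = {t. \<forall>j<m. a j * t (Suc j) = b j * t j}"

lemma two_term_regular:
  assumes a: "\<And>j. j < m \<Longrightarrow> a j \<noteq> 0"
  obtains e where "e \<in> two_term m a b" "e 0 = 1" "\<forall>t\<in>two_term m a b. \<exists>z. \<forall>j\<le>m. t j = z * e j"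
proof -
  define e where "e = rec_nat (1::complex) (\<lambda>j x. b j / a j * x)"
  have e: "e 0 = 1" "\<And>j. e (Suc j) = b j / a j * e j" by (simp_all add: e_def)
  show thesis
  proof (rule that)
    show "e \<in> two_term m a b" using a by (simp add: two_term_def e)
    show "\<forall>t\<in>two_term m a b. \<exists>z. \<forall>j\<le>m. t j = z * e j"
    proof
      fix t assume t: "t \<in> two_term m a b"
      have "t j = t 0 * e j" if "j \<le> m" for j
        using that
      proof (induction j)
        case (Suc j)
        have "a j * t (Suc j) = b j * t j" using t Suc.prems by (simp add: two_term_def)
        then show ?case using Suc a[of j] by (simp add: e field_simps)
      qed (simp add: e)
      then show "\<exists>z. \<forall>j\<le>m. t j = z * e j" by blast
    qed
  qed (rule e)
qed

text \<open>Equation \<open>r\<close> no longer determines \<open>t (Suc r)\<close>, which becomes a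
  free parameter for the upper block. The solution \<open>e\<close> restarts there and is 0 below,
  which satisfies equation \<open>r\<close>.\<close>

lemma two_term_singular:
  assumes r: "r < m" "a r = 0" and a: "\<And>j. j < m \<Longrightarrow> j \<noteq> r \<Longrightarrow> a j \<noteq> 0"
  obtains e where "e \<in> two_term m a b" "e (Suc r) = 1" "\<forall>j\<le>r. e j = 0"
    "\<forall>t\<in>two_term m a b. \<forall>j. r < j \<and> j \<le> m \<longrightarrow> t j = t (Suc r) * e j"
proof -
  define e where "e = rec_nat (0::complex) (\<lambda>j x. if j = r then 1 else b j / a j * x)"
  have e: "e 0 = 0" "\<And>j. e (Suc j) = (if j = r then 1 else b j / a j * e j)" by (simp_all add: e_def)
  have z: "e j = 0" if "j \<le> r" for j
    using that by (induction j) (auto simp: e)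
  show thesis
  proof (rule that)
    show "e \<in> two_term m a b" using a r z[of r] by (auto simp: two_term_def e)
    show "e (Suc r) = 1" by (simp add: e)
    show "\<forall>t\<in>two_term m a b. \<forall>j. r < j \<and> j \<le> m \<longrightarrow> t j = t (Suc r) * e j"
    proof
      fix t assume t: "t \<in> two_term m a b"
      have "t j = t (Suc r) * e j" if "r < j" "j \<le> m" for j
        using that
      proof (induction j)
        case (Suc j)
        show ?case
        proof (cases "j = r")
          case False
          have "a j * t (Suc j) = b j * t j" using t Suc.prems by (simp add: two_term_def)
          then show ?thesis using Suc False a[of j] by (simp add: e field_simps)
        qed (simp add: e)
      qed simp
      then show "\<forall>j. r < j \<and> j \<le> m \<longrightarrow> t j = t (Suc r) * e j" by blast
    qed
  qed (use z in blast)
qed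

text \<open>Equation \<open>r\<close> forces \<open>t r = 0\<close>, and the nonvanishing of
  \<open>b\<close> carries this zero down to index 0. Only the solution that starts above
  \<open>r\<close> is left.\<close>

lemma two_term_singular_1:
  assumes r: "r < m" "a r = 0" and a: "\<And>j. j < m \<Longrightarrow> j \<noteq> r \<Longrightarrow> a j \<noteq> 0"
    and b: "\<And>j. j \<le> r \<Longrightarrow> b j \<noteq> 0"
  obtains e k where "k \<le> m" "e \<in> two_term m a b" "e k = 1" "\<forall>t\<in>two_term m a b. \<exists>z. \<forall>j\<le>m. t j = z * e j"
proof -
  obtain e where e: "e \<in> two_term m a b" "e (Suc r) = 1" "\<forall>j\<le>r. e j = 0"
    "\<forall>t\<in>two_term m a b. \<forall>j. r < j \<and> j \<le> m \<longrightarrow> t j = t (Suc r) * e j"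
    by (rule two_term_singular[of r m a b, OF r a])
  show thesis
  proof (rule that)
    show "Suc r \<le> m" using r by simp
    show "\<forall>t\<in>two_term m a b. \<exists>z. \<forall>j\<le>m. t j = z * e j"
    proof
      fix t assume t: "t \<in> two_term m a b"
      have z: "t j = 0" if "j \<le> r" for j
        using that
      proof (induction j rule: inc_induct)
        case base
        have "a r * t (Suc r) = b r * t r" using t r(1) unfolding two_term_def by blast
        then show ?case using r(2) b[of r] by simp
      next
        case (step j)
        have "j < m" using r(1) step(2) by simp
        then have "a j * t (Suc j) = b j * t j" using t unfolding two_term_def by blast
        then show ?case using step b[of j] by simp
    qed
    have "t j = t (Suc r) * e j" if "j \<le> m" for j
      using e(4) t z[of j] e(3) that by (cases "j \<le> r") auto
    then show "\<exists>z. \<forall>j\<le>m. t j = z * e j" by blast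
    qed
  qed (rule e)+
qed

text \<open>A zero of \<open>b\<close> at \<open>i \<le> r\<close> lets a solution that starts at
  index 0 die out after \<open>i\<close>, hence before \<open>Suc r\<close>; it is independent of
  the one that starts above \<open>r\<close>.\<close>

lemma two_term_singular_2:
  assumes r: "r < m" "a r = 0" and a: "\<And>j. j < m \<Longrightarrow> j \<noteq> r \<Longrightarrow> a j \<noteq> 0"
    and b: "i \<le> r" "b i = 0"
  obtains e e' where "e \<in> two_term m a b" "e' \<in> two_term m a b" "e 0 = 1" "e' 0 = 0" "e' (Suc r) = 1"
    "\<forall>t\<in>two_term m a b. \<exists>y z. \<forall>j\<le>m. t j = y * e j + z * e' j"
proof -
  obtain e' where e': "e' \<in> two_term m a b" "e' (Suc r) = 1" "\<forall>j\<le>r. e' j = 0"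
    "\<forall>t\<in>two_term m a b. \<forall>j. r < j \<and> j \<le> m \<longrightarrow> t j = t (Suc r) * e' j"
    by (rule two_term_singular[of r m a b, OF r a])
  define e where "e = rec_nat (1::complex) (\<lambda>j x. if j < r then b j / a j * x else 0)"
  have e: "e 0 = 1" "\<And>j. e (Suc j) = (if j < r then b j / a j * e j else 0)" by (simp_all add: e_def)
  have z: "e j = 0" if "i < j" for j
    using that
  proof (induction j)
    case (Suc j)
    then show ?case using b by (cases "j = i") (auto simp: e)
  qed simp
  \<comment> \<open>Either \<open>i = r\<close> and \<open>b r = 0\<close>, or \<open>i < r\<close>
    and \<open>e r = 0\<close>, so equation \<open>r\<close> holds with 0 on both sides.\<close>
  have br: "b r * e r = 0" using b z[of r] by (cases "i = r") auto
  show thesis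
  proof (rule that)
    have "a j * e (Suc j) = b j * e j" if "j < m" for j
    proof -
      consider "j < r" | "j = r" | "j > r" by linarith
      then show ?thesis
        using a[OF that] r br z[of j] b by cases (auto simp: e)
    qed
    then show "e \<in> two_term m a b" by (simp add: two_term_def)
    show "\<forall>t\<in>two_term m a b. \<exists>y z. \<forall>j\<le>m. t j = y * e j + z * e' j"
    proof
      fix t assume t: "t \<in> two_term m a b"
      have lo: "t j = t 0 * e j" if "j \<le> r" for j
        using that
      proof (induction j)
        case (Suc j)
        have "a j * t (Suc j) = b j * t j" using t r Suc.prems by (simp add: two_term_def)
        then show ?case using Suc r a[of j] by (simp add: e field_simps)
      qed (simp add: e)
      have "t j = t 0 * e j + t (Suc r) * e' j" if "j \<le> m" for j
        using e'(4) t e'(3) lo[of j] z[of j] b that by (cases "j \<le> r") auto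
      then show "\<exists>y z. \<forall>j\<le>m. t j = y * e j + z * e' j" by blast
    qed
  qed (use e e' in auto)
qed

section \<open>Weights of the jets under the diagonal subgroup\<close>

definition wt :: "bit^3 \<Rightarrow> complex^3 \<Rightarrow> bit^2 \<Rightarrow> complex^2 \<Rightarrow> nat \<times> nat \<times> nat \<Rightarrow> bool"
  where "wt \<xi> l \<eta> \<nu> = (\<lambda>(i, j, k). \<nu> $ 1 - l $ 1 = of_nat (i + j) \<and> l $ 3 - \<nu> $ 2 = of_nat (j + k) \<and>
    \<xi> $ 1 + of_nat (i + j) = \<eta> $ 1 \<and> \<xi> $ 3 + of_nat (j + k) = \<eta> $ 2)"

text \<open>Every jet is an eigenvector of the diagonal matrices, and jets are independent, so the
  condition separates into one equality of characters per exponent. Matrices with entries (s, 1) and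
  (1, s) split it into the two coordinates.\<close>

lemma jet_sum_diag_iff:
  assumes S: "finite S"
  shows "(\<forall>f\<in>I_rep \<xi> l. \<forall>d. (\<forall>j. d $ j \<noteq> 0) \<longrightarrow> jet_sum S t (\<lambda>x. f (iota3 (diag_mat d) ** x)) =
      (\<Prod>j\<in>UNIV. sign_powr (\<eta> $ j) (- (\<nu> $ j)) (d $ j)) * jet_sum S t f) \<longleftrightarrow>
    (\<forall>p\<in>S. t p \<noteq> 0 \<longrightarrow> wt \<xi> l \<eta> \<nu> p)" (is "?A \<longleftrightarrow> ?B")
proof
  let ?c = "\<lambda>(i, j, k) d. sign_powr (\<xi> $ 1 + of_nat (i + j)) (- (l $ 1) - of_nat (i + j)) (d $ 1) *
    sign_powr (\<xi> $ 3 + of_nat (j + k)) (- (l $ 3) + of_nat (j + k)) ((d :: real^2) $ 2)"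
  let ?e = "\<lambda>d. sign_powr (\<eta> $ 1) (- (\<nu> $ 1)) (d $ 1) * sign_powr (\<eta> $ 2) (- (\<nu> $ 2)) ((d :: real^2) $ 2)"
  have e: "(\<Prod>j\<in>UNIV. sign_powr (\<eta> $ j) (- (\<nu> $ j)) (d $ j)) = ?e d" for d
    by (simp add: prod_UNIV_2)
  have js: "jet_sum S t (\<lambda>x. f (iota3 (diag_mat d) ** x)) = jet_sum S (\<lambda>p. ?c p d * t p) f"
    if "f \<in> I_rep \<xi> l" "\<forall>j. d $ j \<noteq> 0" for f d
    unfolding jet_sum_def by (rule sum.cong[OF refl]) (auto simp only: jet_diag[OF that] prod.case mult_ac)
  show ?B if A: ?A
  proof (intro ballI impI)
    fix p assume p: "p \<in> S" "t p \<noteq> 0"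
    obtain i j k where pe: "p = (i, j, k)" by (cases p)
    have *: "?c p d = ?e d" if d: "\<forall>j. d $ j \<noteq> 0" for d
    proof -
      have "(\<Sum>(i, j, k)\<in>S. ((?c (i, j, k) d - ?e d) * t (i, j, k)) * jet i j k f) = 0" if f: "f \<in> I_rep \<xi> l" for f
      proof -
        have "jet_sum S (\<lambda>p. ?c p d * t p) f - ?e d * jet_sum S t f = 0"
          using A f d js[OF f d] e[of d] by simp
        moreover have "(\<Sum>(i, j, k)\<in>S. ((?c (i, j, k) d - ?e d) * t (i, j, k)) * jet i j k f)
          = jet_sum S (\<lambda>p. ?c p d * t p) f - ?e d * jet_sum S t f"
          unfolding jet_sum_def sum_distrib_left sum_subtractf[symmetric]
          by (rule sum.cong[OF refl]) (simp only: case_prod_unfold left_diff_distrib mult.assoc)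
        ultimately show ?thesis by simp
      qed
      from jet_independent[OF S this p(1)] have "(?c p d - ?e d) * t p = 0" unfolding pe by simp
      then show ?thesis using p(2) by simp
    qed
    have c1: "\<forall>j. (vector [s, 1] :: real^2) $ j \<noteq> 0" "\<forall>j. (vector [1, s] :: real^2) $ j \<noteq> 0" if "s \<noteq> 0" for s
      using that by (simp_all add: forall_2)
    have "sign_powr (\<xi> $ 1 + of_nat (i + j)) (- (l $ 1) - of_nat (i + j)) s = sign_powr (\<eta> $ 1) (- (\<nu> $ 1)) s" if "s \<noteq> 0" for s
      using *[OF c1(1)[OF that]] by (simp only: pe prod.case vector_2 sign_powr_1 mult_1_right)
    then have 1: "\<xi> $ 1 + of_nat (i + j) = \<eta> $ 1 \<and> - (l $ 1) - of_nat (i + j) = - (\<nu> $ 1)" by (rule sign_powr_inject)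
    have "sign_powr (\<xi> $ 3 + of_nat (j + k)) (- (l $ 3) + of_nat (j + k)) s = sign_powr (\<eta> $ 2) (- (\<nu> $ 2)) s" if "s \<noteq> 0" for s
      using *[OF c1(2)[OF that]] by (simp only: pe prod.case vector_2 sign_powr_1 mult_1_left)
    then have 2: "\<xi> $ 3 + of_nat (j + k) = \<eta> $ 2 \<and> - (l $ 3) + of_nat (j + k) = - (\<nu> $ 2)" by (rule sign_powr_inject)
    have "\<nu> $ 1 - l $ 1 = of_nat (i + j)" "l $ 3 - \<nu> $ 2 = of_nat (j + k)"
      using conjunct2[OF 1] conjunct2[OF 2] by (simp_all add: algebra_simps)
    with 1 2 show "wt \<xi> l \<eta> \<nu> p" unfolding pe wt_def by blast
  qed
  show ?A if B: ?B
  proof (intro ballI allI impI)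
    fix f d assume f: "f \<in> I_rep \<xi> l" and d: "\<forall>j. (d :: real^2) $ j \<noteq> 0"
    have "?c p d * t p = ?e d * t p" if "p \<in> S" for p
    proof (cases "t p = 0")
      case False
      obtain i j k where pe: "p = (i, j, k)" by (cases p)
      have w: "\<nu> $ 1 - l $ 1 = of_nat (i + j)" "l $ 3 - \<nu> $ 2 = of_nat (j + k)"
        "\<xi> $ 1 + of_nat (i + j) = \<eta> $ 1" "\<xi> $ 3 + of_nat (j + k) = \<eta> $ 2"
        using B that False unfolding pe wt_def by auto
      have "- (l $ 1) - of_nat (i + j) = - (\<nu> $ 1)" "- (l $ 3) + of_nat (j + k) = - (\<nu> $ 2)"
        unfolding w(1,2)[symmetric] by simp_all
      then show ?thesis unfolding pe prod.case w(3,4) by simp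
    qed simp
    then have "jet_sum S (\<lambda>p. ?c p d * t p) f = jet_sum S (\<lambda>p. ?e d * t p) f"
      unfolding jet_sum_def by (intro sum.cong refl) (auto simp only: prod.case)
    also have "\<dots> = ?e d * jet_sum S t f"
      by (simp add: jet_sum_def sum_distrib_left case_prod_unfold mult.assoc)
    finally show "jet_sum S t (\<lambda>x. f (iota3 (diag_mat d) ** x)) =
      (\<Prod>j\<in>UNIV. sign_powr (\<eta> $ j) (- (\<nu> $ j)) (d $ j)) * jet_sum S t f"
      unfolding js[OF f d] e .
  qed
qed

lemma jet_sum_mono_neutral:
  assumes "finite S" "S' \<subseteq> S" "\<And>p. p \<in> S - S' \<Longrightarrow> t p = 0"
  shows "jet_sum S t f = jet_sum S' t f"
  unfolding jet_sum_def by (rule sum.mono_neutral_right) (use assms in auto)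

lemma op_of_add: "op_of \<xi> l (\<lambda>f. T f + T' f) = op_of \<xi> l T + op_of \<xi> l T'"
  by (simp add: op_of_def fun_eq_iff)

lemma op_of_scale: "op_of \<xi> l (\<lambda>f. z * T f) = op_scale z (op_of \<xi> l T)"
  by (simp add: op_of_def fun_eq_iff op_scale_def)

lemma op_of_base: "f \<in> I_rep \<xi> l \<Longrightarrow> op_of \<xi> l T f (mat 1) = T f"
  by (simp add: op_of_def mat_1_GL iota3_1)

definition line_sum :: "nat \<Rightarrow> nat \<Rightarrow> (nat \<Rightarrow> complex) \<Rightarrow> (mat3 \<Rightarrow> complex) \<Rightarrow> complex"
  where "line_sum p q t f = (\<Sum>j\<le>min p q. t j * jet (p - j) j (q - j) f)"

text \<open>These are all the exponents of weight (p, q). The bound on \<open>j\<close> keeps both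
  subtractions exact.\<close>

abbreviation line :: "nat \<Rightarrow> nat \<Rightarrow> (nat \<times> nat \<times> nat) set"
  where "line p q \<equiv> (\<lambda>j. (p - j, j, q - j)) ` {..min p q}"

lemma line_sum_jet_sum: "line_sum p q t = jet_sum (line p q) (\<lambda>(i, j, k). t j)"
  unfolding line_sum_def jet_sum_def by (subst sum.reindex) (auto simp: inj_on_def)

lemma line_sum_independent:
  assumes "\<And>f. f \<in> I_rep \<xi> l \<Longrightarrow> line_sum p q t f = 0" "j \<le> min p q"
  shows "t j = 0"
  using jet_independent[of "line p q" \<xi> l "\<lambda>(i, j, k). t j" "(p - j, j, q - j)"] assms
  by (simp add: line_sum_jet_sum jet_sum_def)

text \<open>The jet of index j contributes to the indices j - 1 and j of weight (p - 1, q - 1).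
  Collecting by the target index pairs \<open>t (Suc j)\<close> with \<open>t j\<close>.\<close>

lemma line_sum_raising:
  assumes f: "f \<in> I_rep \<xi> l" and p: "\<nu> $ 1 - l $ 1 = of_nat p" and q: "l $ 3 - \<nu> $ 2 = of_nat q"
  defines "r \<equiv> \<lambda>t j. of_nat (Suc j) * (of_nat (Suc j) - (\<nu> $ 1 - \<nu> $ 2 - 1)) * t (Suc j) +
      of_nat (p - j) * of_nat (q - j) * (l $ 2 - \<nu> $ 2 - of_nat (Suc j)) * (t j :: complex)"
  shows "((\<lambda>c. line_sum p q t (\<lambda>x. f ((mat 1 + c *\<^sub>R elem 1 3) ** x))) has_vector_derivative
    (\<Sum>j<min p q. r t j * jet (p - Suc j) j (q - Suc j) f)) (at 0)"
proof -
  have nu1: "l $ 1 = \<nu> $ 1 - of_nat p" using p by (simp add: algebra_simps)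
  have nu2: "l $ 3 = \<nu> $ 2 + of_nat q" using q by (simp add: algebra_simps)
  let ?A = "\<lambda>j. t j * (of_nat j * (of_nat j - (\<nu> $ 1 - \<nu> $ 2 - 1))) * jet (p - j) (j - 1) (q - j) f"
  let ?B = "\<lambda>j. t j * (of_nat (p - j) * of_nat (q - j) * (l $ 2 - \<nu> $ 2 - of_nat (Suc j))) * jet (p - Suc j) j (q - Suc j) f"
  have "((\<lambda>c. line_sum p q t (\<lambda>x. f ((mat 1 + c *\<^sub>R elem 1 3) ** x))) has_vector_derivative
    (\<Sum>j\<le>min p q. t j * (of_nat j * (l $ 3 - l $ 1 - of_nat (p - j + j + (q - j)) + 1) * jet (p - j) (j - 1) (q - j) f +
      of_nat (p - j) * of_nat (q - j) * (l $ 2 - l $ 3 + of_nat (q - j) - 1) * jet (p - j - 1) j (q - j - 1) f))) (at 0)"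
    unfolding line_sum_def
    by (intro has_vector_derivative_sum has_vector_derivative_mult_right jet_raising_has_derivative[OF f])
  also have "(\<Sum>j\<le>min p q. t j * (of_nat j * (l $ 3 - l $ 1 - of_nat (p - j + j + (q - j)) + 1) * jet (p - j) (j - 1) (q - j) f +
      of_nat (p - j) * of_nat (q - j) * (l $ 2 - l $ 3 + of_nat (q - j) - 1) * jet (p - j - 1) j (q - j - 1) f))
      = (\<Sum>j\<le>min p q. ?A j + ?B j)"
  proof (rule sum.cong[OF refl])
    fix j assume "j \<in> {..min p q}"
    then have j: "j \<le> p" "j \<le> q" by auto
    show "t j * (of_nat j * (l $ 3 - l $ 1 - of_nat (p - j + j + (q - j)) + 1) * jet (p - j) (j - 1) (q - j) f +
      of_nat (p - j) * of_nat (q - j) * (l $ 2 - l $ 3 + of_nat (q - j) - 1) * jet (p - j - 1) j (q - j - 1) f)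
      = ?A j + ?B j"
    proof -
      \<comment> \<open>Here \<nu>1 - \<nu>2 - 1 comes in: l3 - l1 = p + q - (\<nu>1 - \<nu>2), and
        the jet of index j has order p + q - j.\<close>
      have "l $ 3 - l $ 1 - of_nat (p - j + j + (q - j)) + 1 = of_nat j - (\<nu> $ 1 - \<nu> $ 2 - 1)"
        using j by (simp add: nu1 nu2 of_nat_diff algebra_simps)
      moreover have "l $ 2 - l $ 3 + of_nat (q - j) - 1 = l $ 2 - \<nu> $ 2 - of_nat (Suc j)"
        using j by (simp add: nu2 of_nat_diff algebra_simps)
      ultimately show ?thesis by (simp only: distrib_left mult.assoc diff_diff_left One_nat_def add_Suc_right add_0_right)
    qed
  qed
  also have "\<dots> = (\<Sum>j\<le>min p q. ?A j) + (\<Sum>j\<le>min p q. ?B j)" by (rule sum.distrib)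
  \<comment> \<open>The term \<open>j = 0\<close> carries the factor 0, so the index can be shifted
    by one.\<close>
  also have "(\<Sum>j\<le>min p q. ?A j) = (\<Sum>j<min p q. ?A (Suc j))"
    unfolding lessThan_Suc_atMost[symmetric] sum.lessThan_Suc_shift by simp
  \<comment> \<open>At \<open>j = min p q\<close> one of \<open>p - j\<close> and
    \<open>q - j\<close> is 0.\<close>
  also have "(\<Sum>j\<le>min p q. ?B j) = (\<Sum>j<min p q. ?B j)"
    unfolding lessThan_Suc_atMost[symmetric] by (simp add: min_def)
  also have "(\<Sum>j<min p q. ?A (Suc j)) + (\<Sum>j<min p q. ?B j) = (\<Sum>j<min p q. r t j * jet (p - Suc j) j (q - Suc j) f)"
    unfolding sum.distrib[symmetric] r_def by (rule sum.cong) (simp_all add: algebra_simps)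
  finally show ?thesis .
qed

section \<open>The dimension\<close>

definition coef_a :: "complex^2 \<Rightarrow> nat \<Rightarrow> complex"
  where "coef_a \<nu> j = of_nat (Suc j) * (of_nat (Suc j) - (\<nu> $ 1 - \<nu> $ 2 - 1))"

definition coef_b :: "nat \<Rightarrow> nat \<Rightarrow> complex^3 \<Rightarrow> complex^2 \<Rightarrow> nat \<Rightarrow> complex"
  where "coef_b p q l \<nu> j = - (of_nat (p - j) * of_nat (q - j) * (l $ 2 - \<nu> $ 2 - of_nat (Suc j)))"

text \<open>Invariance makes the derivative at \<open>c = 0\<close> vanish, and independence of jets
  yields the recurrence. Conversely that derivative vanishes for every element of
  \<open>I_rep\<close>, in particular for the translates of f; by the group law it then vanishes at
  every \<open>c\<close>, so the function of \<open>c\<close> is constant.\<close>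

lemma line_sum_unipotent_iff:
  assumes p: "\<nu> $ 1 - l $ 1 = of_nat p" and q: "l $ 3 - \<nu> $ 2 = of_nat q"
  shows "(\<forall>f\<in>I_rep \<xi> l. \<forall>c. line_sum p q t (\<lambda>x. f ((mat 1 + c *\<^sub>R elem 1 3) ** x)) = line_sum p q t f) \<longleftrightarrow>
    t \<in> two_term (min p q) (coef_a \<nu>) (coef_b p q l \<nu>)"
proof -
  let ?u = "\<lambda>c. mat 1 + c *\<^sub>R elem 1 3"
  let ?r = "\<lambda>j. coef_a \<nu> j * t (Suc j) - coef_b p q l \<nu> j * t j"
  let ?S = "(\<lambda>j. (p - Suc j, j, q - Suc j)) ` {..<min p q}"
  have der: "((\<lambda>c. line_sum p q t (\<lambda>x. f (?u c ** x))) has_vector_derivative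
      (\<Sum>j<min p q. ?r j * jet (p - Suc j) j (q - Suc j) f)) (at 0)" if "f \<in> I_rep \<xi> l" for f
    using line_sum_raising[OF that p q, of t] by (simp add: coef_a_def coef_b_def)
  show ?thesis
  proof
    assume inv: "\<forall>f\<in>I_rep \<xi> l. \<forall>c. line_sum p q t (\<lambda>x. f (?u c ** x)) = line_sum p q t f"
    have "(\<Sum>(i, j, k)\<in>?S. ?r j * jet i j k f) = 0" if f: "f \<in> I_rep \<xi> l" for f
    proof -
      have "((\<lambda>c. line_sum p q t (\<lambda>x. f (?u c ** x))) has_vector_derivative 0) (at 0)"
        using inv f by simp
      with der[OF f] have "(\<Sum>j<min p q. ?r j * jet (p - Suc j) j (q - Suc j) f) = 0"
        by (rule vector_derivative_unique_at)
      then show ?thesis by (subst sum.reindex) (auto simp: inj_on_def)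
    qed
    then have "?r j = 0" if "j < min p q" for j
      using jet_independent[of ?S \<xi> l "\<lambda>(i, j, k). ?r j" "(p - Suc j, j, q - Suc j)"] that by simp
    then show "t \<in> two_term (min p q) (coef_a \<nu>) (coef_b p q l \<nu>)"
      by (simp add: two_term_def)
  next
    assume t: "t \<in> two_term (min p q) (coef_a \<nu>) (coef_b p q l \<nu>)"
    then have der0: "((\<lambda>c. line_sum p q t (\<lambda>x. f (?u c ** x))) has_vector_derivative 0) (at 0)" if "f \<in> I_rep \<xi> l" for f
      using der[OF that] by (simp add: two_term_def)
    show "\<forall>f\<in>I_rep \<xi> l. \<forall>c. line_sum p q t (\<lambda>x. f (?u c ** x)) = line_sum p q t f"
    proof (intro ballI allI)
      fix f c assume f: "f \<in> I_rep \<xi> l"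
      let ?\<phi> = "\<lambda>c. line_sum p q t (\<lambda>x. f (?u c ** x))"
      have u: "?u c \<in> GL" for c
        by (simp add: GL_def invertible_det_nz det_3 mat_def elem_nth)
      have "(?\<phi> has_vector_derivative 0) (at c)" for c
      proof -
        have uu: "?u (c + s) = ?u c ** ?u s" for s
          by (simp add: vec_eq_iff forall_3 matrix_matrix_mult_def sum_3 mat_def elem_nth)
        have "((\<lambda>s. line_sum p q t (\<lambda>x. f (?u c ** (?u s ** x)))) has_vector_derivative 0) (at 0)"
          using der0[OF I_rep_left[OF f u]] .
        then have "((\<lambda>s. ?\<phi> (c + s)) has_vector_derivative 0) (at 0)"
          unfolding uu by (simp add: matrix_mul_assoc)
        moreover have "((\<lambda>x. x - c) has_vector_derivative 1) (at c)"
          by (auto intro!: derivative_eq_intros simp: has_vector_derivative_def)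
        ultimately have "((\<lambda>s. ?\<phi> (c + s)) \<circ> (\<lambda>x. x - c) has_vector_derivative 1 *\<^sub>R 0) (at c)"
          by (intro vector_diff_chain_at) simp_all
        then show ?thesis by (simp add: o_def)
      qed
      then obtain k where "\<forall>c. ?\<phi> c = k"
      proof (rule has_vector_derivative_zero_constant[OF convex_UNIV, of ?\<phi>])
        fix k assume "\<And>c. c \<in> UNIV \<Longrightarrow> ?\<phi> c = k"
        then have "\<forall>c. ?\<phi> c = k" by blast
        then show thesis by (rule that)
      qed
      then have "?\<phi> c = ?\<phi> 0" by (simp only:)
      then show "?\<phi> c = line_sum p q t f" by simp
    qed
  qed
qed

text \<open>An equivariant functional is supported on exponents of weight (p, q), that is on
  \<open>line p q\<close>, and every sum over this line satisfies the diagonal condition. Only the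
  recurrence remains.\<close>

lemma Diff_SBO_eq_image:
  assumes p: "\<nu> $ 1 - l $ 1 = of_nat p" and q: "l $ 3 - \<nu> $ 2 = of_nat q"
    and e: "\<xi> $ 1 + of_nat p = \<eta> $ 1" "\<xi> $ 3 + of_nat q = \<eta> $ 2"
  shows "Diff_SBO \<xi> l \<eta> \<nu> = (\<lambda>t. op_of \<xi> l (line_sum p q t)) ` two_term (min p q) (coef_a \<nu>) (coef_b p q l \<nu>)"
proof -
  have fin: "finite (line p q)" by simp
  have wt_line: "wt \<xi> l \<eta> \<nu> x" if "x \<in> line p q" for x
    using that by (auto simp only: wt_def prod.case le_add_diff_inverse le_add_diff_inverse2 p q e min.bounded_iff atMost_iff image_iff)
  have line_wt: "x \<in> line p q" if w: "wt \<xi> l \<eta> \<nu> x" for x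
  proof -
    obtain i j k where x: "x = (i, j, k)" by (cases x)
    have "of_nat p = (of_nat (i + j) :: complex)" "of_nat q = (of_nat (j + k) :: complex)"
      using w unfolding x wt_def p q by auto
    then have "p = i + j" "q = j + k" by (simp_all only: of_nat_eq_iff)
    then show ?thesis unfolding x by (intro image_eqI[of _ _ j]) auto
  qed
  have inv: "equivariant \<xi> l \<eta> \<nu> (line_sum p q t) \<longleftrightarrow> t \<in> two_term (min p q) (coef_a \<nu>) (coef_b p q l \<nu>)" for t
    unfolding equivariant_def line_sum_unipotent_iff[OF p q]
    unfolding line_sum_jet_sum jet_sum_diag_iff[OF fin] using wt_line by blast
  show ?thesis
  proof (intro equalityI subsetI)
    fix D assume "D \<in> (\<lambda>t. op_of \<xi> l (line_sum p q t)) ` two_term (min p q) (coef_a \<nu>) (coef_b p q l \<nu>)"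
    then show "D \<in> Diff_SBO \<xi> l \<eta> \<nu>"
      using inv op_of_Diff_SBO[OF fin] unfolding line_sum_jet_sum by blast
  next
    fix D assume "D \<in> Diff_SBO \<xi> l \<eta> \<nu>"
    from Diff_SBO_op_of[OF this] obtain S t where S: "finite S"
      and eq: "equivariant \<xi> l \<eta> \<nu> (jet_sum S t)" and D: "D = op_of \<xi> l (jet_sum S t)"
      by (elim exE conjE)
    have w: "\<forall>x\<in>S. t x \<noteq> 0 \<longrightarrow> wt \<xi> l \<eta> \<nu> x"
      using eq unfolding equivariant_def jet_sum_diag_iff[OF S] by blast
    \<comment> \<open>Extension by 0 allows the index set to be enlarged by the line and then cut
      down to it.\<close>
    define t' where "t' x = (if x \<in> S then t x else 0)" for x
    have "jet_sum S t f = line_sum p q (\<lambda>j. t' (p - j, j, q - j)) f" for f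
    proof -
      have "jet_sum S t f = jet_sum S t' f"
        unfolding jet_sum_def by (rule sum.cong) (auto simp: t'_def)
      also have "\<dots> = jet_sum (S \<union> line p q) t' f"
        by (rule jet_sum_mono_neutral[symmetric]) (auto simp: t'_def S)
      also have "\<dots> = jet_sum (line p q) t' f"
        by (rule jet_sum_mono_neutral) (use S w line_wt in \<open>auto simp: t'_def\<close>)
      also have "\<dots> = line_sum p q (\<lambda>j. t' (p - j, j, q - j)) f"
        unfolding line_sum_jet_sum jet_sum_def by (rule sum.cong) auto
      finally show ?thesis .
    qed
    then have j: "jet_sum S t = line_sum p q (\<lambda>j. t' (p - j, j, q - j))" by (rule ext)
    show "D \<in> (\<lambda>t. op_of \<xi> l (line_sum p q t)) ` two_term (min p q) (coef_a \<nu>) (coef_b p q l \<nu>)"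
      using eq inv unfolding D j by blast
  qed
qed

lemma Diff_SBO_trivial:
  assumes "\<And>x. \<not> wt \<xi> l \<eta> \<nu> x"
  shows "Diff_SBO \<xi> l \<eta> \<nu> = {0}"
proof (intro equalityI subsetI)
  have z: "op_of \<xi> l (jet_sum {} t) = 0" for t
    by (simp add: op_of_def jet_sum_def fun_eq_iff)
  fix D assume "D \<in> Diff_SBO \<xi> l \<eta> \<nu>"
  from Diff_SBO_op_of[OF this] obtain S t where S: "finite S"
    and eq: "equivariant \<xi> l \<eta> \<nu> (jet_sum S t)" and D: "D = op_of \<xi> l (jet_sum S t)"
    by (elim exE conjE)
  have "\<forall>x\<in>S. t x \<noteq> 0 \<longrightarrow> wt \<xi> l \<eta> \<nu> x"
    using eq unfolding equivariant_def jet_sum_diag_iff[OF S] by blast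
  then have "jet_sum S t f = jet_sum {} t f" for f
    using assms by (intro jet_sum_mono_neutral S) auto
  then have "jet_sum S t = jet_sum {} t" by (rule ext)
  then show "D \<in> {0}" using z by (simp add: D)
next
  fix D :: "(mat3 \<Rightarrow> complex) \<Rightarrow> mat2 \<Rightarrow> complex" assume "D \<in> {0}"
  moreover have "op_of \<xi> l (jet_sum {} (\<lambda>_. 0)) \<in> Diff_SBO \<xi> l \<eta> \<nu>"
    by (rule op_of_Diff_SBO) (simp_all add: equivariant_def jet_sum_def)
  moreover have "op_of \<xi> l (jet_sum {} (\<lambda>_. 0)) = 0"
    by (simp add: op_of_def jet_sum_def fun_eq_iff)
  ultimately show "D \<in> Diff_SBO \<xi> l \<eta> \<nu>" by simp
qed

section \<open>The dimension of the image of the solution space\<close>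

lemma op_of_line_sum_cong:
  assumes "\<And>j. j \<le> min p q \<Longrightarrow> t j = y * s j + z * s' j"
  shows "op_of \<xi> l (line_sum p q t) = op_scale y (op_of \<xi> l (line_sum p q s)) + op_scale z (op_of \<xi> l (line_sum p q s'))"
proof -
  have "line_sum p q t = (\<lambda>f. y * line_sum p q s f + z * line_sum p q s' f)"
    unfolding line_sum_def sum_distrib_left sum.distrib[symmetric]
    by (intro ext sum.cong) (auto simp: assms algebra_simps)
  then show ?thesis by (simp add: op_of_add op_of_scale)
qed

text \<open>Evaluation at 1 recovers the functional, and independence of jets recovers its
  coefficients.\<close>

lemma op_of_line_sum_eqD:
  assumes "op_of \<xi> l (line_sum p q t) = op_scale z (op_of \<xi> l (line_sum p q s))" "j \<le> min p q"
  shows "t j = z * s j"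
proof -
  have "line_sum p q (\<lambda>j. t j - z * s j) f = 0" if "f \<in> I_rep \<xi> l" for f
  proof -
    have "line_sum p q t f = z * line_sum p q s f"
      using fun_cong[OF fun_cong[OF assms(1), of f], of "mat 1"] op_of_base[OF that]
      by (simp add: op_scale_def)
    then show ?thesis
      by (simp add: line_sum_def left_diff_distrib sum_subtractf sum_distrib_left mult.assoc)
  qed
  from line_sum_independent[OF this assms(2)] show ?thesis by simp
qed

text \<open>Indexing by \<open>Suc r\<close> matches the recurrence, whose coefficients of index
  \<open>r\<close> vanish when the parameter equals r + 1.\<close>

lemma int_interval_of_nat_iff:
  "z \<in> int_interval 1 (real m) \<longleftrightarrow> (\<exists>r<m. z = of_nat (Suc r))"
proof
  assume "z \<in> int_interval 1 (real m)"
  then obtain k :: int where k: "z = of_int k" "1 \<le> Re z" "Re z \<le> real m"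
    unfolding int_interval_def by (auto elim: Ints_cases)
  have "1 \<le> k" using k(1,2) by simp
  have "real_of_int k \<le> real_of_int (int m)" using k(1,3) by simp
  then have "k \<le> int m" by (simp only: of_int_le_iff)
  have "int (Suc (nat (k - 1))) = k" using \<open>1 \<le> k\<close> by simp
  then have "z = of_nat (Suc (nat (k - 1)))" unfolding k(1) by (metis of_int_of_nat_eq)
  moreover have "nat (k - 1) < m" using \<open>1 \<le> k\<close> \<open>k \<le> int m\<close> by linarith
  ultimately show "\<exists>r<m. z = of_nat (Suc r)" by blast
qed (auto simp: int_interval_def)

lemma op_dim_1:
  assumes e: "e \<in> A" "k \<le> min p q" "e k \<noteq> 0"
    and A: "\<forall>t\<in>A. \<exists>z. \<forall>j\<le>min p q. t j = z * e j"
  shows "op_space.dim ((\<lambda>t. op_of \<xi> l (line_sum p q t)) ` A) = 1"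
proof (rule op_space.dim_unique[where B = "{op_of \<xi> l (line_sum p q e)}"])
  show "op_space.independent {op_of \<xi> l (line_sum p q e)}"
  proof -
    have "op_of \<xi> l (line_sum p q e) \<noteq> 0"
      using op_of_line_sum_eqD[of \<xi> l p q e 0 e k] e by auto
    then show ?thesis by simp
  qed
  show "(\<lambda>t. op_of \<xi> l (line_sum p q t)) ` A \<subseteq> op_space.span {op_of \<xi> l (line_sum p q e)}"
  proof
    fix D assume "D \<in> (\<lambda>t. op_of \<xi> l (line_sum p q t)) ` A"
    then obtain t where t: "t \<in> A" "D = op_of \<xi> l (line_sum p q t)" by blast
    obtain z where z: "\<forall>j\<le>min p q. t j = z * e j" using A t(1) by blast
    \<comment> \<open>The statement for two solutions is applied with second coefficient 0.\<close>
    have "D = op_scale z (op_of \<xi> l (line_sum p q e)) + op_scale 0 (op_of \<xi> l (line_sum p q e))"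
      unfolding t(2) by (rule op_of_line_sum_cong) (use z in auto)
    then show "D \<in> op_space.span {op_of \<xi> l (line_sum p q e)}"
      by (simp add: op_space.span_base op_space.span_scale op_space.span_add)
  qed
qed (use e in auto)

lemma op_dim_2:
  assumes e: "e \<in> A" "e' \<in> A" "e 0 \<noteq> 0" "e' 0 = 0" "k \<le> min p q" "e' k \<noteq> 0"
    and A: "\<forall>t\<in>A. \<exists>y z. \<forall>j\<le>min p q. t j = y * e j + z * e' j"
  shows "op_space.dim ((\<lambda>t. op_of \<xi> l (line_sum p q t)) ` A) = 2"
proof -
  let ?D = "op_of \<xi> l (line_sum p q e)" and ?D' = "op_of \<xi> l (line_sum p q e')"
  have 0: "?D' \<noteq> 0"
    using op_of_line_sum_eqD[of \<xi> l p q e' 0 e' k] e by auto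
  \<comment> \<open>Index 0 tells the two apart: \<open>e'\<close> vanishes there and
    \<open>e\<close> does not.\<close>
  have ne: "?D \<noteq> op_scale z ?D'" for z
    using op_of_line_sum_eqD[of \<xi> l p q e z e' 0] e by auto
  show ?thesis
  proof (rule op_space.dim_unique[where B = "{?D, ?D'}"])
    have "?D \<notin> op_space.span {?D'}"
      using ne by (auto simp: op_space.span_singleton)
    then show "op_space.independent {?D, ?D'}"
    proof (rule op_space.independent_insertI)
      show "op_space.independent {?D'}" using 0 by simp
    qed
    show "card {?D, ?D'} = 2"
      using ne[of 1] by (auto simp: card_insert_if)
    show "(\<lambda>t. op_of \<xi> l (line_sum p q t)) ` A \<subseteq> op_space.span {?D, ?D'}"
    proof
      fix D assume "D \<in> (\<lambda>t. op_of \<xi> l (line_sum p q t)) ` A"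
      then obtain t where t: "t \<in> A" "D = op_of \<xi> l (line_sum p q t)" by blast
      obtain y z where "\<forall>j\<le>min p q. t j = y * e j + z * e' j" using A t(1) by blast
      then have "D = op_scale y ?D + op_scale z ?D'"
        unfolding t(2) by (intro op_of_line_sum_cong) auto
      then show "D \<in> op_space.span {?D, ?D'}"
        by (simp add: op_space.span_base op_space.span_scale op_space.span_add)
    qed
  qed (use e in auto)
qed

text \<open>Addition is its own inverse modulo 2. This converts the parity condition of
  \<open>wt\<close> into that of \<open>cong2\<close>.\<close>

lemma bit_add_eq_iff: "(a :: bit) + b = c \<longleftrightarrow> a + c = b"
proof -
  have "a + a = 0" by (cases "a = 0") simp_all
  then show ?thesis by (metis add.assoc add_0_left)
qed

lemma cong2_of_nat: "cong2 e (of_nat n) \<longleftrightarrow> e = of_nat n"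
proof -
  have "of_nat n = (of_int k :: complex) \<longleftrightarrow> k = int n" for k
    by (metis of_int_eq_iff of_int_of_nat_eq)
  then show ?thesis by (simp only: cong2_def simp_thms of_int_of_nat_eq)
qed

theorem theoremB:
  fixes \<xi> :: "bit^3" and \<eta> :: "bit^2" and l :: "complex^3" and \<nu> :: "complex^2"
  shows "(Diff_SBO \<xi> l \<eta> \<nu> \<noteq> {0} \<longleftrightarrow> op_space.dim (Diff_SBO \<xi> l \<eta> \<nu>) \<in> {1, 2}) \<and>
    (op_space.dim (Diff_SBO \<xi> l \<eta> \<nu>) \<in> {1, 2} \<longleftrightarrow> (\<xi>, \<eta>, l, \<nu>) \<in> Supp3) \<and>
    (op_space.dim (Diff_SBO \<xi> l \<eta> \<nu>) = 2 \<longleftrightarrow> (\<xi>, \<eta>, l, \<nu>) \<in> Supp3c)"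
proof -
  let ?dim = "op_space.dim (Diff_SBO \<xi> l \<eta> \<nu>)"
  have dim0: "?dim = 0" if "Diff_SBO \<xi> l \<eta> \<nu> = {0}"
    unfolding that by (rule op_space.dim_unique[where B = "{}"]) (simp_all add: op_space.independent_empty)
  \<comment> \<open>The interval conditions of the cases a, b and c are exhaustive, so the union is
    governed by \<open>Phi3\<close> and the parities alone.\<close>
  have Supp3: "(\<xi>, \<eta>, l, \<nu>) \<in> Supp3 \<longleftrightarrow> (l, \<nu>) \<in> Phi3 \<and>
      cong2 (\<xi> $ 1 + \<eta> $ 1) (\<nu> $ 1 - l $ 1) \<and> cong2 (\<xi> $ 3 + \<eta> $ 2) (l $ 3 - \<nu> $ 2)"
    by (auto simp: Supp3_def Supp3a_def Supp3b_def Supp3c_def Supp_over_def Phi3a_def Phi3b_def Phi3c_def)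
  have sub: "(\<xi>, \<eta>, l, \<nu>) \<in> Supp3c \<Longrightarrow> (\<xi>, \<eta>, l, \<nu>) \<in> Supp3" by (simp add: Supp3_def)
  show ?thesis
  proof (cases "(\<xi>, \<eta>, l, \<nu>) \<in> Supp3")
    case False
    have "\<not> wt \<xi> l \<eta> \<nu> x" for x
    proof
      assume w: "wt \<xi> l \<eta> \<nu> x"
      obtain i j k where x: "x = (i, j, k)" by (cases x)
      have w': "\<nu> $ 1 - l $ 1 = of_nat (i + j)" "l $ 3 - \<nu> $ 2 = of_nat (j + k)"
        "\<xi> $ 1 + of_nat (i + j) = \<eta> $ 1" "\<xi> $ 3 + of_nat (j + k) = \<eta> $ 2"
        using w unfolding x wt_def by auto
      have "(l, \<nu>) \<in> Phi3" unfolding Phi3_def mem_Collect_eq prod.case w'(1,2) by (simp only: of_nat_in_Nats)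
      moreover have "cong2 (\<xi> $ 1 + \<eta> $ 1) (\<nu> $ 1 - l $ 1)" "cong2 (\<xi> $ 3 + \<eta> $ 2) (l $ 3 - \<nu> $ 2)"
        unfolding w'(1,2) cong2_of_nat using w'(3,4)[THEN iffD1[OF bit_add_eq_iff]] by simp_all
      ultimately show False using False Supp3 by blast
    qed
    then have "Diff_SBO \<xi> l \<eta> \<nu> = {0}" by (rule Diff_SBO_trivial)
    then show ?thesis using dim0 False sub by auto
  next
    case True
    then obtain p q where p: "\<nu> $ 1 - l $ 1 = of_nat p" and q: "l $ 3 - \<nu> $ 2 = of_nat q"
      and c: "cong2 (\<xi> $ 1 + \<eta> $ 1) (of_nat p)" "cong2 (\<xi> $ 3 + \<eta> $ 2) (of_nat q)"
      unfolding Supp3 Phi3_def by (auto elim!: Nats_cases)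
    let ?n = "\<nu> $ 1 - \<nu> $ 2 - 1" and ?\<kappa> = "l $ 2 - \<nu> $ 2" and ?m = "min p q"
    let ?A = "two_term ?m (coef_a \<nu>) (coef_b p q l \<nu>)"
    have img: "Diff_SBO \<xi> l \<eta> \<nu> = (\<lambda>t. op_of \<xi> l (line_sum p q t)) ` ?A"
      using c[unfolded cong2_of_nat, THEN iffD1[OF bit_add_eq_iff]] by (rule Diff_SBO_eq_image[OF p q])
    have min: "min (Re (\<nu> $ 1 - l $ 1)) (Re (l $ 3 - \<nu> $ 2)) = real ?m"
      unfolding p q by simp
    have Supp3c: "(\<xi>, \<eta>, l, \<nu>) \<in> Supp3c \<longleftrightarrow> ?n \<in> int_interval 1 (real ?m) \<and> ?\<kappa> \<in> int_interval 1 (Re ?n)"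
      using True unfolding Supp3 unfolding Supp3c_def Supp_over_def Phi3c_def mem_Collect_eq prod.case min by blast
    have a: "coef_a \<nu> j = 0 \<longleftrightarrow> ?n = of_nat (Suc j)" for j
      unfolding coef_a_def mult_eq_0_iff of_nat_eq_0_iff by (simp only: Suc_not_Zero simp_thms right_minus_eq eq_commute[of ?n])
    \<comment> \<open>For \<open>j < ?m\<close> the factors \<open>p - j\<close> and
      \<open>q - j\<close> are nonzero, so only the factor that contains \<open>?\<kappa>\<close>
      can vanish.\<close>
    have b: "coef_b p q l \<nu> j = 0 \<longleftrightarrow> ?\<kappa> = of_nat (Suc j)" if "j < ?m" for j
      using that unfolding coef_b_def neg_equal_0_iff_equal mult_eq_0_iff of_nat_eq_0_iff by auto
    \<comment> \<open>The leading coefficient vanishes below \<open>?m\<close> exactly when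
      \<open>?n\<close> lies in the interval, and then at the single index
      \<open>?n - 1\<close>.\<close>
    have "?dim = (if (\<xi>, \<eta>, l, \<nu>) \<in> Supp3c then 2 else 1)"
    proof (cases "?n \<in> int_interval 1 (real ?m)")
      case False
      then have a0: "coef_a \<nu> j \<noteq> 0" if "j < ?m" for j
        using that unfolding int_interval_of_nat_iff a by blast
      obtain e where "e \<in> ?A" "e 0 = 1" "\<forall>t\<in>?A. \<exists>z. \<forall>j\<le>?m. t j = z * e j"
        by (rule two_term_regular[of ?m "coef_a \<nu>" "coef_b p q l \<nu>", OF a0])
      then have "?dim = 1" unfolding img by (intro op_dim_1[of e _ 0]) auto
      then show ?thesis using False Supp3c by simp
    next
      case True
      then obtain r where r: "r < ?m" "?n = of_nat (Suc r)" unfolding int_interval_of_nat_iff by blast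
      have ar: "coef_a \<nu> r = 0" unfolding a by (rule r(2))
      have aj: "coef_a \<nu> j \<noteq> 0" if "j < ?m" "j \<noteq> r" for j
        unfolding a r(2) of_nat_eq_iff using that by simp
      \<comment> \<open>As \<open>?n = Suc r\<close>, the interval from 1 to \<open>?n\<close>
        consists of the values i + 1 with \<open>i \<le> r\<close>, which are the parameters at
        which \<open>coef_b\<close> vanishes no later than \<open>r\<close>.\<close>
      have \<kappa>: "?\<kappa> \<in> int_interval 1 (Re ?n) \<longleftrightarrow> (\<exists>i\<le>r. coef_b p q l \<nu> i = 0)"
      proof -
        have "Re ?n = real (Suc r)" unfolding r(2) by simp
        then show ?thesis
          unfolding int_interval_of_nat_iff[of ?\<kappa> "Suc r", folded \<open>Re ?n = real (Suc r)\<close>]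
          using b r(1) by (metis le_less_trans less_Suc_eq_le)
      qed
      show ?thesis
      proof (cases "\<exists>i\<le>r. coef_b p q l \<nu> i = 0")
        case True': True
        then obtain i where i: "i \<le> r" "coef_b p q l \<nu> i = 0" by blast
        obtain e e' where "e \<in> ?A" "e' \<in> ?A" "e 0 = 1" "e' 0 = 0" "e' (Suc r) = 1"
          "\<forall>t\<in>?A. \<exists>y z. \<forall>j\<le>?m. t j = y * e j + z * e' j"
          by (rule two_term_singular_2[of r ?m "coef_a \<nu>" i "coef_b p q l \<nu>", OF r(1) ar aj i])
        then have "?dim = 2" unfolding img using r(1) by (intro op_dim_2[of e _ e' "Suc r"]) auto
        then show ?thesis using True True' Supp3c \<kappa> by simp
      next
        case False
        then have b0: "coef_b p q l \<nu> i \<noteq> 0" if "i \<le> r" for i using that by blast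
        obtain e k where "k \<le> ?m" "e \<in> ?A" "e k = 1" "\<forall>t\<in>?A. \<exists>z. \<forall>j\<le>?m. t j = z * e j"
          by (rule two_term_singular_1[of r ?m "coef_a \<nu>" "coef_b p q l \<nu>", OF r(1) ar aj b0])
        then have "?dim = 1" unfolding img by (intro op_dim_1[of e _ k]) auto
        then show ?thesis using False Supp3c \<kappa> by simp
      qed
    qed
    then have "?dim \<in> {1, 2}" "?dim = 2 \<longleftrightarrow> (\<xi>, \<eta>, l, \<nu>) \<in> Supp3c" by auto
    moreover have "Diff_SBO \<xi> l \<eta> \<nu> \<noteq> {0}"
    proof
      assume "Diff_SBO \<xi> l \<eta> \<nu> = {0}"
      from dim0[OF this] \<open>?dim \<in> {1, 2}\<close> show False by simp
    qed
    ultimately show ?thesis using True by blast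
  qed
qed

end
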